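(* Let $\alpha^\pm\in\mathcal A_+^{m^\pm}$, let $f:\mathbb R\to\mathbb R$ be continuous and suppose that the limits $f_{\pm\infty}:=\lim_{s\to\pm\infty}f(s)/s$ exist and satisfy $0<f_{\pm\infty}<\infty$. Consider, for $h\in\tilde Y=L^1(-1,1)$, the problem $$( * )\qquad -u''=f(u)+h\ \text{ a.e. on }(-1,1),\qquad u\in\tilde X.$$ (A) If $1\in\Lambda_k^1(f_\infty,f_{-\infty})$ for some $k\ge0$, then for any $h\in\tilde Y$ equation $( * )$ has a solution $u\in\tilde X$. (B) If $1\in\Lambda_k^0(f_\infty,f_{-\infty})$ for some $k\ge1$, then there exist $h_0,h_2\in\tilde Y$ such that if $h=h_0$ then equation $( * )$ has no solution, while if $h=h_2$ then equation $( * )$ has two solutions.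
   Context: For an integer $m\ge1$, $\mathcal A_+^m$ is the set of $\alpha\in\mathbb R^m$ with $\alpha_i\ge0$ for all $i$ and $\sum_{i=1}^m\alpha_i<1$. Fixed data: integers $m^\pm\ge1$, coefficients $\alpha^\pm\in\mathcal A_+^{m^\pm}$, points $\eta^\pm\in(-1,1)^{m^\pm}$. The boundary conditions are (BC) $u(\pm1)=\sum_{i=1}^{m^\pm}\alpha_i^\pm u(\eta_i^\pm)$ (one condition at each of $-1$ and $+1$). Let $X:=\{u\in C^2[-1,1]:u\text{ satisfies (BC)}\}$ and $\tilde X:=\{u\in W^{2,1}(-1,1):u\text{ satisfies (BC)}\}$. Write $u^\pm(x)=\max\{\pm u(x),0\}$, and $f(u)$ for the function $x\mapsto f(u(x))$. A zero $x_0$ of a $C^1$ function $v$ is simple if $v'(x_0)\neq0$. For $k\ge1$, $\nu\in\{\pm\}$, $T_{k,\nu}\subset X$ is the set of $u\in X$ such that: (a) $u'(\pm1)\ne0$ and $\nu u'(-1)>0$; (b) $u'$ has only simple zeros in $(-1,1)$, and has exactly $k$ such zeros; (c) $u$ has a zero strictly between each pair of consecutive zeros of $u'$. It is known that for $a,b>0$, $k\ge1$, $\nu\in\{\pm\}$ there is exactly one $\lambda>0$, denoted $\lambda_{k,\nu}(a,b)$, such that $-u''=\lambda(au^+-bu^-)$ on $(-1,1)$, $u\in X$, has a solution $u\in T_{k,\nu}$; moreover these are the only $\lambda$ for which this problem has a non-trivial solution, and $\lambda_{k',\nu'}(a,b)>\lambda_{k,\nu}(a,b)$ whenever $k'>k$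 and $\nu,\nu'\in\{\pm\}$. For $k\ge1$ put $\lambda_{k,\max}=\max\{\lambda_{k,+}(a,b),\lambda_{k,-}(a,b)\}$, $\lambda_{k,\min}=\min\{\lambda_{k,+}(a,b),\lambda_{k,-}(a,b)\}$, and define the (possibly empty) open interval $\Lambda_k^0(a,b)=(\lambda_{k,\min},\lambda_{k,\max})$, empty if $\lambda_{k,\min}=\lambda_{k,\max}$, and $\Lambda_k^1(a,b)=(\lambda_{k,\max},\lambda_{k+1,\min})$ for $k\ge1$, $\Lambda_0^1(a,b)=(-\infty,\lambda_{1,\min})$. *)

theory Defs
  imports "HOL-Analysis.Analysis"
begin

text \<open>
  Functions on $[-1,1]$ are represented by functions \<open>real \<Rightarrow> real\<close> of which only the
  restriction to \<open>{-1..1}\<close> is relevant; no definition below depends on values outside it.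
  The data $m^\pm, \alpha^\pm, \eta^\pm$ are families indexed by a sign, a vector
  in $R^m$ being a function of which only the entries \<open>1..m\<close> matter.
\<close>

datatype sign = Plus | Minus

fun sval :: "sign \<Rightarrow> real" where
  "sval Plus = 1"
| "sval Minus = -1"

definition A_plus :: "nat \<Rightarrow> (nat \<Rightarrow> real) set" where
  "A_plus m = {\<alpha>. (\<forall>i\<in>{1..m}. 0 \<le> \<alpha> i) \<and> (\<Sum>i=1..m. \<alpha> i) < 1}"

definition BC :: "(sign \<Rightarrow> nat) \<Rightarrow> (sign \<Rightarrow> nat \<Rightarrow> real) \<Rightarrow> (sign \<Rightarrow> nat \<Rightarrow> real)
    \<Rightarrow> (real \<Rightarrow> real) \<Rightarrow> bool" where
  "BC m \<alpha> \<eta> u \<longleftrightarrow> (\<forall>\<sigma>. u (sval \<sigma>) = (\<Sum>i=1..m \<sigma>. \<alpha> \<sigma> i * u (\<eta> \<sigma> i)))"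


subsection \<open>Classical functions and the half-eigenvalues\<close>

text \<open>The derivative relative to $[-1,1]$, hence one-sided at the end points.\<close>

definition D :: "(real \<Rightarrow> real) \<Rightarrow> real \<Rightarrow> real" where
  "D u x = vector_derivative u (at x within {-1..1})"

definition C2 :: "(real \<Rightarrow> real) set" where
  "C2 = {u. u differentiable_on {-1..1} \<and> D u differentiable_on {-1..1} \<and>
            continuous_on {-1..1} (D (D u))}"

definition X_space :: "(sign \<Rightarrow> nat) \<Rightarrow> (sign \<Rightarrow> nat \<Rightarrow> real) \<Rightarrow> (sign \<Rightarrow> nat \<Rightarrow> real)
    \<Rightarrow> (real \<Rightarrow> real) set" where
  "X_space m \<alpha> \<eta> = {u \<in> C2. BC m \<alpha> \<eta> u}"

definition simple_zero :: "(real \<Rightarrow> real) \<Rightarrow> real \<Rightarrow> bool" where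
  "simple_zero v x \<longleftrightarrow> v x = 0 \<and> D v x \<noteq> 0"

definition crit :: "(real \<Rightarrow> real) \<Rightarrow> real set" where
  "crit u = {x \<in> {-1<..<1}. D u x = 0}"

definition T_set :: "(sign \<Rightarrow> nat) \<Rightarrow> (sign \<Rightarrow> nat \<Rightarrow> real) \<Rightarrow> (sign \<Rightarrow> nat \<Rightarrow> real)
    \<Rightarrow> nat \<Rightarrow> sign \<Rightarrow> (real \<Rightarrow> real) set" where
  "T_set m \<alpha> \<eta> k \<nu> = {u \<in> X_space m \<alpha> \<eta>.
     D u (-1) \<noteq> 0 \<and> D u 1 \<noteq> 0 \<and> sval \<nu> * D u (-1) > 0 \<and>
     (\<forall>x\<in>crit u. simple_zero (D u) x) \<and> finite (crit u) \<and> card (crit u) = k \<and>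
     (\<forall>x\<in>crit u. \<forall>y\<in>crit u. x < y \<and> crit u \<inter> {x<..<y} = {} \<longrightarrow> (\<exists>z\<in>{x<..<y}. u z = 0))}"

definition half_eigen_solution :: "real \<Rightarrow> real \<Rightarrow> real \<Rightarrow> (real \<Rightarrow> real) \<Rightarrow> bool" where
  "half_eigen_solution a b l u \<longleftrightarrow>
     (\<forall>x\<in>{-1<..<1}. - D (D u) x = l * (a * max (u x) 0 - b * max (- u x) 0))"

definition half_eigenvalue :: "(sign \<Rightarrow> nat) \<Rightarrow> (sign \<Rightarrow> nat \<Rightarrow> real) \<Rightarrow> (sign \<Rightarrow> nat \<Rightarrow> real)
    \<Rightarrow> nat \<Rightarrow> sign \<Rightarrow> real \<Rightarrow> real \<Rightarrow> real" where
  "half_eigenvalue m \<alpha> \<eta> k \<nu> a b =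
     (THE l. l > 0 \<and> (\<exists>u\<in>T_set m \<alpha> \<eta> k \<nu>. half_eigen_solution a b l u))"

definition lam_max :: "(sign \<Rightarrow> nat) \<Rightarrow> (sign \<Rightarrow> nat \<Rightarrow> real) \<Rightarrow> (sign \<Rightarrow> nat \<Rightarrow> real)
    \<Rightarrow> nat \<Rightarrow> real \<Rightarrow> real \<Rightarrow> real" where
  "lam_max m \<alpha> \<eta> k a b =
     max (half_eigenvalue m \<alpha> \<eta> k Plus a b) (half_eigenvalue m \<alpha> \<eta> k Minus a b)"

definition lam_min :: "(sign \<Rightarrow> nat) \<Rightarrow> (sign \<Rightarrow> nat \<Rightarrow> real) \<Rightarrow> (sign \<Rightarrow> nat \<Rightarrow> real)
    \<Rightarrow> nat \<Rightarrow> real \<Rightarrow> real \<Rightarrow> real" where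
  "lam_min m \<alpha> \<eta> k a b =
     min (half_eigenvalue m \<alpha> \<eta> k Plus a b) (half_eigenvalue m \<alpha> \<eta> k Minus a b)"

definition Lambda0 :: "(sign \<Rightarrow> nat) \<Rightarrow> (sign \<Rightarrow> nat \<Rightarrow> real) \<Rightarrow> (sign \<Rightarrow> nat \<Rightarrow> real)
    \<Rightarrow> nat \<Rightarrow> real \<Rightarrow> real \<Rightarrow> real set" where
  "Lambda0 m \<alpha> \<eta> k a b = {lam_min m \<alpha> \<eta> k a b <..< lam_max m \<alpha> \<eta> k a b}"

definition Lambda1 :: "(sign \<Rightarrow> nat) \<Rightarrow> (sign \<Rightarrow> nat \<Rightarrow> real) \<Rightarrow> (sign \<Rightarrow> nat \<Rightarrow> real)
    \<Rightarrow> nat \<Rightarrow> real \<Rightarrow> real \<Rightarrow> real set" where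
  "Lambda1 m \<alpha> \<eta> k a b =
     (if k = 0 then {..< lam_min m \<alpha> \<eta> 1 a b}
      else {lam_max m \<alpha> \<eta> k a b <..< lam_min m \<alpha> \<eta> (k + 1) a b})"


subsection \<open>The Sobolev space and the inhomogeneous problem\<close>

definition L1 :: "(real \<Rightarrow> real) set" where
  "L1 = {h. h absolutely_integrable_on {-1<..<1}}"

definition test_function :: "(real \<Rightarrow> real) \<Rightarrow> bool" where
  "test_function \<phi> \<longleftrightarrow> (\<forall>n x. (deriv ^^ n) \<phi> differentiable (at x)) \<and>
     closure {x. \<phi> x \<noteq> 0} \<subseteq> {-1<..<1}"

definition weak_deriv :: "(real \<Rightarrow> real) \<Rightarrow> (real \<Rightarrow> real) \<Rightarrow> bool" where
  "weak_deriv u v \<longleftrightarrow> (\<forall>\<phi>. test_function \<phi> \<longrightarrow>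
     integral {-1<..<1} (\<lambda>x. u x * deriv \<phi> x) = - integral {-1<..<1} (\<lambda>x. v x * \<phi> x))"

definition weak_second_deriv :: "(real \<Rightarrow> real) \<Rightarrow> (real \<Rightarrow> real) \<Rightarrow> bool" where
  "weak_second_deriv u w \<longleftrightarrow> w \<in> L1 \<and> (\<exists>v\<in>L1. weak_deriv u v \<and> weak_deriv v w)"

text \<open>
  The boundary condition requires point values, so an element of $W^{2,1}(-1,1)$ is
  represented by its continuous representative on $[-1,1]$ (which is in $L^1$).
\<close>

definition W21 :: "(real \<Rightarrow> real) set" where
  "W21 = {u. continuous_on {-1..1} u \<and> (\<exists>w. weak_second_deriv u w)}"

definition X_tilde :: "(sign \<Rightarrow> nat) \<Rightarrow> (sign \<Rightarrow> nat \<Rightarrow> real) \<Rightarrow> (sign \<Rightarrow> nat \<Rightarrow> real)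
    \<Rightarrow> (real \<Rightarrow> real) set" where
  "X_tilde m \<alpha> \<eta> = {u \<in> W21. BC m \<alpha> \<eta> u}"

definition is_solution :: "(sign \<Rightarrow> nat) \<Rightarrow> (sign \<Rightarrow> nat \<Rightarrow> real) \<Rightarrow> (sign \<Rightarrow> nat \<Rightarrow> real)
    \<Rightarrow> (real \<Rightarrow> real) \<Rightarrow> (real \<Rightarrow> real) \<Rightarrow> (real \<Rightarrow> real) \<Rightarrow> bool" where
  "is_solution m \<alpha> \<eta> f h u \<longleftrightarrow> u \<in> X_tilde m \<alpha> \<eta> \<and>
     (\<exists>w. weak_second_deriv u w \<and> (AE x\<in>{-1<..<1} in lebesgue. - w x = f (u x) + h x))"

end

theory Submission
  imports Defs "HOL-Complex_Analysis.Great_Picard"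
begin

text \<open>
  Every solution of $-v''=\lambda(av^+-bv^-)$ is a multiple of $x\mapsto S(\sqrt\lambda\,x+\theta)$ for one
  periodic function $S$. Since the energy curve of $S$ bounds a convex set, a subconvex boundary condition
  is met by exactly one phase $\theta$ in each interval of monotonicity; the phases for the left condition
  increase and those for the right condition decrease with $\sqrt\lambda$, so that half-eigenvalues are
  crossings of two monotone curves, and the position of 1 relative to them tells on which side of the right
  condition the two rays of initial data lie which satisfy the left one. The rays lie on different sides in
  case (A) and on the same side in case (B).

  The nonlinear problem is a perturbation of size $\varepsilon|z|+C$ of this positively homogeneous problem in the
  initial data $z=(u(-1),u'(-1))$. In case (A) the two residuals satisfy the sign conditions of the
  Poincare-Miranda theorem on a large box around the rays. In case (B) let $h$ be $-J$ times the second
  derivative of a bump near 1 that vanishes at all $\eta_i$: up to small terms it shifts only the right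
  residual, by $J$. For large $J$ of one sign the residuals have no common zero; for the other sign there is
  one box along each ray. Continuous $f$ are reached through Lipschitz approximations and compactness.
\<close>

subsection \<open>Primitives of integrable functions\<close>

text \<open>The obstacles are analytic. The weak equation with integrable \<open>h\<close> becomes
  an integral equation in which \<open>h\<close> enters only through the continuous function H =
  -\<open>int2 h\<close>. A continuous \<open>f\<close> need not determine a solution by its initial
  data, so shooting is carried out for Lipschitz nonlinearities only; the sign conditions on a box
  are imposed on every nonlinearity within e|s| + C of \<open>hl a b\<close>, which makes them
  survive the approximation. In the plane the coordinates are p, the slope datum, and q, the offset
  of the value datum from the rays. The phases of the rays are never extrema of \<open>S\<close>, so
  the slope does not vanish on a ray and the two rays form a graph over p. The left residual has the
  sign of q; on q = 0 the right residual is linear on each half line, with slopes \<open>kP\<close>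
  and \<open>kM\<close>. Slopes of equal sign give a change of sign in p; slopes of opposite sign
  give a residual of one sign, which a shift moves away from zero or makes cross zero twice. The
  forcing has to be concentrated because its shift J grows with the box: the comparison estimate
  sees only the integral of |H|, which is small compared with J.\<close>

definition int2 :: "(real \<Rightarrow> real) \<Rightarrow> real \<Rightarrow> real" where
  "int2 w x = integral {-1..x} (\<lambda>s. (x - s) * w s)"

lemma L1_iff: "w \<in> L1 \<longleftrightarrow> w absolutely_integrable_on {-1..1}"
  using absolutely_integrable_on_open_interval[where f=w and a="-1::real" and b=1] by (simp add: L1_def)

lemma absolutely_integrable_mult_continuous:
  fixes w k :: "real \<Rightarrow> real"
  assumes "w absolutely_integrable_on {a..b}" "continuous_on {a..b} k"
  shows "(\<lambda>s. k s * w s) absolutely_integrable_on {a..b}"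
proof (rule absolutely_integrable_bounded_measurable_product_real)
  show "k \<in> borel_measurable (lebesgue_on {a..b})"
    using assms(2) by (intro continuous_imp_measurable_on_sets_lebesgue) auto
  show "bounded (k ` {a..b})"
    using assms(2) compact_continuous_image compact_imp_bounded by blast
qed (use assms in auto)

lemma integral_diff_interval:
  fixes w :: "real \<Rightarrow> real"
  assumes "w integrable_on {-1..1}" "-1 \<le> x" "x \<le> y" "y \<le> 1"
  shows "integral {-1..y} w - integral {-1..x} w = integral {x..y} w"
proof -
  have "w integrable_on {-1..y}"
    using integrable_subinterval_real[OF assms(1), of "-1" y] assms by auto
  then show ?thesis
    using Henstock_Kurzweil_Integration.integral_combine[of "-1" x y w] assms by simp
qed

text \<open>As \<open>A\<close> is continuous, the error is o(|y - x|). In the applications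
  \<open>A\<close> is the primitive of |w|, so a derivative is obtained at every point although
  \<open>w\<close> is merely integrable.\<close>

lemma derivative_if_increment_bound:
  fixes G A :: "real \<Rightarrow> real"
  assumes A: "continuous_on {-1..1} A" and x: "x \<in> {-1..1}"
    and bd: "\<And>y. y \<in> {-1..1} \<Longrightarrow> \<bar>G y - G x - (y - x) * V\<bar> \<le> K * \<bar>y - x\<bar> * \<bar>A y - A x\<bar>"
  shows "(G has_real_derivative V) (at x within {-1..1})"
proof -
  have "(A \<longlongrightarrow> A x) (at x within {-1..1})"
    using A x by (simp add: continuous_on)
  then have lim: "((\<lambda>y. K * \<bar>A y - A x\<bar>) \<longlongrightarrow> K * \<bar>A x - A x\<bar>) (at x within {-1..1})"
    by (intro tendsto_intros)
  have "((\<lambda>y. (G y - G x) / (y - x) - V) \<longlongrightarrow> 0) (at x within {-1..1})"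
  proof (rule Lim_null_comparison)
    show "\<forall>\<^sub>F y in at x within {-1..1}. norm ((G y - G x) / (y - x) - V) \<le> K * \<bar>A y - A x\<bar>"
      unfolding eventually_at_filter
    proof (intro always_eventually allI impI)
      fix y :: real assume y: "y \<noteq> x" "y \<in> {-1..1}"
      have "\<bar>(G y - G x) / (y - x) - V\<bar> = \<bar>G y - G x - (y - x) * V\<bar> / \<bar>y - x\<bar>"
        using y by (simp add: diff_divide_distrib flip: abs_divide)
      also have "\<dots> \<le> K * \<bar>y - x\<bar> * \<bar>A y - A x\<bar> / \<bar>y - x\<bar>"
        using divide_right_mono[OF bd[OF y(2)], of "\<bar>y - x\<bar>"] by simp
      also have "\<dots> = K * \<bar>A y - A x\<bar>" using y by simp
      finally show "norm ((G y - G x) / (y - x) - V) \<le> K * \<bar>A y - A x\<bar>" by simp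
    qed
  qed (use lim in simp)
  then have "((\<lambda>y. (G y - G x) / (y - x)) \<longlongrightarrow> V) (at x within {-1..1})"
    using LIM_zero_iff by blast
  then show ?thesis by (simp add: has_field_derivative_iff)
qed

lemma abs_integral_interval_le:
  fixes w k :: "real \<Rightarrow> real"
  assumes w: "w absolutely_integrable_on {-1..1}" and k: "continuous_on {-1..1} k"
    and I: "-1 \<le> x" "x \<le> y" "y \<le> 1" and bd: "\<And>s. s \<in> {x..y} \<Longrightarrow> \<bar>k s\<bar> \<le> B"
  shows "\<bar>integral {x..y} (\<lambda>s. k s * w s)\<bar>
    \<le> B * (integral {-1..y} (\<lambda>s. \<bar>w s\<bar>) - integral {-1..x} (\<lambda>s. \<bar>w s\<bar>))"
proof -
  have sub: "{x..y} \<subseteq> {-1..1}" using I by auto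
  have w': "w absolutely_integrable_on {x..y}"
    using absolutely_integrable_on_subinterval[OF w sub] .
  have kw: "(\<lambda>s. k s * w s) integrable_on {x..y}"
    by (rule absolutely_integrable_on_def[THEN iffD1, THEN conjunct1],
        rule absolutely_integrable_mult_continuous[OF w' continuous_on_subset[OF k sub]])
  have aw: "(\<lambda>s. \<bar>w s\<bar>) integrable_on {-1..1}" "(\<lambda>s. \<bar>w s\<bar>) integrable_on {x..y}"
    using w w' by (auto simp: absolutely_integrable_on_def)
  have "norm (integral {x..y} (\<lambda>s. k s * w s)) \<le> integral {x..y} (\<lambda>s. B * \<bar>w s\<bar>)"
    by (intro integral_norm_bound_integral kw integrable_on_mult_right aw)
       (use bd in \<open>auto simp: abs_mult intro: mult_right_mono\<close>)
  also have "\<dots> = B * (integral {-1..y} (\<lambda>s. \<bar>w s\<bar>) - integral {-1..x} (\<lambda>s. \<bar>w s\<bar>))"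
    using integral_diff_interval[OF aw(1) I] by simp
  finally show ?thesis by simp
qed

lemma integrable_mult_continuous:
  fixes w k :: "real \<Rightarrow> real"
  assumes "w absolutely_integrable_on {-1..1}" "continuous_on {-1..1} k" "-1 \<le> x" "y \<le> 1"
  shows "(\<lambda>s. k s * w s) integrable_on {x..y}"
proof -
  have "{x..y} \<subseteq> {-1..1}" using assms by auto
  moreover have "(\<lambda>s. k s * w s) integrable_on {-1..1}"
    using absolutely_integrable_mult_continuous[OF assms(1,2)]
    by (simp add: absolutely_integrable_on_def)
  ultimately show ?thesis using integrable_subinterval_real by blast
qed

lemma int2_eq:
  assumes "w absolutely_integrable_on {-1..1}" "x \<in> {-1..1}"
  shows "int2 w x = x * integral {-1..x} w - integral {-1..x} (\<lambda>s. s * w s)"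
proof -
  have "int2 w x = integral {-1..x} (\<lambda>s. x * w s - s * w s)"
    unfolding int2_def by (simp add: algebra_simps)
  also have "\<dots> = integral {-1..x} (\<lambda>s. x * w s) - integral {-1..x} (\<lambda>s. s * w s)"
    using assms by (intro integral_diff integrable_mult_continuous) (auto intro!: continuous_intros)
  finally show ?thesis by simp
qed

lemma continuous_on_abs_primitive:
  fixes w :: "real \<Rightarrow> real"
  assumes "w absolutely_integrable_on {-1..1}"
  shows "continuous_on {-1..1} (\<lambda>x. integral {-1..x} (\<lambda>s. \<bar>w s\<bar>))"
  using assms by (intro indefinite_integral_continuous_1) (auto simp: absolutely_integrable_on_def)

lemma continuous_on_primitive:
  fixes w :: "real \<Rightarrow> real"
  assumes "w absolutely_integrable_on {-1..1}"
  shows "continuous_on {-1..1} (\<lambda>x. integral {-1..x} w)"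
  using assms by (intro indefinite_integral_continuous_1) (auto simp: absolutely_integrable_on_def)

text \<open>The deviation from linearity is the integral of (y - s) w(s) between x and y, where |y -
  s| is at most |y - x|; so it is bounded by |y - x| times the increment of the primitive of
  |w|.\<close>

lemma int2_has_derivative:
  assumes w: "w absolutely_integrable_on {-1..1}" and x: "x \<in> {-1..1}"
  shows "(int2 w has_real_derivative integral {-1..x} w) (at x within {-1..1})"
proof (rule derivative_if_increment_bound[OF continuous_on_abs_primitive[OF w] x, where K=1])
  fix y :: real assume y: "y \<in> {-1..1}"
  define k where "k s = y - s" for s
  have wi: "w integrable_on {-1..1}" "(\<lambda>s. s * w s) integrable_on {-1..1}"
    using w integrable_mult_continuous[OF w, of "\<lambda>s. s" "-1" 1]
    by (auto simp: absolutely_integrable_on_def)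
  have *: "int2 w y - int2 w x - (y - x) * integral {-1..x} w
      = y * (integral {-1..y} w - integral {-1..x} w)
        - (integral {-1..y} (\<lambda>s. s * w s) - integral {-1..x} (\<lambda>s. s * w s))"
    unfolding int2_eq[OF w x] int2_eq[OF w y] by (simp add: algebra_simps)
  have kc: "continuous_on {-1..1} k" unfolding k_def by (intro continuous_intros)
  have **: "y * integral {p..q} w - integral {p..q} (\<lambda>s. s * w s) = integral {p..q} (\<lambda>s. k s * w s)"
    if "-1 \<le> p" "p \<le> q" "q \<le> 1" for p q
  proof -
    have "integral {p..q} (\<lambda>s. k s * w s) = integral {p..q} (\<lambda>s. y * w s - s * w s)"
      unfolding k_def by (simp add: algebra_simps)
    also have "\<dots> = integral {p..q} (\<lambda>s. y * w s) - integral {p..q} (\<lambda>s. s * w s)"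
      using w that by (intro integral_diff integrable_mult_continuous) (auto intro!: continuous_intros)
    finally show ?thesis by simp
  qed
  show "\<bar>int2 w y - int2 w x - (y - x) * integral {-1..x} w\<bar> \<le> 1 * \<bar>y - x\<bar> *
      \<bar>integral {-1..y} (\<lambda>s. \<bar>w s\<bar>) - integral {-1..x} (\<lambda>s. \<bar>w s\<bar>)\<bar>"
  proof (cases "x \<le> y")
    case True
    have "int2 w y - int2 w x - (y - x) * integral {-1..x} w = integral {x..y} (\<lambda>s. k s * w s)"
      unfolding * using integral_diff_interval[OF wi(1), of x y] integral_diff_interval[OF wi(2), of x y]
        **[of x y] x y True by simp
    moreover have "\<bar>integral {x..y} (\<lambda>s. k s * w s)\<bar> \<le> (y - x) *
        (integral {-1..y} (\<lambda>s. \<bar>w s\<bar>) - integral {-1..x} (\<lambda>s. \<bar>w s\<bar>))"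
      by (rule abs_integral_interval_le[OF w kc]) (use x y True in \<open>auto simp: k_def\<close>)
    ultimately show ?thesis using True
      by (smt (verit, best) mult_left_mono)
  next
    case False
    have "int2 w y - int2 w x - (y - x) * integral {-1..x} w = - integral {y..x} (\<lambda>s. k s * w s)"
      unfolding * using integral_diff_interval[OF wi(1), of y x] integral_diff_interval[OF wi(2), of y x]
        **[of y x] x y False by (simp add: algebra_simps)
    moreover have "\<bar>integral {y..x} (\<lambda>s. k s * w s)\<bar> \<le> (x - y) *
        (integral {-1..x} (\<lambda>s. \<bar>w s\<bar>) - integral {-1..y} (\<lambda>s. \<bar>w s\<bar>))"
      by (rule abs_integral_interval_le[OF w kc]) (use x y False in \<open>auto simp: k_def\<close>)
    ultimately show ?thesis using False
      by (smt (verit, best) mult_left_mono)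
  qed
qed

text \<open>Cauchy's formula for repeated integration, by the fundamental theorem of calculus for
  the derivative just found.\<close>

lemma int2_eq_integral:
  assumes w: "w absolutely_integrable_on {-1..1}" and x: "x \<in> {-1..1}"
  shows "int2 w x = integral {-1..x} (\<lambda>t. integral {-1..t} w)"
proof -
  have "((\<lambda>t. integral {-1..t} w) has_integral (int2 w x - int2 w (-1))) {-1..x}"
  proof (rule fundamental_theorem_of_calculus)
    fix t assume "t \<in> {-1..x}"
    then show "(int2 w has_vector_derivative integral {-1..t} w) (at t within {-1..x})"
      using DERIV_subset[OF int2_has_derivative[OF w], of t "{-1..x}"] x
      by (auto simp: has_real_derivative_iff_has_vector_derivative)
  qed (use x in auto)
  moreover have "int2 w (-1) = 0" by (simp add: int2_def)
  ultimately show ?thesis by (simp add: integral_unique)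
qed

lemma continuous_on_int2:
  assumes w: "w absolutely_integrable_on {-1..1}"
  shows "continuous_on {-1..1} (int2 w)"
  using int2_has_derivative[OF w] by (meson DERIV_continuous continuous_on_eq_continuous_within)

text \<open>The increment of the difference of both sides is $o(|y-x|)$, so no theory of absolutely
  continuous functions is needed.\<close>

lemma integration_by_parts_primitive:
  fixes w \<phi> \<phi>' :: "real \<Rightarrow> real"
  assumes w: "w absolutely_integrable_on {-1..1}"
    and d: "\<And>x. x \<in> {-1..1} \<Longrightarrow> (\<phi> has_real_derivative \<phi>' x) (at x within {-1..1})"
    and c: "continuous_on {-1..1} \<phi>'"
  shows "integral {-1..1} (\<lambda>x. integral {-1..x} w * \<phi>' x) + integral {-1..1} (\<lambda>x. w x * \<phi> x)
    = integral {-1..1} w * \<phi> 1"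
proof -
  define V where "V x = integral {-1..x} w" for x
  define A where "A x = integral {-1..x} (\<lambda>s. \<bar>w s\<bar>)" for x
  have Vc: "continuous_on {-1..1} V" unfolding V_def by (rule continuous_on_primitive[OF w])
  have Ac: "continuous_on {-1..1} A" unfolding A_def by (rule continuous_on_abs_primitive[OF w])
  have \<phi>c: "continuous_on {-1..1} \<phi>"
    using d by (meson DERIV_continuous continuous_on_eq_continuous_within)
  obtain L where L: "\<And>x. x \<in> {-1..1} \<Longrightarrow> \<bar>\<phi>' x\<bar> \<le> L"
    using compact_imp_bounded[OF compact_continuous_image[OF c compact_Icc]]
    unfolding bounded_iff by (metis imageI real_norm_def)
  have L0: "0 \<le> L" using L[of 0] by auto
  have lip: "\<bar>\<phi> y - \<phi> x\<bar> \<le> L * \<bar>y - x\<bar>" if "x \<in> {-1..1}" "y \<in> {-1..1}" for x y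
  proof -
    have "norm (\<phi> y - \<phi> x) \<le> L * norm (y - x)"
      by (rule field_differentiable_bound[of "{-1..1}" \<phi> \<phi>']) (use d L that in auto)
    then show ?thesis by simp
  qed
  have wi: "w integrable_on {-1..1}" using w by (simp add: absolutely_integrable_on_def)
  have i1: "(\<lambda>x. V x * \<phi>' x) integrable_on {p..q}" if "-1 \<le> p" "q \<le> 1" for p q
    by (rule integrable_subinterval_real[OF integrable_continuous_real[of "-1" 1]])
       (use that in \<open>auto intro!: continuous_intros Vc c\<close>)
  have i2: "(\<lambda>x. w x * \<phi> x) integrable_on {p..q}" if "-1 \<le> p" "q \<le> 1" for p q
    using integrable_mult_continuous[OF w \<phi>c that] by (simp add: mult.commute)
  define G where "G x = V x * \<phi> x - integral {-1..x} (\<lambda>x. V x * \<phi>' x) - integral {-1..x} (\<lambda>x. w x * \<phi> x)" for x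
  have Vd: "\<bar>V s - V x\<bar> \<le> A y - A x" if "-1 \<le> x" "x \<le> s" "s \<le> y" "y \<le> 1" for x s y
  proof -
    have aw: "(\<lambda>s. \<bar>w s\<bar>) integrable_on {-1..1}" using w by (simp add: absolutely_integrable_on_def)
    have "\<bar>integral {x..s} w\<bar> \<le> A s - A x"
      using abs_integral_interval_le[OF w, of "\<lambda>_. 1" x s 1] that by (simp add: A_def)
    moreover have "V s - V x = integral {x..s} w"
      unfolding V_def by (rule integral_diff_interval[OF wi]) (use that in auto)
    moreover have "0 \<le> integral {s..y} (\<lambda>s. \<bar>w s\<bar>)"
      by (intro integral_nonneg integrable_subinterval_real[OF aw]) (use that in auto)
    moreover have "integral {s..y} (\<lambda>s. \<bar>w s\<bar>) = A y - A s"
      unfolding A_def by (rule integral_diff_interval[OF aw, symmetric]) (use that in auto)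
    ultimately show ?thesis by linarith
  qed
  \<comment> \<open>The increment of \<open>G\<close> splits into the integrals of (\<phi> y -
    \<phi> s) w(s) and of (V s - V x) \<phi>'(s). Each is a product of a factor of order y - x and a
    factor of order A y - A x.\<close>
  have bd: "\<bar>G y - G x\<bar> \<le> (2 * L) * (y - x) * (A y - A x)" if I: "-1 \<le> x" "x \<le> y" "y \<le> 1" for x y
  proof -
    have kc: "continuous_on {-1..1} (\<lambda>s. \<phi> y - \<phi> s)" by (intro continuous_intros \<phi>c)
    have "integral {x..y} (\<lambda>s. (\<phi> y - \<phi> s) * w s) = integral {x..y} (\<lambda>s. \<phi> y * w s - w s * \<phi> s)"
      by (simp add: algebra_simps)
    also have "\<dots> = integral {x..y} (\<lambda>s. \<phi> y * w s) - integral {x..y} (\<lambda>s. w s * \<phi> s)"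
      using I by (intro integral_diff i2 integrable_mult_continuous[OF w]) auto
    also have "\<dots> = \<phi> y * (V y - V x) - integral {x..y} (\<lambda>s. w s * \<phi> s)"
      using integral_diff_interval[OF wi, of x y] I by (simp add: V_def)
    finally have e1: "integral {x..y} (\<lambda>s. (\<phi> y - \<phi> s) * w s)
      = \<phi> y * (V y - V x) - integral {x..y} (\<lambda>s. w s * \<phi> s)" .
    have "(\<phi>' has_integral (\<phi> y - \<phi> x)) {x..y}"
    proof (rule fundamental_theorem_of_calculus[OF I(2)])
      fix t assume "t \<in> {x..y}"
      then show "(\<phi> has_vector_derivative \<phi>' t) (at t within {x..y})"
        using DERIV_subset[OF d, of t "{x..y}"] I
        by (auto simp: has_real_derivative_iff_has_vector_derivative)
    qed
    then have e2: "integral {x..y} \<phi>' = \<phi> y - \<phi> x" "\<phi>' integrable_on {x..y}"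
      by (auto simp: integral_unique)
    have i3: "(\<lambda>s. (V s - V x) * \<phi>' s) integrable_on {x..y}"
      by (rule integrable_continuous_real)
         (use I in \<open>auto intro!: continuous_intros continuous_on_subset[OF Vc] continuous_on_subset[OF c]\<close>)
    have "integral {x..y} (\<lambda>s. (V s - V x) * \<phi>' s) = integral {x..y} (\<lambda>s. V s * \<phi>' s - V x * \<phi>' s)"
      by (simp add: algebra_simps)
    also have "\<dots> = integral {x..y} (\<lambda>s. V s * \<phi>' s) - integral {x..y} (\<lambda>s. V x * \<phi>' s)"
      using I e2 by (intro integral_diff i1 integrable_on_mult_right) auto
    finally have e3: "integral {x..y} (\<lambda>s. (V s - V x) * \<phi>' s)
        = integral {x..y} (\<lambda>s. V s * \<phi>' s) - V x * (\<phi> y - \<phi> x)"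
      by (simp add: e2)
    have "G y - G x = V y * \<phi> y - V x * \<phi> x - integral {x..y} (\<lambda>s. V s * \<phi>' s)
        - integral {x..y} (\<lambda>s. w s * \<phi> s)"
      using integral_diff_interval[OF i1[of "-1" 1], of x y] integral_diff_interval[OF i2[of "-1" 1], of x y] I
      by (simp add: G_def)
    also have "\<dots> = integral {x..y} (\<lambda>s. (\<phi> y - \<phi> s) * w s) - integral {x..y} (\<lambda>s. (V s - V x) * \<phi>' s)"
      unfolding e1 e3 by (simp add: algebra_simps)
    finally have e: "G y - G x = \<dots>" .
    have "\<bar>\<phi> y - \<phi> s\<bar> \<le> L * (y - x)" if "s \<in> {x..y}" for s
      using lip[of s y] that I mult_left_mono[of "y - s" "y - x" L] L0 by auto
    then have b1: "\<bar>integral {x..y} (\<lambda>s. (\<phi> y - \<phi> s) * w s)\<bar> \<le> (L * (y - x)) * (A y - A x)"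
      using abs_integral_interval_le[OF w kc I, of "L * (y - x)"] by (simp add: A_def)
    have "norm (integral {x..y} (\<lambda>s. (V s - V x) * \<phi>' s)) \<le> integral {x..y} (\<lambda>s. (A y - A x) * L)"
    proof (intro integral_norm_bound_integral i3)
      fix s assume s: "s \<in> {x..y}"
      show "norm ((V s - V x) * \<phi>' s) \<le> (A y - A x) * L"
        unfolding norm_mult using Vd[of x s y] L[of s] s I by (intro mult_mono) auto
    qed auto
    then have b2: "\<bar>integral {x..y} (\<lambda>s. (V s - V x) * \<phi>' s)\<bar> \<le> (y - x) * ((A y - A x) * L)"
      using I by (simp add: mult_ac)
    show ?thesis unfolding e using b1 b2 by (simp add: algebra_simps)
  qed
  have "(G has_real_derivative 0) (at x within {-1..1})" if x: "x \<in> {-1..1}" for x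
  proof (rule derivative_if_increment_bound[OF Ac x, where K = "2 * L"])
    fix y :: real assume y: "y \<in> {-1..1}"
    show "\<bar>G y - G x - (y - x) * 0\<bar> \<le> 2 * L * \<bar>y - x\<bar> * \<bar>A y - A x\<bar>"
    proof (cases "x \<le> y")
      case True
      have "2 * L * (y - x) * (A y - A x) \<le> 2 * L * (y - x) * \<bar>A y - A x\<bar>"
        using True L0 by (intro mult_left_mono) auto
      then show ?thesis using bd[of x y] x y True by auto
    next
      case False
      have "2 * L * (x - y) * (A x - A y) \<le> 2 * L * (x - y) * \<bar>A y - A x\<bar>"
        using False L0 by (intro mult_left_mono) auto
      then show ?thesis using bd[of y x] x y False by (auto simp: abs_minus_commute)
    qed
  qed
  then obtain C where "\<And>x. x \<in> {-1..1} \<Longrightarrow> G x = C"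
    using has_field_derivative_zero_constant[of "{-1..1::real}" G] by auto
  then have "G 1 = G (-1)" by simp
  then show ?thesis by (simp add: G_def V_def)
qed

subsection \<open>Weak derivatives\<close>

lemma test_functionD:
  assumes "test_function \<phi>"
  shows "(\<phi> has_real_derivative deriv \<phi> x) (at x)" "continuous_on UNIV (deriv \<phi>)"
    "test_function (deriv \<phi>)" "\<exists>r<1. \<forall>x. \<phi> x \<noteq> 0 \<longrightarrow> \<bar>x\<bar> \<le> r"
proof -
  have d: "\<And>n x. (deriv ^^ n) \<phi> differentiable (at x)" and cl: "closure {x. \<phi> x \<noteq> 0} \<subseteq> {-1<..<1}"
    using assms by (auto simp: test_function_def)
  show d0: "(\<phi> has_real_derivative deriv \<phi> x) (at x)" for x
    using d[of 0 x] by (simp add: DERIV_deriv_iff_real_differentiable)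
  have "deriv \<phi> differentiable (at x)" for x using d[of 1 x] by simp
  then show "continuous_on UNIV (deriv \<phi>)"
    by (meson continuous_at_imp_continuous_on differentiable_imp_continuous_within)
  have bdd: "bounded (closure {x. \<phi> x \<noteq> 0})"
    by (rule bounded_subset[OF _ cl]) auto
  then have cp: "compact (closure {x. \<phi> x \<noteq> 0})" by (simp add: compact_eq_bounded_closed)
  show "\<exists>r<1. \<forall>x. \<phi> x \<noteq> 0 \<longrightarrow> \<bar>x\<bar> \<le> r"
  proof (cases "{x. \<phi> x \<noteq> 0} = {}")
    case True
    then show ?thesis by (intro exI[of _ 0]) auto
  next
    case False
    then have "closure {x. \<phi> x \<noteq> 0} \<noteq> {}" by simp
    moreover have "continuous_on (closure {x. \<phi> x \<noteq> 0}) (\<lambda>x. \<bar>x\<bar>)" by (intro continuous_intros)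
    ultimately obtain m where m: "m \<in> closure {x. \<phi> x \<noteq> 0}" "\<forall>x\<in>closure {x. \<phi> x \<noteq> 0}. \<bar>x\<bar> \<le> \<bar>m\<bar>"
      using continuous_attains_sup[OF cp] by blast
    then have "\<bar>m\<bar> < 1" using subsetD[OF cl m(1)] by auto
    moreover have "\<bar>x\<bar> \<le> \<bar>m\<bar>" if "\<phi> x \<noteq> 0" for x
      using m(2) subsetD[OF closure_subset, of x "{x. \<phi> x \<noteq> 0}"] that by auto
    ultimately show ?thesis by blast
  qed
  \<comment> \<open>Differentiation does not enlarge the support: \<phi> is zero near every point
    outside the closed support.\<close>
  have "deriv \<phi> x = 0" if x: "x \<notin> closure {x. \<phi> x \<noteq> 0}" for x
  proof -
    have "\<forall>\<^sub>F y in nhds x. y \<in> - closure {x. \<phi> x \<noteq> 0}"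
      using x by (intro eventually_nhds_in_open) auto
    then have ev: "\<forall>\<^sub>F y in nhds x. \<phi> y = 0"
      by eventually_elim (use subsetD[OF closure_subset, of _ "{x. \<phi> x \<noteq> 0}"] in auto)
    have "deriv \<phi> x = deriv (\<lambda>_. 0) x" by (rule deriv_cong_ev[OF ev refl])
    then show ?thesis by simp
  qed
  then have "{x. deriv \<phi> x \<noteq> 0} \<subseteq> closure {x. \<phi> x \<noteq> 0}" by blast
  then have "closure {x. deriv \<phi> x \<noteq> 0} \<subseteq> closure {x. \<phi> x \<noteq> 0}"
    by (rule closure_minimal) simp
  then have "closure {x. deriv \<phi> x \<noteq> 0} \<subseteq> {-1<..<1}" using cl by (rule subset_trans)
  moreover have "(deriv ^^ n) (deriv \<phi>) differentiable (at x)" for n x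
    using d[of "Suc n" x] by (simp only: funpow_Suc_right comp_apply)
  ultimately show "test_function (deriv \<phi>)" by (simp add: test_function_def)
qed

lemma test_function_boundary:
  assumes "test_function \<phi>"
  shows "\<phi> 1 = 0" "\<phi> (-1) = 0"
  using test_functionD(4)[OF assms] by force+

text \<open>The constant \<open>d\<close> drops out because \<phi>' has integral zero; what is left
  is integration by parts with \<phi>(1) = 0.\<close>

lemma weak_deriv_primitive:
  assumes w: "w \<in> L1" and u: "\<And>x. x \<in> {-1..1} \<Longrightarrow> u x = d + integral {-1..x} w"
  shows "weak_deriv u w"
  unfolding weak_deriv_def
proof (intro allI impI)
  fix \<phi> assume \<phi>: "test_function \<phi>"
  have w': "w absolutely_integrable_on {-1..1}" using w by (simp add: L1_iff)
  note t = test_functionD[OF \<phi>]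
  have c: "continuous_on {-1..1} (deriv \<phi>)" by (rule continuous_on_subset[OF t(2)]) simp
  have "(deriv \<phi> has_integral (\<phi> 1 - \<phi> (-1))) {-1..1}"
    using t(1) by (intro fundamental_theorem_of_calculus)
      (auto simp: has_field_derivative_at_within simp flip: has_real_derivative_iff_has_vector_derivative)
  then have i0: "(deriv \<phi> has_integral 0) {-1..1}" using test_function_boundary[OF \<phi>] by simp
  have iV: "(\<lambda>x. integral {-1..x} w * deriv \<phi> x) integrable_on {-1..1}"
    by (intro integrable_continuous_real continuous_intros c continuous_on_primitive[OF w'])
  have "integral {-1<..<1} (\<lambda>x. u x * deriv \<phi> x) = integral {-1..1} (\<lambda>x. u x * deriv \<phi> x)"
    by (simp add: integral_open_interval_real)
  also have "\<dots> = integral {-1..1} (\<lambda>x. d * deriv \<phi> x + integral {-1..x} w * deriv \<phi> x)"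
    by (rule Henstock_Kurzweil_Integration.integral_cong) (simp add: u algebra_simps)
  also have "\<dots> = integral {-1..1} (\<lambda>x. d * deriv \<phi> x) + integral {-1..1} (\<lambda>x. integral {-1..x} w * deriv \<phi> x)"
    using i0 by (intro Henstock_Kurzweil_Integration.integral_add iV integrable_on_mult_right) (auto simp: has_integral_integrable)
  also have "\<dots> = integral {-1..1} (\<lambda>x. integral {-1..x} w * deriv \<phi> x)"
    using i0 by (simp add: integral_unique)
  also have "\<dots> = - integral {-1..1} (\<lambda>x. w x * \<phi> x)"
    using integration_by_parts_primitive[OF w' _ c, of \<phi>] t(1) test_function_boundary[OF \<phi>]
    by (simp add: has_field_derivative_at_within)
  finally show "integral {-1<..<1} (\<lambda>x. u x * deriv \<phi> x) = - integral {-1<..<1} (\<lambda>x. w x * \<phi> x)"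
    by (simp add: integral_open_interval_real)
qed

lemma weak_second_deriv_int2:
  assumes w: "w \<in> L1" and u: "\<And>x. x \<in> {-1..1} \<Longrightarrow> u x = c + d * (x + 1) + int2 w x"
  shows "weak_second_deriv u w"
proof -
  have w': "w absolutely_integrable_on {-1..1}" using w by (simp add: L1_iff)
  define v where "v x = d + integral {-1..x} w" for x
  have vc: "continuous_on {-1..1} v"
    unfolding v_def by (intro continuous_intros continuous_on_primitive[OF w'])
  have v: "v \<in> L1" unfolding L1_iff by (rule absolutely_integrable_continuous_real[OF vc])
  have "u x = c + integral {-1..x} v" if x: "x \<in> {-1..1}" for x
  proof -
    have "integral {-1..x} v = integral {-1..x} (\<lambda>t. d) + integral {-1..x} (\<lambda>t. integral {-1..t} w)"
      unfolding v_def using x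
      by (intro Henstock_Kurzweil_Integration.integral_add integrable_continuous_real)
         (auto intro!: continuous_intros continuous_on_subset[OF continuous_on_primitive[OF w']])
    then show ?thesis using u[OF x] int2_eq_integral[OF w' x] x by simp
  qed
  then have "weak_deriv u v" by (rule weak_deriv_primitive[OF v])
  moreover have "weak_deriv v w" by (rule weak_deriv_primitive[OF w]) (simp add: v_def)
  ultimately show ?thesis using w v unfolding weak_second_deriv_def by blast
qed

lemma weak_second_derivD:
  assumes "weak_second_deriv u w" "test_function \<phi>"
  shows "integral {-1..1} (\<lambda>x. u x * deriv (deriv \<phi>) x) = integral {-1..1} (\<lambda>x. w x * \<phi> x)"
proof -
  obtain v where v: "weak_deriv u v" "weak_deriv v w"
    using assms(1) by (auto simp: weak_second_deriv_def)
  have "integral {-1<..<1} (\<lambda>x. u x * deriv (deriv \<phi>) x) = - integral {-1<..<1} (\<lambda>x. v x * deriv \<phi> x)"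
    using v(1) test_functionD(3)[OF assms(2)] by (simp add: weak_deriv_def)
  also have "\<dots> = integral {-1<..<1} (\<lambda>x. w x * \<phi> x)"
    using v(2) assms(2) by (simp add: weak_deriv_def)
  finally show ?thesis by (simp add: integral_open_interval_real)
qed

text \<open>A smooth bump function is built from $e^{-1/x}$, whose derivatives all have the form
  $p(1/x)\,e^{-1/x}$ with a polynomial $p$.\<close>

definition flat :: "real poly \<Rightarrow> real \<Rightarrow> real" where
  "flat p x = (if x > 0 then poly p (1 / x) * exp (- (1 / x)) else 0)"

lemma poly_times_exp_lim: "((\<lambda>t::real. poly p t * exp (- t)) \<longlongrightarrow> 0) at_top"
proof -
  have "((\<lambda>t. \<Sum>i\<le>degree p. coeff p i * (t ^ i / exp t)) \<longlongrightarrow> (\<Sum>i\<le>degree p. coeff p i * 0)) at_top"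
    by (intro tendsto_intros tendsto_power_div_exp_0)
  moreover have "poly p t * exp (- t) = (\<Sum>i\<le>degree p. coeff p i * (t ^ i / exp t))" for t :: real
    by (simp add: poly_altdef sum_distrib_right exp_minus divide_inverse mult.assoc)
  ultimately show ?thesis by simp
qed

text \<open>With t = 1/x the chain rule turns p(t) exp(-t) into t^2 (p(t) - p'(t)) exp(-t), and
  \<open>[:0, 0, 1:]\<close> is t^2. At 0 both one-sided difference quotients tend to zero.\<close>

lemma flat_has_derivative:
  "(flat p has_real_derivative flat ([:0, 0, 1:] * (p - pderiv p)) x) (at x)"
proof (cases x "0::real" rule: linorder_cases)
  case greater
  have "((\<lambda>x. poly p (1 / x) * exp (- (1 / x))) has_real_derivative
      flat ([:0, 0, 1:] * (p - pderiv p)) x) (at x)"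
    using greater
    by (auto intro!: derivative_eq_intros simp: flat_def field_simps power2_eq_square)
  then show ?thesis
    by (rule DERIV_cong_ev[OF refl _ refl, THEN iffD1, rotated])
       (use eventually_nhds_in_open[of "{0<..}" x] greater in \<open>auto elim!: eventually_mono simp: flat_def\<close>)
next
  case less
  have "((\<lambda>x. 0::real) has_real_derivative flat ([:0, 0, 1:] * (p - pderiv p)) x) (at x)"
    using less by (simp add: flat_def)
  then show ?thesis
    by (rule DERIV_cong_ev[OF refl _ refl, THEN iffD1, rotated])
       (use eventually_nhds_in_open[of "{..<0}" x] less in \<open>auto elim!: eventually_mono simp: flat_def\<close>)
next
  case equal
  have "((\<lambda>y. (flat p y - flat p 0) / (y - 0)) \<longlongrightarrow> 0) (at_right 0)"
  proof -
    \<comment> \<open>\<open>pCons 0 p\<close> is t p(t): the division by y = 1/t in the difference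
      quotient is absorbed into the polynomial.\<close>
    have "((\<lambda>y::real. poly (pCons 0 p) (1 / y) * exp (- (1 / y))) \<longlongrightarrow> 0) (at_right 0)"
      using filterlim_compose[OF poly_times_exp_lim filterlim_inverse_at_top_right, of "pCons 0 p"]
      by (simp add: inverse_eq_divide)
    then show ?thesis
      by (rule Lim_transform_eventually)
         (use eventually_at_right_less[of "0::real"] in \<open>auto elim!: eventually_mono simp: flat_def\<close>)
  qed
  moreover have "((\<lambda>y. (flat p y - flat p 0) / (y - 0)) \<longlongrightarrow> 0) (at_left 0)"
  proof (rule Lim_transform_eventually[of "\<lambda>_. 0"])
    have "\<forall>\<^sub>F y in at_left 0. y < (0::real)" by (simp add: eventually_at_filter)
    then show "\<forall>\<^sub>F y in at_left 0. 0 = (flat p y - flat p 0) / (y - 0)"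
      by eventually_elim (simp add: flat_def)
  qed simp
  ultimately have "((\<lambda>y. (flat p y - flat p 0) / (y - 0)) \<longlongrightarrow> 0) (at 0)"
    by (simp add: filterlim_split_at)
  then show ?thesis using equal by (simp add: has_field_derivative_iff flat_def)
qed

section \<open>Smooth bumps and their iterated primitives\<close>

definition smooth :: "(real \<Rightarrow> real) \<Rightarrow> bool" where
  "smooth f \<longleftrightarrow> (\<forall>n x. (deriv ^^ n) f differentiable (at x))"

text \<open>Smoothness is proved by membership in a family closed under differentiation, so that no
  formula for the n-th derivative has to be found.\<close>

lemma smoothI:
  assumes "f \<in> F" "\<And>g. g \<in> F \<Longrightarrow> \<exists>g'\<in>F. \<forall>x. (g has_real_derivative g' x) (at x)"
  shows "smooth f"
proof -
  have "(deriv ^^ n) f \<in> F" for n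
  proof (induction n)
    case (Suc n)
    then obtain g' where g': "g' \<in> F" "\<And>x. ((deriv ^^ n) f has_real_derivative g' x) (at x)"
      using assms(2) by blast
    have "deriv ((deriv ^^ n) f) = g'" using g'(2) DERIV_imp_deriv by blast
    then show ?case using g'(1) by simp
  qed (use assms(1) in simp)
  then show ?thesis unfolding smooth_def
    by (meson assms(2) real_differentiable_def)
qed

text \<open>Repeated differentiation of the bump exp(-1/(1+s)) exp(-1/(1-s)), which is
  \<open>flat_prod [(1, 1)]\<close> on (-1,1), stays among these finite sums. All of them vanish
  outside (-1,1).\<close>

definition flat_prod :: "(real poly \<times> real poly) list \<Rightarrow> real \<Rightarrow> real" where
  "flat_prod l s = (\<Sum>(p, q)\<leftarrow>l. flat p (1 + s) * flat q (1 - s))"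

lemma flat_minus: "flat (- p) x = - flat p x"
  by (simp add: flat_def)

lemma flat_prod_derivative:
  "\<exists>l'. \<forall>x. (flat_prod l has_real_derivative flat_prod l' x) (at x)"
proof (induction l)
  case Nil
  have "flat_prod [] = (\<lambda>_. 0)" by (simp add: flat_prod_def fun_eq_iff)
  then show ?case by (intro exI[of _ "[]"]) simp
next
  case (Cons pq l)
  obtain p q where pq: "pq = (p, q)" by (cases pq)
  obtain l' where l': "\<And>x. (flat_prod l has_real_derivative flat_prod l' x) (at x)"
    using Cons by blast
  let ?D = "\<lambda>p. [:0, 0, 1:] * (p - pderiv p)"
  have "(flat_prod (pq # l) has_real_derivative flat_prod ((?D p, q) # (p, - ?D q) # l') x) (at x)" for x
  proof -
    have "((\<lambda>s. flat p (1 + s)) has_real_derivative flat (?D p) (1 + x) * 1) (at x)"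
      by (rule DERIV_chain'[OF _ flat_has_derivative]) (auto intro!: derivative_eq_intros)
    moreover have "((\<lambda>s. flat q (1 - s)) has_real_derivative flat (?D q) (1 - x) * (- 1)) (at x)"
      by (rule DERIV_chain'[OF _ flat_has_derivative]) (auto intro!: derivative_eq_intros)
    ultimately have "((\<lambda>s. flat p (1 + s) * flat q (1 - s) + flat_prod l s) has_real_derivative
        flat (?D p) (1 + x) * flat q (1 - x) + flat p (1 + x) * - flat (?D q) (1 - x) + flat_prod l' x) (at x)"
      by (intro DERIV_add l' derivative_eq_intros) (auto simp: algebra_simps)
    moreover have "(\<lambda>s. flat p (1 + s) * flat q (1 - s) + flat_prod l s) = flat_prod (pq # l)"
      by (simp add: fun_eq_iff flat_prod_def pq)
    moreover have "flat (?D p) (1 + x) * flat q (1 - x) + flat p (1 + x) * - flat (?D q) (1 - x) + flat_prod l' x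
        = flat_prod ((?D p, q) # (p, - ?D q) # l') x"
      unfolding flat_minus[symmetric] by (simp add: flat_prod_def)
    ultimately show ?thesis by metis
  qed
  then show ?case by blast
qed

text \<open>The lower limit -2 lies to the left of the support. Hence the integral is zero for all s
  up to -1, also where the interval is empty, and the derivative formula holds on the whole
  line.\<close>

lemma primitive_from_left:
  fixes \<rho> :: "real \<Rightarrow> real"
  assumes c: "continuous_on UNIV \<rho>" and z: "\<And>s. s \<le> -1 \<Longrightarrow> \<rho> s = 0"
  shows "((\<lambda>s. integral {-2..s} \<rho>) has_real_derivative \<rho> s) (at s)"
    and "s \<le> -1 \<Longrightarrow> integral {-2..s} \<rho> = 0"
proof -
  show z': "integral {-2..s} \<rho> = 0" if "s \<le> -1" for s
  proof -
    have "integral {-2..s} \<rho> = integral {-2..s} (\<lambda>_. 0)"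
      by (rule Henstock_Kurzweil_Integration.integral_cong) (use z that in auto)
    then show ?thesis by simp
  qed
  show "((\<lambda>s. integral {-2..s} \<rho>) has_real_derivative \<rho> s) (at s)"
  proof (cases "s > -2")
    case True
    have "((\<lambda>s. integral {-2..s} \<rho>) has_real_derivative \<rho> s) (at s within {-2..s+1})"
      by (rule integral_has_real_derivative) (use c True in \<open>auto intro: continuous_on_subset\<close>)
    then show ?thesis using True by (simp add: at_within_Icc_at)
  next
    case False
    have "((\<lambda>s. 0) has_real_derivative \<rho> s) (at s)" using z[of s] False by simp
    then show ?thesis
      by (rule DERIV_cong_ev[OF refl _ refl, THEN iffD1, rotated])
         (use eventually_nhds_in_open[of "{..<-1}" s] False z' in \<open>auto elim!: eventually_mono\<close>)
  qed
qed

text \<open>Beyond the support of \<rho> the primitive \<open>P\<close> is constant and the second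
  primitive \<open>R\<close> is affine. A symmetric second difference of translates of
  \<open>R\<close> therefore has compact support, while its second derivative is a second difference
  of bumps.\<close>

lemma bump_exists:
  obtains \<rho> P R :: "real \<Rightarrow> real" and m e :: real where
    "smooth R" "\<And>s. (R has_real_derivative P s) (at s)" "\<And>s. (P has_real_derivative \<rho> s) (at s)"
    "continuous_on UNIV \<rho>" "\<And>s. \<rho> s \<ge> 0" "\<And>s. \<bar>s\<bar> \<ge> 1 \<Longrightarrow> \<rho> s = 0"
    "\<And>s. s \<le> -1 \<Longrightarrow> P s = 0" "\<And>s. s \<le> -1 \<Longrightarrow> R s = 0" "\<And>s. s \<ge> 1 \<Longrightarrow> P s = m"
    "\<And>s. s \<ge> 1 \<Longrightarrow> R s = m * s + e" "m > 0"
proof -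
  define \<rho> where "\<rho> = flat_prod [(1, 1)]"
  have \<rho>: "\<rho> s = flat 1 (1 + s) * flat 1 (1 - s)" for s by (simp add: \<rho>_def flat_prod_def)
  have \<rho>c: "continuous_on UNIV \<rho>"
    using flat_prod_derivative[of "[(1,1)]"] unfolding \<rho>_def
    by (meson DERIV_isCont continuous_at_imp_continuous_on)
  have \<rho>0: "\<rho> s \<ge> 0" for s by (simp add: \<rho> flat_def)
  have \<rho>z: "\<rho> s = 0" if "\<bar>s\<bar> \<ge> 1" for s using that by (auto simp: \<rho> flat_def abs_if split: if_splits)
  define P where "P s = integral {-2..s} \<rho>" for s
  have P: "(P has_real_derivative \<rho> s) (at s)" "s \<le> -1 \<Longrightarrow> P s = 0" for s
    unfolding P_def using primitive_from_left[OF \<rho>c] \<rho>z by auto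
  have Pc: "continuous_on UNIV P" using P(1) by (meson DERIV_isCont continuous_at_imp_continuous_on)
  define R where "R s = integral {-2..s} P" for s
  have R: "(R has_real_derivative P s) (at s)" "s \<le> -1 \<Longrightarrow> R s = 0" for s
    unfolding R_def using primitive_from_left[OF Pc] P by auto
  have P1: "P s = P 1" if "s \<ge> 1" for s
  proof (rule DERIV_isconst2[of 1 "s + 1" P])
    show "(P has_real_derivative 0) (at x)" if "1 < x" "x < s + 1" for x
      using P(1)[of x] \<rho>z[of x] that by simp
  qed (use that Pc in \<open>auto intro: continuous_on_subset\<close>)
  have R1: "R s = P 1 * s + (R 1 - P 1)" if "s \<ge> 1" for s
  proof -
    have "R s - P 1 * s = R 1 - P 1 * 1"
    proof (rule DERIV_isconst2[of 1 "s + 1" "\<lambda>s. R s - P 1 * s"])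
      show "((\<lambda>s. R s - P 1 * s) has_real_derivative 0) (at x)" if "1 < x" "x < s + 1" for x
        using R(1)[of x] P1[of x] that by (auto intro!: derivative_eq_intros)
      have "continuous_on UNIV R" using R(1) by (meson DERIV_isCont continuous_at_imp_continuous_on)
      then show "continuous_on {1..s + 1} (\<lambda>s. R s - P 1 * s)"
        by (auto intro!: continuous_intros intro: continuous_on_subset)
    qed (use that in auto)
    then show ?thesis by simp
  qed
  have "P 1 \<ge> 0" unfolding P_def
    by (rule integral_nonneg) (use \<rho>c \<rho>0 in \<open>auto intro!: integrable_continuous_real intro: continuous_on_subset\<close>)
  moreover have "P 1 \<noteq> 0"
  proof
    assume "P 1 = 0"
    then have "\<forall>x\<in>{-2..1}. \<rho> x = 0"
      using integral_eq_0_iff[of "-2" 1 \<rho>] \<rho>0 \<rho>c unfolding P_def by (auto intro: continuous_on_subset)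
    then have "\<rho> 0 = 0" by simp
    then show False by (simp add: \<rho> flat_def)
  qed
  ultimately have "P 1 > 0" by simp
  moreover have "smooth R"
  proof (rule smoothI[of R "{R, P} \<union> range flat_prod"])
    fix g assume "g \<in> {R, P} \<union> range flat_prod"
    then show "\<exists>g'\<in>{R, P} \<union> range flat_prod. \<forall>x. (g has_real_derivative g' x) (at x)"
      using R(1) P(1) flat_prod_derivative unfolding \<rho>_def by blast
  qed simp
  ultimately show ?thesis
    using that[of R P \<rho> "P 1" "R 1 - P 1"] R P \<rho>c \<rho>0 \<rho>z P1 R1 by blast
qed

lemma smooth_affine_combination:
  assumes "smooth R" and e: "e \<noteq> 0"
  shows "smooth (\<lambda>s. k1 * R ((s - x1) / e) + k2 * R ((s - x2) / e) + k3 * R ((s - x3) / e))"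
proof (rule smoothI)
  let ?F = "{\<lambda>s. k1 * g ((s - x1) / e) + k2 * g ((s - x2) / e) + k3 * g ((s - x3) / e) | k1 k2 k3 g. smooth g}"
  show "(\<lambda>s. k1 * R ((s - x1) / e) + k2 * R ((s - x2) / e) + k3 * R ((s - x3) / e)) \<in> ?F"
    using assms by blast
  fix h assume "h \<in> ?F"
  then obtain k1 k2 k3 g where g: "smooth g"
    and h: "h = (\<lambda>s. k1 * g ((s - x1) / e) + k2 * g ((s - x2) / e) + k3 * g ((s - x3) / e))" by blast
  have "\<forall>n x. (deriv ^^ n) (deriv g) differentiable (at x)"
    using g unfolding smooth_def by (metis comp_apply funpow_Suc_right)
  then have g': "smooth (deriv g)" by (simp add: smooth_def)
  have "(g has_real_derivative deriv g x) (at x)" for x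
    using g unfolding smooth_def by (metis DERIV_deriv_iff_real_differentiable funpow_0)
  then have *: "((\<lambda>s. g ((s - y) / e)) has_real_derivative deriv g ((x - y) / e) * (1 / e)) (at x)" for x y
    by (intro DERIV_chain'[where f = "\<lambda>s. (s - y) / e"]) (auto intro!: derivative_eq_intros simp: e)
  define h' where "h' x = (k1 / e) * deriv g ((x - x1) / e) + (k2 / e) * deriv g ((x - x2) / e)
      + (k3 / e) * deriv g ((x - x3) / e)" for x
  have "(h has_real_derivative h' x) (at x)" for x
    unfolding h h'_def by (auto intro!: derivative_eq_intros * simp: mult.commute)
  moreover have "h' \<in> ?F" unfolding h'_def using g' by blast
  ultimately show "\<exists>g'\<in>?F. \<forall>x. (h has_real_derivative g' x) (at x)" by (intro bexI[of _ h'] allI)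
qed

text \<open>A du Bois-Reymond argument. A test function is built whose second derivative is
  concentrated at x, at the midpoint and at y with weights 1, -2, 1; orthogonality makes the
  averaged second difference of \<open>z\<close> vanish, and uniform continuity removes the
  averaging.\<close>

lemma second_difference_zero:
  fixes z :: "real \<Rightarrow> real"
  assumes z: "continuous_on {-1..1} z"
    and orth: "\<And>\<phi>. test_function \<phi> \<Longrightarrow> integral {-1..1} (\<lambda>x. z x * deriv (deriv \<phi>) x) = 0"
    and xy: "-1 < x" "x < y" "y < 1"
  shows "z x - 2 * z ((x + y) / 2) + z y = 0"
proof -
  obtain \<rho> P R m e0 where b: "smooth R" "\<And>s. (R has_real_derivative P s) (at s)"
    "\<And>s. (P has_real_derivative \<rho> s) (at s)"
    "continuous_on UNIV \<rho>" "\<And>s. \<rho> s \<ge> 0" "\<And>s. \<bar>s\<bar> \<ge> 1 \<Longrightarrow> \<rho> s = 0"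
    "\<And>s. s \<le> -1 \<Longrightarrow> P s = 0" "\<And>s. s \<le> -1 \<Longrightarrow> R s = 0" "\<And>s. s \<ge> 1 \<Longrightarrow> P s = m"
    "\<And>s. s \<ge> 1 \<Longrightarrow> R s = m * s + e0" "m > (0::real)"
    by (rule bump_exists, rule that; assumption)
  let ?w = "(x + y) / 2"
  have "\<bar>z x - 2 * z ?w + z y\<bar> \<le> 4 * \<epsilon>" if \<epsilon>: "\<epsilon> > 0" for \<epsilon>
  proof -
    have "uniformly_continuous_on {-1..1} z"
      using z by (simp add: compact_uniformly_continuous)
    then obtain \<delta> where \<delta>0: "\<delta> > 0"
      and \<delta>1: "\<forall>s\<in>{-1..1}. \<forall>t\<in>{-1..1}. dist t s < \<delta> \<longrightarrow> dist (z t) (z s) < \<epsilon>"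
      unfolding uniformly_continuous_on_def using \<epsilon> by blast
    have \<delta>: "\<bar>z s - z t\<bar> < \<epsilon>" if "s \<in> {-1..1}" "t \<in> {-1..1}" "\<bar>s - t\<bar> < \<delta>" for s t
      using \<delta>1 that unfolding dist_real_def by blast
    \<comment> \<open>The radius e = M/2 keeps the three bumps inside (-1,1) and is small enough for
      \<open>z\<close> to vary by less than \<epsilon> on each of them.\<close>
    define M where "M = min \<delta> (min (x + 1) (1 - y))"
    have M: "0 < M" "M \<le> \<delta>" "M \<le> x + 1" "M \<le> 1 - y" using \<delta>0 xy by (auto simp: M_def)
    define e where "e = M / 2"
    have e: "e > 0" "e < \<delta>" "e < x + 1" "e < 1 - y" 
      using M unfolding e_def by linarith+
    define k where "k t s = \<rho> ((s - t) / e)" for t s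
    have kc: "continuous_on A (k t)" for t A unfolding k_def
      using e by (intro continuous_on_compose2[OF b(4)] continuous_intros) auto
    have kz: "k t s = 0" if "\<bar>s - t\<bar> \<ge> e" for s t
      unfolding k_def using that e by (intro b(6)) (simp add: abs_divide)
    have k0: "k t s \<ge> 0" for t s using b(5) by (simp add: k_def)
    have ik: "(k t has_integral e * m) {-1..1}" if "-1 < t - e" "t + e < 1" for t
    proof -
      have "(k t has_integral e * P ((1 - t) / e) - e * P ((-1 - t) / e)) {-1..1}"
      proof (rule fundamental_theorem_of_calculus)
        fix s :: real assume "s \<in> {-1..1}"
        have "((\<lambda>s. e * P ((s - t) / e)) has_real_derivative e * (\<rho> ((s - t) / e) * (1 / e))) (at s within {-1..1})"
          by (intro DERIV_cmult DERIV_chain'[OF _ b(3)]) (use e in \<open>auto intro!: derivative_eq_intros\<close>)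
        then show "((\<lambda>s. e * P ((s - t) / e)) has_vector_derivative k t s) (at s within {-1..1})"
          using e by (simp add: has_real_derivative_iff_has_vector_derivative k_def)
      qed simp
      moreover have "P ((1 - t) / e) = m" using that e by (intro b(9)) simp
      moreover have "P ((-1 - t) / e) = 0" using that e by (intro b(7)) (simp add: pos_divide_le_eq)
      ultimately show ?thesis by simp
    qed
    have zk: "(\<lambda>s. z s * k t s) integrable_on {-1..1}" for t
      by (intro integrable_continuous_real continuous_intros z kc)
    have avg: "\<bar>integral {-1..1} (\<lambda>s. z s * k t s) - z t * (e * m)\<bar> \<le> \<epsilon> * (e * m)"
      if t: "-1 < t - e" "t + e < 1" for t
    proof -
      have t1: "t \<in> {-1..1}" using t e by auto
      have i: "integral {-1..1} (k t) = e * m" "k t integrable_on {-1..1}"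
        using ik[OF t] by (auto simp: integral_unique)
      have "integral {-1..1} (\<lambda>s. (z s - z t) * k t s) = integral {-1..1} (\<lambda>s. z s * k t s - z t * k t s)"
        by (simp add: algebra_simps)
      also have "\<dots> = integral {-1..1} (\<lambda>s. z s * k t s) - integral {-1..1} (\<lambda>s. z t * k t s)"
        by (intro integral_diff zk integrable_on_mult_right i)
      finally have eq: "integral {-1..1} (\<lambda>s. (z s - z t) * k t s)
          = integral {-1..1} (\<lambda>s. z s * k t s) - z t * (e * m)" using i by simp
      have "norm (integral {-1..1} (\<lambda>s. (z s - z t) * k t s)) \<le> integral {-1..1} (\<lambda>s. \<epsilon> * k t s)"
      proof (rule integral_norm_bound_integral)
        show "(\<lambda>s. (z s - z t) * k t s) integrable_on {-1..1}"
          by (intro integrable_continuous_real continuous_intros z kc)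
        show "(\<lambda>s. \<epsilon> * k t s) integrable_on {-1..1}" by (intro integrable_on_mult_right i)
        fix s :: real assume s: "s \<in> {-1..1}"
        show "norm ((z s - z t) * k t s) \<le> \<epsilon> * k t s"
        proof (cases "\<bar>s - t\<bar> < e")
          case True
          then have "\<bar>z s - z t\<bar> \<le> \<epsilon>" using \<delta>[OF s t1] e by simp
          then show ?thesis using k0 by (auto simp: abs_mult intro!: mult_right_mono)
        qed (use kz in simp)
      qed
      then show ?thesis unfolding eq using i by simp
    qed
    \<comment> \<open>The factor e^2 makes the second derivative equal to k x - 2 k ?w + k y, where
      each k t has mass e m. Left of the bumps all terms vanish; right of them the three affine
      parts cancel.\<close>
    define \<phi> where "\<phi> s = e^2 * R ((s - x) / e) + (- 2 * e^2) * R ((s - ?w) / e) + e^2 * R ((s - y) / e)" for s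
    have cl: "closure {s. \<phi> s \<noteq> 0} \<subseteq> {x - e..y + e}"
    proof (rule closure_minimal)
      have zero_out: "\<phi> s = 0" if "s \<le> x - e \<or> s \<ge> y + e" for s
      proof (cases "s \<le> x - e")
        case True
        then have "s - x \<le> - e" "s - ?w \<le> - e" "s - y \<le> - e" using xy by (auto simp: field_simps)
        then have "(s - x) / e \<le> -1" "(s - ?w) / e \<le> -1" "(s - y) / e \<le> -1"
          using e by (auto simp: pos_divide_le_eq)
        then show ?thesis using b(8) by (simp add: \<phi>_def)
      next
        case False
        then have "s - x \<ge> e" "s - ?w \<ge> e" "s - y \<ge> e" using xy that by (auto simp: field_simps)
        then have "(s - x) / e \<ge> 1" "(s - ?w) / e \<ge> 1" "(s - y) / e \<ge> 1"
          using e by (auto simp: pos_le_divide_eq)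
        then have "R ((s - x) / e) = m * ((s - x) / e) + e0" "R ((s - ?w) / e) = m * ((s - ?w) / e) + e0"
          "R ((s - y) / e) = m * ((s - y) / e) + e0"
          using b(10) by blast+
        then have "\<phi> s = e^2 * m * ((s - x) / e - 2 * ((s - ?w) / e) + (s - y) / e)"
          unfolding \<phi>_def by algebra
        also have "(s - x) / e - 2 * ((s - ?w) / e) + (s - y) / e = 0"
          using e by (simp add: field_simps)
        finally show ?thesis by simp
      qed
      show "{s. \<phi> s \<noteq> 0} \<subseteq> {x - e..y + e}"
      proof
        fix s assume "s \<in> {s. \<phi> s \<noteq> 0}"
        then have "\<not> (s \<le> x - e \<or> s \<ge> y + e)" using zero_out by blast
        then show "s \<in> {x - e..y + e}" by simp
      qed
    qed simp
    have "smooth \<phi>" unfolding \<phi>_def by (rule smooth_affine_combination[OF b(1)]) (use e in simp)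
    then have \<phi>: "test_function \<phi>"
      using cl e xy unfolding test_function_def smooth_def
      by (auto dest!: subsetD[OF cl])
    have R': "((\<lambda>s. R ((s - t) / e)) has_real_derivative P ((s - t) / e) * (1 / e)) (at s)"
      and P': "((\<lambda>s. P ((s - t) / e)) has_real_derivative \<rho> ((s - t) / e) * (1 / e)) (at s)" for s t
    proof -
      have lin: "((\<lambda>s. (s - t) / e) has_real_derivative 1 / e) (at s)"
        using e by (auto intro!: derivative_eq_intros)
      show "((\<lambda>s. R ((s - t) / e)) has_real_derivative P ((s - t) / e) * (1 / e)) (at s)"
        by (rule DERIV_chain'[OF lin b(2)])
      show "((\<lambda>s. P ((s - t) / e)) has_real_derivative \<rho> ((s - t) / e) * (1 / e)) (at s)"
        by (rule DERIV_chain'[OF lin b(3)])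
    qed
    have "(\<phi> has_real_derivative e * P ((s - x) / e) - 2 * e * P ((s - ?w) / e) + e * P ((s - y) / e)) (at s)" for s
      unfolding \<phi>_def using e
      by (auto intro!: derivative_eq_intros R' simp: power2_eq_square)
    then have d1: "deriv \<phi> = (\<lambda>s. e * P ((s - x) / e) - 2 * e * P ((s - ?w) / e) + e * P ((s - y) / e))"
      using DERIV_imp_deriv by blast
    have "((\<lambda>s. e * P ((s - x) / e) - 2 * e * P ((s - ?w) / e) + e * P ((s - y) / e))
        has_real_derivative k x s - 2 * k ?w s + k y s) (at s)" for s
      unfolding k_def using e by (auto intro!: derivative_eq_intros P')
    then have d2: "deriv (deriv \<phi>) = (\<lambda>s. k x s - 2 * k ?w s + k y s)"
      unfolding d1 using DERIV_imp_deriv by blast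
    have "0 = integral {-1..1} (\<lambda>s. z s * k x s - 2 * (z s * k ?w s) + z s * k y s)"
      using orth[OF \<phi>] unfolding d2 by (simp add: algebra_simps)
    also have "\<dots> = integral {-1..1} (\<lambda>s. z s * k x s - 2 * (z s * k ?w s)) + integral {-1..1} (\<lambda>s. z s * k y s)"
      by (intro Henstock_Kurzweil_Integration.integral_add integrable_diff integrable_on_mult_right zk)
    also have "integral {-1..1} (\<lambda>s. z s * k x s - 2 * (z s * k ?w s))
        = integral {-1..1} (\<lambda>s. z s * k x s) - integral {-1..1} (\<lambda>s. 2 * (z s * k ?w s))"
      by (intro integral_diff integrable_on_mult_right zk)
    finally have "0 = integral {-1..1} (\<lambda>s. z s * k x s) - 2 * integral {-1..1} (\<lambda>s. z s * k ?w s)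
        + integral {-1..1} (\<lambda>s. z s * k y s)" by simp
    moreover have "\<bar>integral {-1..1} (\<lambda>s. z s * k x s) - z x * (e * m)\<bar> \<le> \<epsilon> * (e * m)"
      "\<bar>integral {-1..1} (\<lambda>s. z s * k ?w s) - z ?w * (e * m)\<bar> \<le> \<epsilon> * (e * m)"
      "\<bar>integral {-1..1} (\<lambda>s. z s * k y s) - z y * (e * m)\<bar> \<le> \<epsilon> * (e * m)"
      using e xy by (auto intro!: avg) (auto simp: field_simps)
    ultimately have "\<bar>z x * (e * m) - 2 * (z ?w * (e * m)) + z y * (e * m)\<bar> \<le> 4 * (\<epsilon> * (e * m))"
      by linarith
    then have "\<bar>(z x - 2 * z ?w + z y) * (e * m)\<bar> \<le> (4 * \<epsilon>) * (e * m)"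
      by (simp add: algebra_simps)
    then show ?thesis using e b(11) by (simp add: abs_mult)
  qed
  \<comment> \<open>The bound 4\<epsilon> holds for every positive \<epsilon>; one eighth of the
    modulus as \<epsilon> leaves only the value zero.\<close>
  from this[of "\<bar>z x - 2 * z ?w + z y\<bar> / 8"] show ?thesis
    by (cases "z x - 2 * z ?w + z y = 0") auto
qed

text \<open>A maximum principle. If a point is the midpoint of two others and carries the maximum,
  the values at both others are maximal too; so the maximum spreads from an interior point to the
  nearer end, where the function is zero.\<close>

lemma midpoint_affine_nonpos:
  fixes y :: "real \<Rightarrow> real"
  assumes c: "continuous_on {-1..1} y" and b: "y (-1) = 0" "y 1 = 0"
    and mid: "\<And>s t. -1 < s \<Longrightarrow> s < t \<Longrightarrow> t < 1 \<Longrightarrow> y s - 2 * y ((s + t) / 2) + y t = 0"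
    and x: "x \<in> {-1..1}"
  shows "y x \<le> 0"
proof -
  obtain x0 where x0: "x0 \<in> {-1..1}" "\<And>x. x \<in> {-1..1} \<Longrightarrow> y x \<le> y x0"
    using continuous_attains_sup[OF compact_Icc _ c] by auto
  have "y x0 \<le> 0"
  proof (rule ccontr)
    assume n: "\<not> y x0 \<le> 0"
    then have in1: "-1 < x0" "x0 < 1" using b x0(1) by (metis atLeastAtMost_iff less_eq_real_def)+
    have eq: "y (x0 + t) = y x0" "y (x0 - t) = y x0" if "0 < t" "x0 + t < 1" "-1 < x0 - t" for t
      using mid[of "x0 - t" "x0 + t"] x0(2)[of "x0 - t"] x0(2)[of "x0 + t"] that by auto
    show False
    \<comment> \<open>The nearer end is taken because the reflected point must also stay in
      (-1,1).\<close>
    proof (cases "x0 \<ge> 0")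
      case True
      have "y 1 = y x0"
      proof (rule continuous_constant_on_closure[where f = y and S = "{x0<..<1}" and x = 1])
        show "continuous_on (closure {x0<..<1}) y"
          using in1 by (auto intro!: continuous_on_subset[OF c])
        show "y t = y x0" if "t \<in> {x0<..<1}" for t using eq(1)[of "t - x0"] that True by auto
      qed (use in1 in auto)
      then show False using b n by simp
    next
      case False
      have "y (-1) = y x0"
      proof (rule continuous_constant_on_closure[where f = y and S = "{-1<..<x0}" and x = "-1"])
        show "continuous_on (closure {-1<..<x0}) y"
          using in1 by (auto intro!: continuous_on_subset[OF c])
        show "y t = y x0" if "t \<in> {-1<..<x0}" for t using eq(2)[of "x0 - t"] that False by auto
      qed (use in1 in auto)
      then show False using b n by simp
    qed
  qed
  then show ?thesis using x0(2)[OF x] by simp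
qed

text \<open>Subtracting \<open>int2 w\<close> leaves a continuous function whose weak second
  derivative is zero. The maximum principle, applied with both signs to its difference from the
  chord between the end points, shows that it is affine.\<close>

lemma weak_second_deriv_representation:
  assumes u: "continuous_on {-1..1} u" and w: "weak_second_deriv u w"
  obtains c d where "\<And>x. x \<in> {-1..1} \<Longrightarrow> u x = c + d * (x + 1) + int2 w x"
proof -
  have wL: "w \<in> L1" and w': "w absolutely_integrable_on {-1..1}"
    using w by (auto simp: weak_second_deriv_def L1_iff)
  define z where "z x = u x - int2 w x" for x
  have zc: "continuous_on {-1..1} z" unfolding z_def by (intro continuous_intros u continuous_on_int2[OF w'])
  have orth: "integral {-1..1} (\<lambda>x. z x * deriv (deriv \<phi>) x) = 0" if \<phi>: "test_function \<phi>" for \<phi>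
  proof -
    have c: "continuous_on {-1..1} (deriv (deriv \<phi>))"
      using test_functionD(2)[OF test_functionD(3)[OF \<phi>]] continuous_on_subset by blast
    have "integral {-1..1} (\<lambda>x. z x * deriv (deriv \<phi>) x)
      = integral {-1..1} (\<lambda>x. u x * deriv (deriv \<phi>) x - int2 w x * deriv (deriv \<phi>) x)"
      by (simp add: z_def algebra_simps)
    also have "\<dots> = integral {-1..1} (\<lambda>x. u x * deriv (deriv \<phi>) x) - integral {-1..1} (\<lambda>x. int2 w x * deriv (deriv \<phi>) x)"
      by (intro integral_diff integrable_continuous_real continuous_intros c u continuous_on_int2[OF w'])
    also have "\<dots> = 0"
      using weak_second_derivD[OF w \<phi>] weak_second_derivD[OF weak_second_deriv_int2[OF wL, of "int2 w" 0 0] \<phi>]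
      by simp
    finally show ?thesis .
  qed
  define d where "d = (z 1 - z (-1)) / 2"
  define y where "y x = z x - (z (-1) + d * (x + 1))" for x
  have yc: "continuous_on {-1..1} y" unfolding y_def by (intro continuous_intros zc)
  have mid: "y s - 2 * y ((s + t) / 2) + y t = 0" if "-1 < s" "s < t" "t < 1" for s t
    using second_difference_zero[OF zc orth that] by (simp add: y_def algebra_simps add_divide_distrib)
  have b: "y (-1) = 0" "y 1 = 0" by (auto simp: y_def d_def field_simps)
  have y0: "y x = 0" if "x \<in> {-1..1}" for x
  proof -
    have "- y x \<le> 0"
    proof (rule midpoint_affine_nonpos[of "\<lambda>x. - y x", OF _ _ _ _ that])
      show "continuous_on {-1..1} (\<lambda>x. - y x)" by (intro continuous_intros yc)
      show "- y s - 2 * - y ((s + t) / 2) + - y t = 0" if "-1 < s" "s < t" "t < 1" for s t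
        using mid[OF that] by linarith
    qed (use b in auto)
    then show ?thesis using midpoint_affine_nonpos[OF yc b mid that] by simp
  qed
  have "u x = z (-1) + d * (x + 1) + int2 w x" if "x \<in> {-1..1}" for x
    using y0[OF that] by (simp add: y_def z_def algebra_simps)
  then show ?thesis by (rule that)
qed

subsection \<open>The integrated initial value problem\<close>

lemma L1_continuous:
  fixes w :: "real \<Rightarrow> real"
  shows "continuous_on {-1..1} w \<Longrightarrow> w absolutely_integrable_on {-1..1}"
  by (rule absolutely_integrable_continuous_real)

lemma int2_diff:
  assumes "w1 absolutely_integrable_on {-1..1}" "w2 absolutely_integrable_on {-1..1}" "x \<in> {-1..1}"
  shows "int2 (\<lambda>s. w1 s - w2 s) x = int2 w1 x - int2 w2 x"
proof -
  have "int2 (\<lambda>s. w1 s - w2 s) x = integral {-1..x} (\<lambda>s. (x - s) * w1 s - (x - s) * w2 s)"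
    unfolding int2_def by (simp add: algebra_simps)
  also have "\<dots> = int2 w1 x - int2 w2 x"
    unfolding int2_def using assms
    by (intro integral_diff integrable_mult_continuous) (auto intro!: continuous_intros)
  finally show ?thesis .
qed

lemma abs_int2_le:
  assumes "w absolutely_integrable_on {-1..1}" "x \<in> {-1..1}"
  shows "\<bar>int2 w x\<bar> \<le> 2 * integral {-1..x} (\<lambda>s. \<bar>w s\<bar>)"
  using abs_integral_interval_le[OF assms(1), of "\<lambda>s. x - s" "-1" x 2] assms(2)
    continuous_on_op_minus[of "{-1..1}" x]
  unfolding int2_def by auto

lemma integral_mono_continuous:
  fixes v w :: "real \<Rightarrow> real"
  assumes "continuous_on {-1..1} v" "continuous_on {-1..1} w" "x \<in> {-1..1}"
    and "\<And>s. s \<in> {-1..1} \<Longrightarrow> v s \<le> w s"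
  shows "integral {-1..x} v \<le> integral {-1..x} w"
  using assms by (intro integral_le integrable_continuous_real) (auto intro: continuous_on_subset)

text \<open>\<open>W\<close> majorises \<open>v\<close>, and exp(-L(x+1)) W is nonincreasing because
  its derivative has the sign of v - W. The 2 in the exponent is the length of the interval.\<close>

lemma gronwall:
  fixes v :: "real \<Rightarrow> real"
  assumes c: "continuous_on {-1..1} v" and L: "L \<ge> 0" and M: "M \<ge> 0"
    and le: "\<And>x. x \<in> {-1..1} \<Longrightarrow> v x \<le> M + L * integral {-1..x} v" and x: "x \<in> {-1..1}"
  shows "v x \<le> M * exp (2 * L)"
proof -
  define W where "W x = M + L * integral {-1..x} v" for x
  define y where "y x = exp (- L * (x + 1)) * W x" for x
  have d: "(W has_real_derivative L * v x) (at x within {-1..1})" if "x \<in> {-1..1}" for x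
    unfolding W_def using integral_has_real_derivative[OF c that]
    by (auto intro!: derivative_eq_intros)
  have yd: "(y has_real_derivative exp (- L * (x + 1)) * L * (v x - W x)) (at x within {-1..1})"
    if "x \<in> {-1..1}" for x
    unfolding y_def using d[OF that] by (auto intro!: derivative_eq_intros simp: algebra_simps)
  have yc: "continuous_on {-1..1} y"
    using yd by (meson DERIV_continuous continuous_on_eq_continuous_within)
  have "y x \<le> y (-1)"
  proof (rule DERIV_nonpos_imp_decreasing_open[of "-1" x y])
    show "continuous_on {-1..x} y"
      by (rule continuous_on_subset[OF yc]) (use x in auto)
    show "\<exists>z. (y has_real_derivative z) (at t) \<and> z \<le> 0" if t: "-1 < t" "t < x" for t
    proof (intro exI conjI)
      show "(y has_real_derivative exp (- L * (t + 1)) * L * (v t - W t)) (at t)"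
        using yd[of t] t x at_within_Icc_at[of "-1" t 1] by auto
      show "exp (- L * (t + 1)) * L * (v t - W t) \<le> 0"
        using le[of t] t x L by (intro mult_nonneg_nonpos) (auto simp: W_def)
    qed
  qed (use x in auto)
  then have "exp (- L * (x + 1)) * W x \<le> M" by (simp add: y_def W_def)
  then have "exp (L * (x + 1)) * (exp (- L * (x + 1)) * W x) \<le> exp (L * (x + 1)) * M"
    by (rule mult_left_mono) simp
  moreover have "exp (L * (x + 1)) * (exp (- L * (x + 1)) * W x) = W x"
    unfolding mult.assoc[symmetric] exp_add[symmetric] by simp
  ultimately have "W x \<le> M * exp (L * (x + 1))" by (simp only: mult.commute)
  also have "\<dots> \<le> M * exp (2 * L)" using x L M mult_left_mono[of "x + 1" 2 L] by (auto intro!: mult_left_mono simp: mult.commute)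
  finally show ?thesis using le[OF x] by (simp add: W_def)
qed

text \<open>The initial value problem $-u''=\varphi(u)-H''$, $u(-1)=c+H(-1)$, $u'(-1)=d+H'(-1)$ in
  integrated form.\<close>

definition int_sol :: "(real \<Rightarrow> real) \<Rightarrow> (real \<Rightarrow> real) \<Rightarrow> real \<Rightarrow> real \<Rightarrow> (real \<Rightarrow> real) \<Rightarrow> bool" where
  "int_sol \<phi> H c d u \<longleftrightarrow> continuous_on {-1..1} u \<and>
     (\<forall>x\<in>{-1..1}. u x = c + d * (x + 1) + H x - int2 (\<lambda>s. \<phi> (u s)) x)"

lemma int_solD:
  assumes "int_sol \<phi> H c d u"
  shows "continuous_on {-1..1} u"
    "x \<in> {-1..1} \<Longrightarrow> u x = c + d * (x + 1) + H x - int2 (\<lambda>s. \<phi> (u s)) x"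
  using assms by (auto simp: int_sol_def)

text \<open>The difference of u - H and U - H0 is estimated, not that of u and U: the forcing then
  enters only through an integral, and a large but concentrated forcing costs little. Only
  \<open>g\<close> is Lipschitz. The deviation of \<phi> is evaluated at u and e|u| is replaced by
  e|u - U| + eN, which with e \<le> 1 turns L into L + 1. The exponent has one factor 2 from the
  kernel x - s and one from \<open>gronwall\<close>.\<close>

lemma int_sol_estimate:
  assumes u: "int_sol \<phi> H c d u" and U: "int_sol g H0 c' d' U"
    and cont: "continuous_on UNIV \<phi>" "continuous_on UNIV g"
      "continuous_on {-1..1} H" "continuous_on {-1..1} H0"
    and L: "\<And>s t. \<bar>g s - g t\<bar> \<le> L * \<bar>s - t\<bar>"
    and dev: "\<And>s. \<bar>\<phi> s - g s\<bar> \<le> e * \<bar>s\<bar> + C" and e: "0 \<le> e" "e \<le> 1" and C: "0 \<le> C"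
    and Ub: "\<And>x. x \<in> {-1..1} \<Longrightarrow> \<bar>U x\<bar> \<le> N"
    and Hb: "integral {-1..1} (\<lambda>s. \<bar>H s - H0 s\<bar>) \<le> h" and x: "x \<in> {-1..1}"
  shows "\<bar>(u x - H x) - (U x - H0 x)\<bar> \<le>
    (\<bar>c - c'\<bar> + 2 * \<bar>d - d'\<bar> + 2 * (L + 1) * h + 4 * e * N + 4 * C) * exp (4 * (L + 1))"
proof -
  have L0: "L \<ge> 0" using L[of 1 0] by simp
  have N0: "N \<ge> 0" using Ub[of 0] by simp
  have uc: "continuous_on {-1..1} u" and Uc: "continuous_on {-1..1} U"
    using u U by (auto simp: int_sol_def)
  have \<phi>u: "continuous_on {-1..1} (\<lambda>s. \<phi> (u s))" and gU: "continuous_on {-1..1} (\<lambda>s. g (U s))"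
    using continuous_on_compose2[OF cont(1) uc] continuous_on_compose2[OF cont(2) Uc] by auto
  define v where "v x = \<bar>(u x - H x) - (U x - H0 x)\<bar>" for x
  define M where "M = \<bar>c - c'\<bar> + 2 * \<bar>d - d'\<bar> + 2 * (L + 1) * h + 4 * e * N + 4 * C"
  have vc: "continuous_on {-1..1} v" unfolding v_def by (intro continuous_intros uc Uc cont)
  have Hc: "continuous_on {-1..1} (\<lambda>s. \<bar>H s - H0 s\<bar>)" by (intro continuous_intros cont)
  have "0 \<le> integral {-1..1} (\<lambda>s. \<bar>H s - H0 s\<bar>)"
    by (intro integral_nonneg integrable_continuous_real Hc) auto
  then have h0: "h \<ge> 0" using Hb by simp
  then have M0: "M \<ge> 0" unfolding M_def using L0 e C N0 by simp
  have "v x \<le> M + (2 * (L + 1)) * integral {-1..x} v" if x: "x \<in> {-1..1}" for x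
  proof -
    let ?w = "\<lambda>s. \<phi> (u s) - g (U s)"
    have wc: "continuous_on {-1..1} ?w" by (intro continuous_intros \<phi>u gU)
    have I1: "integral {-1..x} (\<lambda>s. \<bar>H s - H0 s\<bar>) \<le> h"
    proof -
      have "integral {-1..x} (\<lambda>s. \<bar>H s - H0 s\<bar>) \<le> integral {-1..1} (\<lambda>s. \<bar>H s - H0 s\<bar>)"
        by (intro integral_subset_le integrable_continuous_real continuous_on_subset[OF Hc]) (use x in auto)
      then show ?thesis using Hb by simp
    qed
    have "integral {-1..x} (\<lambda>s. \<bar>?w s\<bar>) \<le> integral {-1..x}
        (\<lambda>s. (L + 1) * v s + (L + 1) * \<bar>H s - H0 s\<bar> + (e * N + C))"
    proof (intro integral_mono_continuous continuous_on_add continuous_on_mult_left continuous_on_rabs wc vc Hc x continuous_on_const continuous_on_diff cont)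
      fix s :: real assume s: "s \<in> {-1..1}"
      have "\<bar>?w s\<bar> \<le> \<bar>\<phi> (u s) - g (u s)\<bar> + \<bar>g (u s) - g (U s)\<bar>" by simp
      also have "\<dots> \<le> (e * \<bar>u s\<bar> + C) + L * \<bar>u s - U s\<bar>" using dev L by (intro add_mono)
      also have "\<dots> \<le> (e * (\<bar>u s - U s\<bar> + N) + C) + L * \<bar>u s - U s\<bar>"
        using Ub[OF s] e L0 by (intro add_mono mult_left_mono) auto
      also have "\<dots> \<le> (L + 1) * \<bar>u s - U s\<bar> + (e * N + C)"
        using mult_right_mono[OF e(2), of "\<bar>u s - U s\<bar>"] by (simp add: algebra_simps)
      also have "\<dots> \<le> (L + 1) * (v s + \<bar>H s - H0 s\<bar>) + (e * N + C)"
        using L0 e by (intro add_mono mult_left_mono) (auto simp: v_def)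
      finally show "\<bar>?w s\<bar> \<le> (L + 1) * v s + (L + 1) * \<bar>H s - H0 s\<bar> + (e * N + C)"
        by (simp add: algebra_simps)
    qed
    also have "\<dots> = integral {-1..x} (\<lambda>s. (L + 1) * v s + (L + 1) * \<bar>H s - H0 s\<bar>)
        + integral {-1..x} (\<lambda>s. e * N + C)"
      by (intro Henstock_Kurzweil_Integration.integral_add integrable_continuous_real continuous_intros
          continuous_on_subset[OF vc] continuous_on_subset[OF Hc]) (use x in auto)
    also have "integral {-1..x} (\<lambda>s. (L + 1) * v s + (L + 1) * \<bar>H s - H0 s\<bar>)
        = integral {-1..x} (\<lambda>s. (L + 1) * v s) + integral {-1..x} (\<lambda>s. (L + 1) * \<bar>H s - H0 s\<bar>)"
      by (intro Henstock_Kurzweil_Integration.integral_add integrable_continuous_real continuous_intros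
          continuous_on_subset[OF vc] continuous_on_subset[OF Hc]) (use x in auto)
    also have "\<dots> + integral {-1..x} (\<lambda>s. e * N + C)
        \<le> (L + 1) * integral {-1..x} v + (L + 1) * h + 2 * (e * N + C)"
    proof -
      have "(L + 1) * integral {-1..x} (\<lambda>s. \<bar>H s - H0 s\<bar>) \<le> (L + 1) * h"
        using I1 L0 by (intro mult_left_mono) auto
      moreover have "integral {-1..x} (\<lambda>s. e * N + C) = (x + 1) * (e * N + C)"
        using x by (simp del: mult_eq_0_iff)
      moreover have "(x + 1) * (e * N + C) \<le> 2 * (e * N + C)"
        using x e N0 C by (intro mult_right_mono) auto
      ultimately show ?thesis
        unfolding integral_mult_right by linarith
    qed
    finally have I2: "integral {-1..x} (\<lambda>s. \<bar>?w s\<bar>)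
      \<le> (L + 1) * integral {-1..x} v + (L + 1) * h + 2 * (e * N + C)" .
    have "(u x - H x) - (U x - H0 x) = (c - c') + (d - d') * (x + 1) - int2 ?w x"
      using int_solD(2)[OF u x] int_solD(2)[OF U x]
        int2_diff[OF L1_continuous[OF \<phi>u] L1_continuous[OF gU] x]
      by (simp add: algebra_simps)
    then have "v x \<le> \<bar>c - c'\<bar> + \<bar>(d - d') * (x + 1)\<bar> + \<bar>int2 ?w x\<bar>"
      unfolding v_def by linarith
    moreover have "\<bar>(d - d') * (x + 1)\<bar> \<le> \<bar>d - d'\<bar> * 2"
      unfolding abs_mult using x by (intro mult_left_mono) auto
    moreover note abs_int2_le[OF L1_continuous[OF wc] x] I2
    ultimately show ?thesis unfolding M_def by (simp add: algebra_simps)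
  qed
  then have "v x \<le> M * exp (2 * (2 * (L + 1)))"
    using L0 by (intro gronwall[OF vc _ M0 _ x]) auto
  then show ?thesis by (simp add: v_def M_def)
qed

section \<open>Existence, Lipschitz approximation and limits of solutions\<close>

lemma continuous_on_lipschitz_bound:
  fixes \<phi> :: "real \<Rightarrow> real"
  assumes L: "\<And>s t. \<bar>\<phi> s - \<phi> t\<bar> \<le> L * \<bar>s - t\<bar>"
  shows "continuous_on A \<phi>"
proof -
  have "L \<ge> 0" using L[of 1 0] by simp
  then show ?thesis
    using L by (intro lipschitz_on_continuous_on[of L] lipschitz_onI) (auto simp: dist_real_def)
qed

text \<open>Picard iteration for y = u/E with the weight E = exp(K(x+1)). The weight makes the
  integral operator a contraction on the whole interval at once, so that no continuation of local
  solutions is required.\<close>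

lemma int_sol_exists:
  assumes L: "\<And>s t. \<bar>\<phi> s - \<phi> t\<bar> \<le> L * \<bar>s - t\<bar>" and H: "continuous_on {-1..1} H"
  shows "\<exists>u. int_sol \<phi> H c d u"
proof -
  have L0: "L \<ge> 0" using L[of 1 0] by simp
  have \<phi>c: "continuous_on UNIV \<phi>" by (rule continuous_on_lipschitz_bound[OF L])
  \<comment> \<open>The contraction factor is at most 2L/K, where the 2 bounds the kernel; 4L makes
    it at most 1/2, and the 1 keeps K positive for L = 0.\<close>
  define K where "K = 4 * L + 1"
  have K: "K > 0" "2 * L \<le> K / 2" using L0 by (auto simp: K_def)
  define E where "E x = exp (K * (x + 1))" for x :: real
  have Epos: "E x > 0" for x by (simp add: E_def)
  have Ec: "continuous_on A E" for A unfolding E_def by (intro continuous_intros)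
  define T where "T y x = (c + d * (x + 1) + H x - int2 (\<lambda>s. \<phi> (E s * y s)) x) / E x" for y :: "real \<Rightarrow> real" and x
  have \<phi>y: "continuous_on {-1..1} (\<lambda>s. \<phi> (E s * apply_bcontfun y s))" for y
    by (intro continuous_on_compose2[OF \<phi>c] continuous_intros Ec) auto
  have Tc: "continuous_on {-1..1} (T (apply_bcontfun y))" for y
    unfolding T_def
    by (intro continuous_intros H Ec continuous_on_int2 L1_continuous \<phi>y) (simp add: E_def)
  \<comment> \<open>The complete space consists of bounded continuous functions on the line, so the
    image is extended by constants beyond [-1,1].\<close>
  have "\<exists>z::real \<Rightarrow>\<^sub>C real. \<forall>x. z x = T (apply_bcontfun y) (clamp (-1) 1 x)" for y
  proof -
    have "continuous_on (cbox (-1) 1) (T (apply_bcontfun y))" using Tc[of y] by simp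
    then show ?thesis by (rule continuous_on_cbox_bcontfunE) blast
  qed
  then obtain \<T> :: "(real \<Rightarrow>\<^sub>C real) \<Rightarrow> (real \<Rightarrow>\<^sub>C real)" where
    \<T>: "\<And>y x. \<T> y x = T (apply_bcontfun y) (clamp (-1) 1 x)" by metis
  have "\<exists>!y. \<T> y = y"
  proof (rule banach_fix_type[of "1/2"])
    show "\<forall>y1 y2. dist (\<T> y1) (\<T> y2) \<le> 1 / 2 * dist y1 y2"
    proof (intro allI dist_bound)
      fix y1 y2 :: "real \<Rightarrow>\<^sub>C real" and x :: real
      define t where "t = clamp (-1) 1 x"
      have t: "t \<in> {-1..1}" unfolding t_def using clamp_in_interval[of "-1" "1::real" x] by simp
      let ?w = "\<lambda>s. \<phi> (E s * y1 s) - \<phi> (E s * y2 s)"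
      define \<delta> where "\<delta> = dist y1 y2"
      have \<delta>0: "\<delta> \<ge> 0" by (simp add: \<delta>_def)
      have wc: "continuous_on {-1..1} ?w" by (intro continuous_intros \<phi>y)
      have "integral {-1..t} (\<lambda>s. \<bar>?w s\<bar>) \<le> integral {-1..t} (\<lambda>s. L * \<delta> * E s)"
      proof (intro integral_mono_continuous continuous_on_mult_left continuous_on_rabs wc Ec t)
        fix s :: real
        have "\<bar>?w s\<bar> \<le> L * \<bar>E s * y1 s - E s * y2 s\<bar>" by (rule L)
        also have "\<dots> = L * (E s * \<bar>y1 s - y2 s\<bar>)"
          using Epos[of s] by (simp add: abs_mult flip: right_diff_distrib)
        also have "\<dots> \<le> L * (E s * \<delta>)"
          using dist_bounded[of y1 s y2] Epos[of s] L0 unfolding \<delta>_def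
          by (intro mult_left_mono) (auto simp: dist_real_def)
        finally show "\<bar>?w s\<bar> \<le> L * \<delta> * E s" by (simp add: mult_ac)
      qed
      also have "\<dots> = L * \<delta> * ((E t - E (-1)) / K)"
      proof -
        have "(E has_integral (E t / K - E (-1) / K)) {-1..t}"
        proof (rule fundamental_theorem_of_calculus)
          fix s show "((\<lambda>x. E x / K) has_vector_derivative E s) (at s within {-1..t})"
            unfolding E_def has_real_derivative_iff_has_vector_derivative[symmetric]
            using K by (auto intro!: derivative_eq_intros)
        qed (use t in auto)
        then show ?thesis by (simp add: integral_unique diff_divide_distrib)
      qed
      also have "\<dots> \<le> L * \<delta> * (E t / K)"
        using Epos[of "-1"] K L0 \<delta>0 by (intro mult_left_mono divide_right_mono) auto
      finally have I: "integral {-1..t} (\<lambda>s. \<bar>?w s\<bar>) \<le> L * \<delta> * (E t / K)" .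
      have "T y1 t - T y2 t = - (int2 (\<lambda>s. \<phi> (E s * y1 s)) t - int2 (\<lambda>s. \<phi> (E s * y2 s)) t) / E t"
        unfolding T_def diff_divide_distrib[symmetric] by simp
      also have "\<dots> = - int2 ?w t / E t"
        using int2_diff[OF L1_continuous[OF \<phi>y] L1_continuous[OF \<phi>y] t] by simp
      finally have "\<bar>T y1 t - T y2 t\<bar> = \<bar>int2 ?w t\<bar> / E t"
        using Epos[of t] by simp
      also have "\<dots> \<le> (2 * (L * \<delta> * (E t / K))) / E t"
        using abs_int2_le[OF L1_continuous[OF wc] t] I Epos[of t] by (intro divide_right_mono) auto
      also have "\<dots> = (2 * L) * \<delta> / K" using Epos[of t] by simp
      also have "\<dots> \<le> (K / 2) * \<delta> / K"
        using K \<delta>0 by (intro divide_right_mono mult_right_mono) auto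
      also have "\<dots> = 1 / 2 * \<delta>" using K by simp
      finally show "dist (\<T> y1 x) (\<T> y2 x) \<le> 1 / 2 * dist y1 y2"
        unfolding \<T> t_def[symmetric] \<delta>_def dist_real_def .
    qed
  qed auto
  then obtain y where y: "\<T> y = y" by blast
  have "int_sol \<phi> H c d (\<lambda>x. E x * y x)"
    unfolding int_sol_def
  proof (intro conjI ballI)
    show "continuous_on {-1..1} (\<lambda>x. E x * y x)" by (intro continuous_intros Ec) auto
    fix x :: real assume x: "x \<in> {-1..1}"
    then have "clamp (-1) 1 x = x" by (intro clamp_cancel_cbox) simp
    then have "y x = T y x" using \<T>[of y x] y by simp
    then show "E x * y x = c + d * (x + 1) + H x - int2 (\<lambda>s. \<phi> (E s * y s)) x"
      using Epos[of x] by (simp add: T_def)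
  qed
  then show ?thesis by blast
qed

text \<open>The continuous remainder f - g is replaced on [-n,n] by a polynomial and continued by
  constants through the truncation \<open>r\<close>. As \<open>r\<close> does not increase |s|, the
  deviation bound extends to the whole line, with one unit added to C for the approximation
  error.\<close>

lemma lipschitz_approximation:
  fixes f g :: "real \<Rightarrow> real"
  assumes f: "continuous_on UNIV f" and L: "\<And>s t. \<bar>g s - g t\<bar> \<le> L * \<bar>s - t\<bar>"
    and dev: "\<And>s. \<bar>f s - g s\<bar> \<le> e * \<bar>s\<bar> + C" and e: "e \<ge> 0"
  obtains \<phi> L' where "\<And>s t. \<bar>\<phi> s - \<phi> t\<bar> \<le> L' * \<bar>s - t\<bar>"
    "\<And>s. \<bar>s\<bar> \<le> real n \<Longrightarrow> \<bar>\<phi> s - f s\<bar> \<le> 1 / (real n + 1)" "\<And>s. \<bar>\<phi> s - g s\<bar> \<le> e * \<bar>s\<bar> + (C + 1)"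
proof -
  have gc: "continuous_on UNIV g" by (rule continuous_on_lipschitz_bound[OF L])
  define S where "S = {-real n..real n}"
  have c: "continuous_on S (\<lambda>s. f s - g s)" by (intro continuous_intros continuous_on_subset[OF f] continuous_on_subset[OF gc]) auto
  obtain p where p: "real_polynomial_function p" "\<And>s. s \<in> S \<Longrightarrow> \<bar>f s - g s - p s\<bar> < 1 / (real n + 1)"
    using Stone_Weierstrass_real_polynomial_function[OF _ c, of "1 / (real n + 1)"] by (auto simp: S_def)
  obtain p' where p': "real_polynomial_function p'" "\<And>x. (p has_real_derivative p' x) (at x)"
    using has_real_derivative_polynomial_function[OF p(1)] by blast
  have "continuous_on S p'" using p'(1)
    by (simp add: continuous_on_polymonial_function real_polynomial_function_eq)
  then have "bounded (p' ` S)"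
    by (intro compact_imp_bounded compact_continuous_image) (auto simp: S_def)
  then obtain B where B: "\<And>s. s \<in> S \<Longrightarrow> \<bar>p' s\<bar> \<le> B"
    unfolding bounded_iff by (metis imageI real_norm_def)
  have B0: "B \<ge> 0" using B[of 0] by (auto simp: S_def)
  define r where "r s = max (- real n) (min (real n) s)" for s
  have rS: "r s \<in> S" for s by (auto simp: r_def S_def)
  have rl: "\<bar>r s - r t\<bar> \<le> \<bar>s - t\<bar>" for s t by (auto simp: r_def)
  have pl: "\<bar>p s - p t\<bar> \<le> B * \<bar>s - t\<bar>" if "s \<in> S" "t \<in> S" for s t
  proof -
    have "norm (p s - p t) \<le> B * norm (s - t)"
      by (rule field_differentiable_bound[of S p p'])
         (use p'(2) B that in \<open>auto simp: S_def intro: has_field_derivative_at_within\<close>)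
    then show ?thesis by simp
  qed
  define \<phi> where "\<phi> s = g s + p (r s)" for s
  show ?thesis
  proof (rule that[of \<phi> "L + B"])
    fix s t
    have "\<bar>\<phi> s - \<phi> t\<bar> \<le> \<bar>g s - g t\<bar> + \<bar>p (r s) - p (r t)\<bar>" by (simp add: \<phi>_def)
    also have "\<dots> \<le> L * \<bar>s - t\<bar> + B * \<bar>s - t\<bar>"
      using L[of s t] pl[OF rS rS, of s t] mult_left_mono[OF rl[of s t] B0] by simp
    finally show "\<bar>\<phi> s - \<phi> t\<bar> \<le> (L + B) * \<bar>s - t\<bar>" by (simp add: algebra_simps)
  next
    fix s :: real assume s: "\<bar>s\<bar> \<le> real n"
    then have "r s = s" "s \<in> S" by (auto simp: r_def S_def)
    then show "\<bar>\<phi> s - f s\<bar> \<le> 1 / (real n + 1)" using p(2)[of s] by (simp add: \<phi>_def)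
  next
    fix s
    have "\<bar>\<phi> s - g s\<bar> \<le> \<bar>f (r s) - g (r s)\<bar> + 1 / (real n + 1)"
      using p(2)[OF rS, of s] by (simp add: \<phi>_def)
    also have "\<dots> \<le> (e * \<bar>r s\<bar> + C) + 1" using dev by (intro add_mono) auto
    also have "\<dots> \<le> (e * \<bar>s\<bar> + C) + 1"
      using e by (intro add_mono mult_left_mono) (auto simp: r_def)
    finally show "\<bar>\<phi> s - g s\<bar> \<le> e * \<bar>s\<bar> + (C + 1)" by simp
  qed
qed

text \<open>Arzela-Ascoli. The growth bound makes the integral terms Lipschitz with one constant, so
  the solutions are equicontinuous together with H. Along a uniformly convergent subsequence the
  nonlinear terms converge uniformly, since the approximations are close to \<open>f\<close> on the
  bounded range of the solutions.\<close>

lemma int_sol_limit: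
  fixes u :: "nat \<Rightarrow> real \<Rightarrow> real"
  assumes u: "\<And>n. int_sol (\<phi> n) H (c n) (d n) (u n)"
    and \<phi>: "\<And>n. continuous_on UNIV (\<phi> n)" and f: "continuous_on UNIV f" and H: "continuous_on {-1..1} H"
    and approx: "\<And>n s. \<bar>s\<bar> \<le> real n \<Longrightarrow> \<bar>\<phi> n s - f s\<bar> \<le> 1 / (real n + 1)"
    and dev: "\<And>n s. \<bar>\<phi> n s\<bar> \<le> A * \<bar>s\<bar> + C" and A: "A \<ge> 0"
    and c: "c \<longlonglongrightarrow> c0" and d: "d \<longlonglongrightarrow> d0"
    and bd: "\<And>n x. x \<in> {-1..1} \<Longrightarrow> \<bar>u n x\<bar> \<le> M"
  obtains U k where "int_sol f H c0 d0 U" "strict_mono (k :: nat \<Rightarrow> nat)"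
    "\<And>x. x \<in> {-1..1} \<Longrightarrow> (\<lambda>n. u (k n) x) \<longlonglongrightarrow> U x"
proof -
  have uc: "continuous_on {-1..1} (u n)" for n using u by (auto simp: int_sol_def)
  have \<phi>u: "continuous_on {-1..1} (\<lambda>s. \<phi> n (u n s))" for n
    using continuous_on_compose2[OF \<phi> uc] by auto
  obtain D where D: "\<And>n. \<bar>d n\<bar> \<le> D"
    using convergent_imp_Bseq[of d] d unfolding convergent_def Bseq_def by auto
  have M0: "M \<ge> 0" using bd[of 0 0] by simp
  define B where "B = A * M + C"
  have \<phi>b: "\<bar>\<phi> n (u n s)\<bar> \<le> B" if "s \<in> {-1..1}" for n s
    using dev[of n "u n s"] mult_left_mono[OF bd[OF that, of n] A] by (simp add: B_def)
  have B0: "B \<ge> 0" using \<phi>b[of 0 0] by simp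
  have lip: "\<bar>int2 (\<lambda>s. \<phi> n (u n s)) x - int2 (\<lambda>s. \<phi> n (u n s)) y\<bar> \<le> (2 * B) * \<bar>x - y\<bar>"
    if "x \<in> {-1..1}" "y \<in> {-1..1}" for n x y
  proof -
    have "norm (int2 (\<lambda>s. \<phi> n (u n s)) x - int2 (\<lambda>s. \<phi> n (u n s)) y) \<le> (2 * B) * norm (x - y)"
    proof (rule field_differentiable_bound[of "{-1..1}"])
      fix t :: real assume t: "t \<in> {-1..1}"
      show "(int2 (\<lambda>s. \<phi> n (u n s)) has_real_derivative integral {-1..t} (\<lambda>s. \<phi> n (u n s))) (at t within {-1..1})"
        by (rule int2_has_derivative[OF L1_continuous[OF \<phi>u] t])
      have "norm (integral {-1..t} (\<lambda>s. \<phi> n (u n s))) \<le> integral {-1..t} (\<lambda>s. B)"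
        by (intro integral_norm_bound_integral integrable_continuous_real continuous_on_subset[OF \<phi>u])
           (use t \<phi>b in auto)
      also have "\<dots> = (t + 1) * B" using t by simp
      also have "\<dots> \<le> 2 * B" using t B0 by (intro mult_right_mono) auto
      finally show "norm (integral {-1..t} (\<lambda>s. \<phi> n (u n s))) \<le> 2 * B" .
    qed (use that in auto)
    then show ?thesis by simp
  qed
  obtain U k where Uc: "continuous_on {-1..1} U" and k: "strict_mono (k :: nat \<Rightarrow> nat)"
    and conv: "\<And>e. 0 < e \<Longrightarrow> \<exists>N. \<forall>n x. n \<ge> N \<and> x \<in> {-1..1} \<longrightarrow> norm (u (k n) x - U x) < e"
  proof (rule Arzela_Ascoli[of "{-1..1::real}" u M])
    fix x e :: real assume x: "x \<in> {-1..1}" and e: "0 < e"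
    obtain \<delta> where \<delta>: "\<delta> > 0" "\<And>y. y \<in> {-1..1} \<Longrightarrow> \<bar>y - x\<bar> < \<delta> \<Longrightarrow> \<bar>H y - H x\<bar> < e / 2"
      using H x e unfolding continuous_on_iff dist_real_def by (metis half_gt_zero)
    define Q where "Q = D + 2 * B + 1"
    have Q: "Q > 0" "D + 2 * B \<le> Q" using D[of 0] B0 by (auto simp: Q_def)
    show "\<exists>\<delta>>0. \<forall>n y. y \<in> {-1..1} \<and> norm (x - y) < \<delta> \<longrightarrow> norm (u n x - u n y) < e"
    proof (intro exI[of _ "min \<delta> (e / (2 * Q))"] conjI allI impI)
      fix n y assume y: "y \<in> {-1..1} \<and> norm (x - y) < min \<delta> (e / (2 * Q))"
      have "u n x - u n y = d n * (x - y) + (H x - H y) -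
          (int2 (\<lambda>s. \<phi> n (u n s)) x - int2 (\<lambda>s. \<phi> n (u n s)) y)"
        using int_solD(2)[OF u[of n] x] int_solD(2)[OF u[of n], of y] y by (simp add: algebra_simps)
      then have "\<bar>u n x - u n y\<bar> \<le> \<bar>d n\<bar> * \<bar>x - y\<bar> + \<bar>H x - H y\<bar> + (2 * B) * \<bar>x - y\<bar>"
        using lip[OF x, of y n] y unfolding abs_mult[symmetric] by linarith
      also have "\<dots> \<le> Q * \<bar>x - y\<bar> + \<bar>H x - H y\<bar>"
        using mult_right_mono[of "\<bar>d n\<bar> + 2 * B" Q "\<bar>x - y\<bar>"] D[of n] Q by (simp add: algebra_simps)
      also have "\<dots> < e / 2 + e / 2"
        using y \<delta>(2)[of y] Q by (intro add_strict_mono) (auto simp: field_simps abs_minus_commute)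
      finally show "norm (u n x - u n y) < e" by simp
    qed (use \<delta> e Q in auto)
  qed (use bd in auto)
  have Ub: "\<bar>U x\<bar> \<le> M" if x: "x \<in> {-1..1}" for x
  proof (rule field_le_epsilon)
    fix e :: real assume "0 < e"
    then obtain N where "\<bar>u (k N) x - U x\<bar> < e" using conv[of e] x by force
    then show "\<bar>U x\<bar> \<le> M + e" using bd[OF x, of "k N"] by linarith
  qed
  have fU: "continuous_on {-1..1} (\<lambda>s. f (U s))" using continuous_on_compose2[OF f Uc] by auto
  have pw: "(\<lambda>n. u (k n) x) \<longlonglongrightarrow> U x" if x: "x \<in> {-1..1}" for x
    unfolding LIMSEQ_iff using conv x by fastforce
  have i2: "(\<lambda>n. int2 (\<lambda>s. \<phi> (k n) (u (k n) s)) x) \<longlonglongrightarrow> int2 (\<lambda>s. f (U s)) x" if x: "x \<in> {-1..1}" for x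
    unfolding LIMSEQ_iff
  proof (intro allI impI)
    fix e :: real assume e: "0 < e"
    \<comment> \<open>The integrand is at most 2e', the interval has length at most 2 and the kernel
      is at most 2: altogether 8e' = e/2.\<close>
    define e' where "e' = e / 16"
    have e': "e' > 0" using e by (simp add: e'_def)
    have "uniformly_continuous_on {-M..M} f"
      by (intro compact_uniformly_continuous continuous_on_subset[OF f]) auto
    then obtain \<delta> where \<delta>: "\<delta> > 0" "\<And>s t. \<bar>s\<bar> \<le> M \<Longrightarrow> \<bar>t\<bar> \<le> M \<Longrightarrow> \<bar>s - t\<bar> < \<delta> \<Longrightarrow> \<bar>f s - f t\<bar> < e'"
      unfolding uniformly_continuous_on_def dist_real_def using e'
      by (metis abs_le_iff atLeastAtMost_iff minus_le_iff)
    obtain N1 where N1: "\<And>n x. n \<ge> N1 \<Longrightarrow> x \<in> {-1..1} \<Longrightarrow> \<bar>u (k n) x - U x\<bar> < \<delta>"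
      using conv[OF \<delta>(1)] by auto
    obtain N2 where N2: "real N2 \<ge> M" "real N2 \<ge> 1 / e'" using real_arch_simple[of "max M (1 / e')"] by auto
    show "\<exists>N. \<forall>n\<ge>N. norm (int2 (\<lambda>s. \<phi> (k n) (u (k n) s)) x - int2 (\<lambda>s. f (U s)) x) < e"
    proof (intro exI[of _ "max N1 N2"] allI impI)
      fix n assume n: "max N1 N2 \<le> n"
      have kn: "k n \<ge> n" using k by (rule seq_suble)
      let ?w = "\<lambda>s. \<phi> (k n) (u (k n) s) - f (U s)"
      have wc: "continuous_on {-1..1} ?w" by (intro continuous_intros \<phi>u fU)
      have "\<bar>?w s\<bar> \<le> 2 * e'" if s: "s \<in> {-1..1}" for s
      proof -
        have "real N2 \<le> real (k n)" using n kn by simp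
        then have "M \<le> real (k n)" "1 / e' \<le> real (k n)" using N2 by linarith+
        moreover have "1 / (real (k n) + 1) \<le> e'"
        proof -
          have "1 / e' \<le> real (k n) + 1" using \<open>1 / e' \<le> real (k n)\<close> by simp
          then show ?thesis using e' by (simp add: field_simps)
        qed
        ultimately have "\<bar>\<phi> (k n) (u (k n) s) - f (u (k n) s)\<bar> \<le> e'"
          using approx[of "u (k n) s" "k n"] bd[OF s, of "k n"] by linarith
        moreover have "\<bar>f (u (k n) s) - f (U s)\<bar> < e'"
          using \<delta>(2)[OF bd[OF s] Ub[OF s]] N1[OF _ s, of n] n by simp
        ultimately show ?thesis by linarith
      qed
      then have "integral {-1..x} (\<lambda>s. \<bar>?w s\<bar>) \<le> integral {-1..x} (\<lambda>s. 2 * e')"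
        by (intro integral_mono_continuous continuous_on_const continuous_on_rabs wc x)
      also have "\<dots> \<le> 4 * e'" using x e' by (simp add: mult_right_mono)
      finally have "integral {-1..x} (\<lambda>s. \<bar>?w s\<bar>) \<le> 4 * e'" .
      then have "\<bar>int2 ?w x\<bar> \<le> 8 * e'" using abs_int2_le[OF L1_continuous[OF wc] x] by simp
      then show "norm (int2 (\<lambda>s. \<phi> (k n) (u (k n) s)) x - int2 (\<lambda>s. f (U s)) x) < e"
        using int2_diff[OF L1_continuous[OF \<phi>u] L1_continuous[OF fU] x] e by (simp add: e'_def)
    qed
  qed
  have "int_sol f H c0 d0 U"
    unfolding int_sol_def
  proof (intro conjI Uc ballI)
    fix x :: real assume x: "x \<in> {-1..1}"
    have "(\<lambda>n. c (k n) + d (k n) * (x + 1) + H x - int2 (\<lambda>s. \<phi> (k n) (u (k n) s)) x)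
        \<longlonglongrightarrow> c0 + d0 * (x + 1) + H x - int2 (\<lambda>s. f (U s)) x"
      using LIMSEQ_subseq_LIMSEQ[OF c k] LIMSEQ_subseq_LIMSEQ[OF d k]
      by (intro tendsto_intros i2[OF x]) (auto simp: o_def)
    moreover have "(\<lambda>n. c (k n) + d (k n) * (x + 1) + H x - int2 (\<lambda>s. \<phi> (k n) (u (k n) s)) x)
        = (\<lambda>n. u (k n) x)"
      using u x by (simp add: int_sol_def fun_eq_iff)
    ultimately show "U x = c0 + d0 * (x + 1) + H x - int2 (\<lambda>s. f (U s)) x"
      using pw[OF x] LIMSEQ_unique by metis
  qed
  then show ?thesis using that k pw by blast
qed

text \<open>Brouwer's theorem for z - F(z) clipped to the box. Where clipping acts at a fixed point,
  that component lies on a side and the residual would have the sign excluded there.\<close>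

lemma poincare_miranda:
  fixes F1 F2 :: "real \<times> real \<Rightarrow> real"
  assumes ab: "a1 \<le> b1" "a2 \<le> b2"
    and c: "continuous_on ({a1..b1} \<times> {a2..b2}) F1" "continuous_on ({a1..b1} \<times> {a2..b2}) F2"
    and s1: "\<And>q. q \<in> {a2..b2} \<Longrightarrow> F1 (a1, q) \<le> 0 \<and> F1 (b1, q) \<ge> 0"
    and s2: "\<And>p. p \<in> {a1..b1} \<Longrightarrow> F2 (p, a2) \<le> 0 \<and> F2 (p, b2) \<ge> 0"
  obtains p q where "p \<in> {a1..b1}" "q \<in> {a2..b2}" "F1 (p, q) = 0" "F2 (p, q) = 0"
proof -
  let ?S = "{a1..b1} \<times> {a2..b2}"
  define r where "r a b s = max a (min b s)" for a b s :: real
  define \<Phi> where "\<Phi> z = (r a1 b1 (fst z - F1 z), r a2 b2 (snd z - F2 z))" for z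
  obtain z where z: "z \<in> ?S" "\<Phi> z = z"
  proof (rule brouwer[of ?S \<Phi>])
    show "continuous_on ?S \<Phi>" unfolding \<Phi>_def r_def by (intro continuous_intros c)
    show "\<Phi> \<in> ?S \<rightarrow> ?S" using ab by (auto simp: \<Phi>_def r_def)
  qed (use ab in \<open>auto intro!: compact_Times convex_Times\<close>)
  obtain p q where pq: "z = (p, q)" by (cases z)
  have p: "p \<in> {a1..b1}" "q \<in> {a2..b2}" using z pq by auto
  have e: "r a1 b1 (p - F1 (p, q)) = p" "r a2 b2 (q - F2 (p, q)) = q"
    using z(2) by (auto simp: \<Phi>_def pq)
  have "F1 (p, q) = 0" using e(1) p s1[OF p(2)] unfolding r_def
    by (smt (verit) atLeastAtMost_iff)
  moreover have "F2 (p, q) = 0" using e(2) p s2[OF p(1)] unfolding r_def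
    by (smt (verit) atLeastAtMost_iff)
  ultimately show ?thesis using that p by blast
qed

subsection \<open>The half-linear oscillator\<close>

lemma DERIV_glue:
  fixes g h :: "real \<Rightarrow> real"
  assumes g: "\<And>x. (g has_real_derivative g' x) (at x)" and h: "\<And>x. (h has_real_derivative h' x) (at x)"
    and eq: "g c = h c" "g' c = h' c"
  shows "((\<lambda>x. if x \<le> c then g x else h x) has_real_derivative (if x \<le> c then g' x else h' x)) (at x)"
proof (cases x c rule: linorder_cases)
  case less
  have "((\<lambda>x. if x \<le> c then g x else h x) has_real_derivative g' x) (at x)"
    using g[of x] by (rule DERIV_cong_ev[OF refl _ refl, THEN iffD1, rotated])
      (use eventually_nhds_in_open[of "{..<c}" x] less in \<open>auto elim!: eventually_mono\<close>)
  then show ?thesis using less by simp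
next
  case greater
  have "((\<lambda>x. if x \<le> c then g x else h x) has_real_derivative h' x) (at x)"
    using h[of x] by (rule DERIV_cong_ev[OF refl _ refl, THEN iffD1, rotated])
      (use eventually_nhds_in_open[of "{c<..}" x] greater in \<open>auto elim!: eventually_mono\<close>)
  then show ?thesis using greater by simp
next
  case equal
  let ?f = "\<lambda>x. if x \<le> c then g x else h x"
  have "((\<lambda>y. (?f y - ?f c) / (y - c)) \<longlongrightarrow> g' c) (at_left c)"
  proof (rule Lim_transform_eventually)
    show "((\<lambda>y. (g y - g c) / (y - c)) \<longlongrightarrow> g' c) (at_left c)"
      using g[of c] filterlim_at_split by (fastforce simp: has_field_derivative_iff filterlim_at_split)
    show "\<forall>\<^sub>F y in at_left c. (g y - g c) / (y - c) = (?f y - ?f c) / (y - c)"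
      by (simp add: eventually_at_filter)
  qed
  moreover have "((\<lambda>y. (?f y - ?f c) / (y - c)) \<longlongrightarrow> g' c) (at_right c)"
  proof (rule Lim_transform_eventually)
    show "((\<lambda>y. (h y - h c) / (y - c)) \<longlongrightarrow> g' c) (at_right c)"
      using h[of c] eq by (fastforce simp: has_field_derivative_iff filterlim_at_split)
    show "\<forall>\<^sub>F y in at_right c. (h y - h c) / (y - c) = (?f y - ?f c) / (y - c)"
      using eq by (simp add: eventually_at_filter)
  qed
  ultimately show ?thesis using equal by (simp add: has_field_derivative_iff filterlim_at_split)
qed

text \<open>All zeros are crossed upwards, so there can be no second one: at the first return to
  nonpositive values the function would be zero and increasing, although it is positive just
  before.\<close>

lemma pos_right_of_zero:
  fixes h :: "real \<Rightarrow> real"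
  assumes d: "\<And>x. l < x \<Longrightarrow> x < r \<Longrightarrow> (h has_real_derivative h' x) (at x)"
    and p: "\<And>x. l < x \<Longrightarrow> x < r \<Longrightarrow> h x = 0 \<Longrightarrow> h' x > 0"
    and x0: "l < x0" "h x0 = 0" and x: "x0 < x" "x < r"
  shows "h x > 0"
proof (rule ccontr)
  assume n: "\<not> h x > 0"
  obtain e where e: "e > 0" "\<And>t. 0 < t \<Longrightarrow> t < e \<Longrightarrow> h (x0 + t) > 0"
    using DERIV_pos_inc_right[OF d p, of x0] x0 x by auto
  define t where "t = min (e / 2) ((x - x0) / 2)"
  have t: "0 < t" "t < e" "x0 + t < x" using e x by (auto simp: t_def min_def field_simps)
  have c: "continuous_on {x0 + t..x} h"
    by (intro continuous_at_imp_continuous_on ballI DERIV_isCont[OF d]) (use x0 x t in auto)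
  define A where "A = {s \<in> {x0 + t..x}. h s \<in> {..0}}"
  have "closed ({x0 + t..x} \<inter> h -` {..0})" by (intro continuous_closed_preimage c) auto
  moreover have "{x0 + t..x} \<inter> h -` {..0} = A" by (auto simp: A_def)
  ultimately have "closed A" by simp
  moreover have Ane: "A \<noteq> {}" using n t by (auto simp: A_def)
  moreover have Ab: "bdd_below A" by (auto simp: A_def bdd_below_def)
  ultimately have IA: "Inf A \<in> A" by (metis closed_contains_Inf)
  define y where "y = Inf A"
  have y: "x0 + t \<le> y" "y \<le> x" "h y \<le> 0" using IA by (auto simp: A_def y_def)
  have lt: "h s > 0" if "x0 + t \<le> s" "s < y" for s
    using cInf_lower[OF _ Ab, of s] that y by (force simp: A_def y_def)
  have yt: "x0 + t < y" using e(2)[OF t(1,2)] y by (metis less_eq_real_def not_le)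
  have "h y = 0"
  proof (rule antisym[OF y(3)])
    have "((\<lambda>s. h s) \<longlongrightarrow> h y) (at_left y)"
      using DERIV_isCont[OF d[of y]] x0 x t y unfolding isCont_def
      by (auto intro: tendsto_mono[rotated] at_le)
    then show "0 \<le> h y"
      using lt yt by (intro tendsto_lowerbound[where F = "at_left y"])
        (auto intro!: eventually_mono[OF eventually_at_left_real[OF yt]] less_imp_le)
  qed
  then have "h' y > 0" using p x0 x t y by auto
  then obtain e' where e': "e' > 0" "\<And>t. 0 < t \<Longrightarrow> t < e' \<Longrightarrow> h (y - t) < h y"
    using DERIV_pos_inc_left[OF d, of y] x0 x t y by auto
  define t' where "t' = min (e' / 2) ((y - (x0 + t)) / 2)"
  have "0 < t'" "t' < e'" "x0 + t \<le> y - t'" using e' yt by (auto simp: t'_def min_def field_simps)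
  then show False using e'(2)[of t'] lt[of "y - t'"] \<open>h y = 0\<close> by auto
qed

lemma neg_left_of_zero:
  fixes h :: "real \<Rightarrow> real"
  assumes d: "\<And>x. l < x \<Longrightarrow> x < r \<Longrightarrow> (h has_real_derivative h' x) (at x)"
    and p: "\<And>x. l < x \<Longrightarrow> x < r \<Longrightarrow> h x = 0 \<Longrightarrow> h' x > 0"
    and x0: "x0 < r" "h x0 = 0" and x: "l < x" "x < x0"
  shows "h x < 0"
proof -
  have "- h (- (- x)) > 0"
  proof (rule pos_right_of_zero[of "-r" "-l" "\<lambda>x. - h (- x)" "\<lambda>x. h' (- x)" "- x0" "- x"])
    fix t assume "- r < t" "t < - l"
    then show "((\<lambda>x. - h (- x)) has_real_derivative h' (- t)) (at t)"
      using DERIV_mirror[of h "h' (-t)" t] d[of "-t"] by (auto intro!: derivative_eq_intros)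
  qed (use p x0 x in auto)
  then show ?thesis by simp
qed

text \<open>Besides the nonlinearity a s^+ - b s^-, this is used as the general positively
  homogeneous function of one variable, with slope a on the right and b on the left; the graph of
  the rays and the right residual along them have this form, with coefficients of any sign.\<close>

definition hl :: "real \<Rightarrow> real \<Rightarrow> real \<Rightarrow> real" where
  "hl a b s = a * max s 0 - b * max (- s) 0"

locale half_linear =
  fixes a b :: real
  assumes a_pos: "a > 0" and b_pos: "b > 0"
begin

definition "ra = sqrt a"
definition "rb = sqrt b"
definition "per = pi / ra + pi / rb"

lemma ra_pos: "ra > 0" and rb_pos: "rb > 0" and ra_sq: "ra * ra = a" and rb_sq: "rb * rb = b"
  using a_pos b_pos by (auto simp: ra_def rb_def)

lemma sq_div: "a * (t / ra) = ra * t" "b * (t / rb) = rb * t"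
proof -
  have "ra * ra * (t / ra) = ra * t" "rb * rb * (t / rb) = rb * t" using ra_pos rb_pos by auto
  then show "a * (t / ra) = ra * t" "b * (t / rb) = rb * t" by (simp_all only: ra_sq rb_sq)
qed

lemma half_periods:
  "0 < pi / ra" "0 < pi / rb" "pi / (2 * ra) = pi / ra / 2" "pi / (2 * rb) = pi / rb / 2"
  using ra_pos rb_pos by auto

lemma per_pos: "per > 0"
  using half_periods unfolding per_def by linarith

text \<open>The formulas are used on the interval from -pi/rb to \<open>per\<close>, which is longer
  than one period. Every point, multiples of the period included, then has a neighbourhood in which
  one translate of them is valid.\<close>

definition "S0 y = (if y \<le> 0 then sin (rb * y) / rb
   else if y \<le> pi / ra then sin (ra * y) / ra else - sin (rb * (y - pi / ra)) / rb)"
definition "C0 y = (if y \<le> 0 then cos (rb * y)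
   else if y \<le> pi / ra then cos (ra * y) else - cos (rb * (y - pi / ra)))"

lemma S0_deriv: "(S0 has_real_derivative C0 y) (at y)"
  unfolding S0_def C0_def using ra_pos rb_pos
  by (intro DERIV_glue) (auto intro!: derivative_eq_intros)

lemma C0_deriv:
  assumes "- pi / rb \<le> y" "y \<le> per"
  shows "(C0 has_real_derivative - hl a b (S0 y)) (at y)"
proof -
  define N0 where "N0 y = (if y \<le> 0 then - rb * sin (rb * y)
     else if y \<le> pi / ra then - ra * sin (ra * y) else rb * sin (rb * (y - pi / ra)))" for y
  have "(C0 has_real_derivative N0 y) (at y)"
    unfolding C0_def N0_def using ra_pos rb_pos
    by (intro DERIV_glue) (auto intro!: derivative_eq_intros)
  moreover have "N0 y = - hl a b (S0 y)"
  proof -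
    consider "y \<le> 0" | "0 < y" "y \<le> pi / ra" | "pi / ra < y" by linarith
    then show ?thesis
    proof cases
      case 1
      have "sin (rb * (- y)) \<ge> 0"
        using 1 assms rb_pos by (intro sin_ge_zero mult_nonneg_nonneg) (auto simp: field_simps)
      then have "sin (rb * y) / rb \<le> 0" using rb_pos by (simp add: divide_le_0_iff)
      moreover have e: "S0 y = sin (rb * y) / rb" "N0 y = - (rb * sin (rb * y))"
        using 1 by (auto simp: S0_def N0_def)
      ultimately have "hl a b (S0 y) = b * (sin (rb * y) / rb)" by (simp add: hl_def)
      then show ?thesis unfolding sq_div(2) by (simp add: e)
    next
      case 2
      have "sin (ra * y) \<ge> 0"
        using 2 ra_pos by (intro sin_ge_zero) (auto simp: field_simps)
      then have "sin (ra * y) / ra \<ge> 0" using ra_pos by simp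
      moreover have e: "S0 y = sin (ra * y) / ra" "N0 y = - (ra * sin (ra * y))"
        using 2 by (auto simp: S0_def N0_def)
      ultimately have "hl a b (S0 y) = a * (sin (ra * y) / ra)" by (simp add: hl_def)
      then show ?thesis unfolding sq_div(1) by (simp add: e)
    next
      case 3
      have "rb * (y - pi / ra) \<le> rb * (pi / rb)"
        using assms rb_pos unfolding per_def by (intro mult_left_mono) auto
      then have "sin (rb * (y - pi / ra)) \<ge> 0"
        using 3 rb_pos by (intro sin_ge_zero) auto
      then have "- sin (rb * (y - pi / ra)) / rb \<le> 0" using rb_pos by simp
      moreover have e: "S0 y = - sin (rb * (y - pi / ra)) / rb" "N0 y = - (rb * - sin (rb * (y - pi / ra)))"
        using 3 half_periods by (auto simp: S0_def N0_def)
      ultimately have "hl a b (S0 y) = b * (- sin (rb * (y - pi / ra)) / rb)" by (simp add: hl_def)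
      then show ?thesis unfolding sq_div(2) by (simp only: e)
    qed
  qed
  ultimately show ?thesis by simp
qed

section \<open>Periodic extension, symmetry and energy\<close>

definition "S x = S0 (x - per * of_int \<lfloor>x / per\<rfloor>)"
definition "C x = C0 (x - per * of_int \<lfloor>x / per\<rfloor>)"

lemma reduce:
  obtains n :: int and y where "x = per * of_int n + y" "0 \<le> y" "y < per"
proof (rule that)
  show "x = per * of_int \<lfloor>x / per\<rfloor> + (x - per * of_int \<lfloor>x / per\<rfloor>)" by simp
  show "0 \<le> x - per * of_int \<lfloor>x / per\<rfloor>" "x - per * of_int \<lfloor>x / per\<rfloor> < per"
    using floor_divide_lower[OF per_pos, of x] floor_divide_upper[OF per_pos, of x]
    by (auto simp: algebra_simps)
qed

text \<open>For negative y the floor is n - 1; there the left branch of \<open>S0\<close> agrees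
  with the last branch one period later.\<close>

lemma SC_eq:
  assumes "- pi / rb < y" "y < per"
  shows "S (per * of_int n + y) = S0 y" "C (per * of_int n + y) = C0 y"
proof -
  have "S (per * of_int n + y) = S0 y \<and> C (per * of_int n + y) = C0 y"
  proof (cases "y \<ge> 0")
    case True
    have "\<lfloor>(per * of_int n + y) / per\<rfloor> = n"
      using True assms per_pos by (intro floor_unique) (auto simp: field_simps)
    then show ?thesis by (simp add: S_def C_def)
  next
    case False
    have "pi / rb < per" using ra_pos by (simp add: per_def)
    then have fl: "\<lfloor>(per * of_int n + y) / per\<rfloor> = n - 1"
      using False assms per_pos by (intro floor_unique) (auto simp: field_simps)
    have "S (per * of_int n + y) = S0 (y + per)" "C (per * of_int n + y) = C0 (y + per)"
      unfolding S_def C_def fl by (auto simp: algebra_simps)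
    moreover have "y + per > pi / ra" "pi / ra > 0" using assms ra_pos by (auto simp: per_def)
    moreover have "rb * (y + per - pi / ra) = rb * y + pi"
      using rb_pos by (simp add: per_def algebra_simps)
    ultimately show ?thesis using False by (simp add: S0_def C0_def)
  qed
  then show "S (per * of_int n + y) = S0 y" "C (per * of_int n + y) = C0 y" by auto
qed

lemma S_deriv: "(S has_real_derivative C x) (at x)"
  and C_deriv: "(C has_real_derivative - hl a b (S x)) (at x)"
proof -
  obtain n y where x: "x = per * of_int n + y" and y: "0 \<le> y" "y < per" by (rule reduce)
  have p: "- pi / rb < 0" using rb_pos by simp
  have ev: "\<forall>\<^sub>F z in nhds x. z \<in> {per * of_int n - pi / rb<..<per * of_int n + per}"
    using x y p by (intro eventually_nhds_in_open) auto
  have eS: "\<forall>\<^sub>F z in nhds x. S z = S0 (z - per * of_int n)"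
    using ev by eventually_elim (use SC_eq(1)[of "_ - per * of_int n" n] in auto)
  have eC: "\<forall>\<^sub>F z in nhds x. C z = C0 (z - per * of_int n)"
    using ev by eventually_elim (use SC_eq(2)[of "_ - per * of_int n" n] in auto)
  have "((\<lambda>z. S0 (z - per * of_int n)) has_real_derivative C0 y * 1) (at x)"
    by (rule DERIV_chain'[where f = "\<lambda>z. z - per * of_int n"])
       (use S0_deriv[of y] x in \<open>auto intro!: derivative_eq_intros\<close>)
  then show "(S has_real_derivative C x) (at x)"
    using DERIV_cong_ev[OF refl eS, of "C0 y"] SC_eq[of y n] x y p by simp
  have "((\<lambda>z. C0 (z - per * of_int n)) has_real_derivative - hl a b (S0 y) * 1) (at x)"
    by (rule DERIV_chain'[where f = "\<lambda>z. z - per * of_int n"])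
       (use C0_deriv[of y] x y p in \<open>auto intro!: derivative_eq_intros\<close>)
  then show "(C has_real_derivative - hl a b (S x)) (at x)"
    using DERIV_cong_ev[OF refl eC, of "- hl a b (S0 y)"] SC_eq[of y n] x y p by simp
qed

lemma S_cont: "continuous_on A S"
  using S_deriv by (meson DERIV_isCont continuous_at_imp_continuous_on)

lemma S_periodic: "S (x + per) = S x"
proof -
  obtain n y where x: "x = per * of_int n + y" and y: "0 \<le> y" "y < per" by (rule reduce)
  have p: "- pi / rb < 0" using rb_pos by simp
  have e: "x + per = per * of_int (n + 1) + y" using x by (simp add: algebra_simps)
  show "S (x + per) = S x"
    unfolding e using SC_eq[of y n] SC_eq[of y "n + 1"] x y p by auto
qed

text \<open>Reflection in the maximum at pi/(2 ra). It carries statements about the left boundary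
  condition over to the right one.\<close>

lemma S_reflect: "S (pi / ra - x) = S x"
proof -
  obtain n y where x: "x = per * of_int n + y" and y: "0 \<le> y" "y < per" by (rule reduce)
  have p: "- pi / rb < 0" "0 < pi / rb" "0 < pi / ra" using rb_pos ra_pos by auto
  have e: "pi / ra - x = per * of_int (- n) + (pi / ra - y)" using x by simp
  have "- pi / rb < pi / ra - y" "pi / ra - y < per" using y p by (auto simp: per_def)
  note f = SC_eq[OF this, of "- n", folded e] SC_eq[of y n, folded x]
  have r: "ra * (pi / ra - y) = pi - ra * y" "rb * (pi / ra - y) = - (rb * (y - pi / ra))"
    using ra_pos by (auto simp: algebra_simps)
  have "S0 (pi / ra - y) = S0 y"
  proof -
    consider "y = 0" | "0 < y" "y < pi / ra" | "y = pi / ra" | "0 < y" "y > pi / ra"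
      using y p by linarith
    then show ?thesis
      using p ra_pos by cases (auto simp: S0_def r divide_le_0_iff not_le[THEN iffD2, OF pi_gt_zero])
  qed
  then show "S (pi / ra - x) = S x" using f y p by auto
qed

text \<open>Its square is twice the potential of \<open>hl a b\<close>. As a maximum of two linear
  functions it is convex, which is the form needed for subconvex combinations.\<close>

definition "gauge_hl s = max (ra * s) (- rb * s)"

lemma gauge_nonneg: "gauge_hl s \<ge> 0"
  using ra_pos rb_pos by (cases "s \<ge> 0") (auto simp: gauge_hl_def le_max_iff_disj mult_nonpos_nonneg mult_le_0_iff)

lemma energy: "(C x)\<^sup>2 + (gauge_hl (S x))\<^sup>2 = 1"
proof -
  obtain n y where x: "x = per * of_int n + y" and y: "0 \<le> y" "y < per" by (rule reduce)
  have p: "- pi / rb < 0" using rb_pos by simp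
  consider "y = 0" | "0 < y" "y \<le> pi / ra" | "pi / ra < y" using y by linarith
  then have "(C0 y)\<^sup>2 + (gauge_hl (S0 y))\<^sup>2 = 1"
  proof cases
    case 1
    then show ?thesis by (simp add: S0_def C0_def gauge_hl_def)
  next
    case 2
    have s: "sin (ra * y) \<ge> 0"
      using 2 ra_pos by (intro sin_ge_zero) (auto simp: field_simps)
    then have "- rb * (sin (ra * y) / ra) \<le> 0" "0 \<le> ra * (sin (ra * y) / ra)"
      using ra_pos rb_pos by (auto simp: mult_nonneg_nonneg)
    then have "gauge_hl (sin (ra * y) / ra) = sin (ra * y)"
      using ra_pos unfolding gauge_hl_def by (simp add: max_def)
    then show ?thesis using 2 by (simp add: S0_def C0_def)
  next
    case 3
    have "rb * (y - pi / ra) \<le> rb * (pi / rb)"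
      using y rb_pos unfolding per_def by (intro mult_left_mono) auto
    then have s: "sin (rb * (y - pi / ra)) \<ge> 0"
      using 3 rb_pos by (intro sin_ge_zero) auto
    have y0: "y > 0" using 3 ra_pos by (smt (verit) divide_pos_pos pi_gt_zero)
    have "ra * (- sin (rb * (y - pi / ra)) / rb) \<le> 0" "0 \<le> - rb * (- sin (rb * (y - pi / ra)) / rb)"
      using ra_pos rb_pos s by (auto simp: mult_nonneg_nonneg)
    then have "gauge_hl (- sin (rb * (y - pi / ra)) / rb) = sin (rb * (y - pi / ra))"
      using rb_pos unfolding gauge_hl_def by (simp add: max_def)
    then show ?thesis using 3 y0 by (simp add: S0_def C0_def)
  qed
  then show ?thesis using SC_eq[of y n] x y p by simp
qed

lemma S_bounds: "- 1 / rb \<le> S x" "S x \<le> 1 / ra"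
proof -
  have "(gauge_hl (S x))\<^sup>2 \<le> 1" using energy[of x] by (smt (verit) zero_le_power2)
  then have "gauge_hl (S x) \<le> 1" using power2_le_imp_le[of "gauge_hl (S x)" 1] by simp
  then have "ra * S x \<le> 1" "- rb * S x \<le> 1" by (auto simp: gauge_hl_def)
  then show "- 1 / rb \<le> S x" "S x \<le> 1 / ra" using ra_pos rb_pos by (auto simp: field_simps)
qed

text \<open>The critical points of \<open>S\<close>: minima at even, maxima at odd indices.\<close>

definition pk :: "int \<Rightarrow> real" where
  "pk j = per * of_int (j div 2) + (if even j then - pi / (2 * rb) else pi / (2 * ra))"

text \<open>The sign of \<open>C\<close> between \<open>pk j\<close> and \<open>pk (j + 1)\<close>;
  multiplying by it treats increasing and decreasing arcs alike.\<close>

definition sg :: "int \<Rightarrow> real" where "sg j = (if even j then 1 else -1)"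

lemma pk_even: "pk (2 * i) = per * of_int i - pi / (2 * rb)"
  and pk_odd: "pk (2 * i + 1) = per * of_int i + pi / (2 * ra)"
  by (auto simp: pk_def)

lemma pk_period: "pk (j + 2) = pk j + per"
  by (auto simp: pk_def algebra_simps)

lemma pk_less_Suc: "pk j < pk (j + 1)"
proof (cases "even j")
  case True
  then obtain i where j: "j = 2 * i" by (elim evenE)
  have "pk (2 * i) < pk (2 * i + 1)" using half_periods pk_even[of i] pk_odd[of i] by linarith
  then show ?thesis using j by simp
next
  case False
  then obtain i where j: "j = 2 * i + 1" by (elim oddE)
  have "pi / (2 * ra) + pi / (2 * rb) < per"
    using half_periods unfolding per_def by linarith
  then show ?thesis using j pk_odd[of i] pk_even[of "i + 1"] by (simp add: algebra_simps)
qed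

lemma pk_strict_mono: "i < j \<Longrightarrow> pk i < pk j"
proof (induction j rule: int_gr_induct[of i])
  case base then show ?case by (rule pk_less_Suc)
next
  case (step j) then show ?case using pk_less_Suc[of j] by simp
qed

lemma pk_less_iff: "pk i < pk j \<longleftrightarrow> i < j"
  by (metis linorder_cases order_less_irrefl order_less_asym pk_strict_mono)

lemma pk_inj: "pk i = pk j \<longleftrightarrow> i = j"
  by (metis linorder_cases order_less_irrefl pk_strict_mono)

lemma pk_mono: "i \<le> j \<Longrightarrow> pk i \<le> pk j"
  by (metis less_eq_real_def order_le_less pk_strict_mono)

lemma pk_reflect: "pi / ra - pk j = pk (2 - j)"
proof (cases "even j")
  case True
  then obtain i where j: "j = 2 * i" by (elim evenE)
  have "2 - j = 2 * (1 - i)" using j by simp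
  moreover have "per * real_of_int (1 - i) = pi / ra + pi / rb - per * of_int i"
    unfolding per_def[symmetric] by (simp add: right_diff_distrib)
  ultimately show ?thesis using j pk_even[of i] pk_even[of "1 - i"] half_periods by simp
next
  case False
  then obtain i where j: "j = 2 * i + 1" by (elim oddE)
  have "2 - j = 2 * (- i) + 1" using j by simp
  then show ?thesis using j pk_odd[of i] pk_odd[of "- i"] half_periods by simp
qed

lemma pk_cover: obtains j where "pk j \<le> x" "x < pk (j + 1)"
proof -
  obtain n y where x: "x + pi / (2 * rb) = per * of_int n + y" and y: "0 \<le> y" "y < per" by (rule reduce)
  show ?thesis
  proof (cases "x < pk (2 * n + 1)")
    case True
    then show ?thesis using that[of "2 * n"] pk_even[of n] x y by simp
  next
    case False
    then show ?thesis using that[of "2 * n + 1"] pk_even[of "n + 1"] x y by (simp add: algebra_simps)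
  qed
qed

lemma sg_Suc: "sg (j + 1) = - sg j" by (simp add: sg_def)

lemma S_pk: "S (pk j) = (if even j then - 1 / rb else 1 / ra)" and C_pk: "C (pk j) = 0"
proof -
  have "S (pk j) = (if even j then - 1 / rb else 1 / ra) \<and> C (pk j) = 0"
  proof (cases "even j")
    case True
    then obtain i where j: "j = 2 * i" by (elim evenE)
    have "pk j = per * of_int i + (- pi / (2 * rb))" using j pk_even by simp
    moreover have "- pi / rb < - pi / (2 * rb)" "- pi / (2 * rb) < 0" using rb_pos by (auto simp: field_simps)
    moreover have "rb * (- pi / (2 * rb)) = - (pi / 2)" using rb_pos by simp
    moreover have "rb \<noteq> 0" using rb_pos by simp
    ultimately show ?thesis using True SC_eq[of "- pi / (2 * rb)" i] per_pos by (simp add: S0_def C0_def)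
  next
    case False
    then obtain i where j: "j = 2 * i + 1" by (elim oddE)
    have "pk j = per * of_int i + pi / (2 * ra)" using j pk_odd by simp
    moreover have "0 < pi / (2 * ra)" "pi / (2 * ra) \<le> pi / ra" "- pi / rb < 0"
      using ra_pos rb_pos by (auto simp: field_simps)
    moreover have "pi / (2 * ra) < per"
      using half_periods unfolding per_def by linarith
    moreover have "ra * (pi / (2 * ra)) = pi / 2" "ra \<noteq> 0" using ra_pos by auto
    ultimately show ?thesis using False SC_eq[of "pi / (2 * ra)" i] by (simp add: S0_def C0_def)
  qed
  then show "S (pk j) = (if even j then - 1 / rb else 1 / ra)" "C (pk j) = 0" by auto
qed

lemma C_sign:
  assumes "pk j < x" "x < pk (j + 1)"
  shows "sg j * C x > 0"
proof (cases "even j")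
  case True
  then obtain i where j: "j = 2 * i" by (elim evenE)
  define y where "y = x - per * of_int i"
  have y: "- pi / (2 * rb) < y" "y < pi / (2 * ra)"
    using assms j pk_even[of i] pk_odd[of i] by (auto simp: y_def)
  have le: "- pi / rb < - pi / (2 * rb)" "pi / (2 * ra) < pi / ra" "pi / ra < per" "pi / (2 * ra) < per"
    using half_periods unfolding per_def by linarith+
  have "C0 y > 0"
  proof (cases "y \<le> 0")
    case True
    then have "rb * y \<le> 0" "- (pi / 2) < rb * y"
      using y rb_pos mult_nonneg_nonpos[of rb y] by (auto simp: field_simps)
    then have "cos (rb * y) > 0" using pi_gt_zero by (intro cos_gt_zero_pi) linarith+
    then show ?thesis using True by (simp add: C0_def)
  next
    case False
    then have "ra * y > 0" "ra * y < pi / 2"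
      using y ra_pos by (auto simp: field_simps)
    then have "cos (ra * y) > 0" using pi_gt_zero by (intro cos_gt_zero_pi) linarith+
    then show ?thesis using False y le by (simp add: C0_def)
  qed
  then show ?thesis using True SC_eq(2)[of y i] y le by (simp add: sg_def y_def)
next
  case False
  then obtain i where j: "j = 2 * i + 1" by (elim oddE)
  define y where "y = x - per * of_int i"
  have y: "pi / (2 * ra) < y" "y < per - pi / (2 * rb)"
    using assms j pk_odd[of i] pk_even[of "i + 1"] by (auto simp: y_def algebra_simps)
  have p: "0 < pi / (2 * ra)" "0 < pi / (2 * rb)" "- pi / rb < 0" using ra_pos rb_pos by auto
  have "C0 y < 0"
  proof (cases "y \<le> pi / ra")
    case True
    have "cos (pi - ra * y) > 0"
      using y True ra_pos by (intro cos_gt_zero_pi) (auto simp: field_simps)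
    then show ?thesis using y True p by (simp add: C0_def)
  next
    case n: False
    have "rb * (y - pi / ra) < rb * (pi / (2 * rb))"
      using y(2) half_periods rb_pos unfolding per_def by (intro mult_strict_left_mono) linarith+
    moreover have "0 < rb * (y - pi / ra)" using n rb_pos by simp
    moreover have "rb * (pi / (2 * rb)) = pi / 2" using rb_pos by simp
    ultimately have "cos (rb * (y - pi / ra)) > 0"
      using pi_gt_zero by (intro cos_gt_zero_pi) linarith+
    then show ?thesis using y n p by (simp add: C0_def)
  qed
  then show ?thesis using False SC_eq(2)[of y i] y p by (simp add: sg_def y_def)
qed

lemma C_zero_iff: "C x = 0 \<longleftrightarrow> (\<exists>j. x = pk j)"
proof
  assume "C x = 0"
  obtain j where j: "pk j \<le> x" "x < pk (j + 1)" by (rule pk_cover)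
  then show "\<exists>j. x = pk j" using C_sign[of j x] \<open>C x = 0\<close> by (metis less_eq_real_def mult_zero_right order_less_irrefl)
qed (auto simp: C_pk)

lemma S_extreme: "sg j * S (pk j) < 0" "sg j * S (pk j) \<le> sg j * S x" "sg j * S x \<le> sg j * S (pk (j + 1))"
  using S_bounds[of x] ra_pos rb_pos by (auto simp: S_pk sg_def)

text \<open>The unit ball of \<open>(s, c) \<mapsto> sqrt (gauge_hl s ^ 2 + c ^ 2)\<close> is convex and symmetric in \<open>c\<close>, so
  a subconvex combination of points of the energy curve lies strictly inside it.\<close>

lemma subconvex_derivative_less:
  assumes al: "\<alpha> \<in> A_plus m" and be: "\<And>i. i \<in> {1..m} \<Longrightarrow> \<bar>\<beta> i\<bar> \<le> \<alpha> i"
    and eq: "S y = (\<Sum>i=1..m. \<alpha> i * S (z i))"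
  shows "\<bar>\<Sum>i=1..m. \<beta> i * C (z i)\<bar> < \<bar>C y\<bar>"
proof -
  have al0: "\<alpha> i \<ge> 0" if "i \<in> {1..m}" for i using al that by (auto simp: A_plus_def)
  have al1: "(\<Sum>i=1..m. \<alpha> i) < 1" "(\<Sum>i=1..m. \<alpha> i) \<ge> 0" using al by (auto simp: A_plus_def intro: sum_nonneg)
  \<comment> \<open>Complex numbers serve as the Euclidean plane. By the energy identity the i-th
    vector has length \<alpha> i, so the triangle inequality bounds the sum by a number below
    1.\<close>
  define w where "w i = Complex (\<alpha> i * gauge_hl (S (z i))) (\<alpha> i * \<bar>C (z i)\<bar>)" for i
  have nw: "norm (w i) = \<alpha> i" if "i \<in> {1..m}" for i
  proof -
    have "norm (w i) = sqrt ((\<alpha> i)\<^sup>2 * ((C (z i))\<^sup>2 + (gauge_hl (S (z i)))\<^sup>2))"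
      by (simp add: w_def complex_norm power_mult_distrib algebra_simps)
    then show ?thesis using energy al0[OF that] by simp
  qed
  have "norm (\<Sum>i=1..m. w i) \<le> (\<Sum>i=1..m. \<alpha> i)"
    using norm_sum[of w "{1..m}"] nw by simp
  then have "(norm (\<Sum>i=1..m. w i))\<^sup>2 < 1"
    using al1 by (simp add: power_less_one_iff abs_square_less_1)
  moreover have "(norm (\<Sum>i=1..m. w i))\<^sup>2
      = (\<Sum>i=1..m. \<alpha> i * gauge_hl (S (z i)))\<^sup>2 + (\<Sum>i=1..m. \<alpha> i * \<bar>C (z i)\<bar>)\<^sup>2"
    unfolding cmod_power2 by (simp add: w_def)
  moreover have "(gauge_hl (S y))\<^sup>2 \<le> (\<Sum>i=1..m. \<alpha> i * gauge_hl (S (z i)))\<^sup>2"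
  proof (rule power_mono[OF _ gauge_nonneg])
    have "ra * S y \<le> (\<Sum>i=1..m. \<alpha> i * gauge_hl (S (z i)))"
      unfolding eq sum_distrib_left
    proof (rule sum_mono)
      fix i assume "i \<in> {1..m}"
      then have "\<alpha> i * (ra * S (z i)) \<le> \<alpha> i * gauge_hl (S (z i))"
        using al0 by (intro mult_left_mono) (auto simp: gauge_hl_def)
      then show "ra * (\<alpha> i * S (z i)) \<le> \<alpha> i * gauge_hl (S (z i))" by (simp add: mult_ac)
    qed
    moreover have "- rb * S y \<le> (\<Sum>i=1..m. \<alpha> i * gauge_hl (S (z i)))"
      unfolding eq sum_distrib_left
    proof (rule sum_mono)
      fix i assume "i \<in> {1..m}"
      then have "\<alpha> i * (- rb * S (z i)) \<le> \<alpha> i * gauge_hl (S (z i))"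
        using al0 by (intro mult_left_mono) (auto simp: gauge_hl_def)
      then show "- rb * (\<alpha> i * S (z i)) \<le> \<alpha> i * gauge_hl (S (z i))" by (simp add: mult_ac)
    qed
    ultimately show "gauge_hl (S y) \<le> (\<Sum>i=1..m. \<alpha> i * gauge_hl (S (z i)))"
      by (simp add: gauge_hl_def)
  qed
  ultimately have "(\<Sum>i=1..m. \<alpha> i * \<bar>C (z i)\<bar>)\<^sup>2 < (C y)\<^sup>2" using energy[of y] by linarith
  then have "\<bar>\<Sum>i=1..m. \<alpha> i * \<bar>C (z i)\<bar>\<bar> < \<bar>C y\<bar>"
    by (simp add: abs_le_square_iff flip: not_le)
  moreover have "\<bar>\<Sum>i=1..m. \<beta> i * C (z i)\<bar> \<le> (\<Sum>i=1..m. \<alpha> i * \<bar>C (z i)\<bar>)"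
    by (rule order_trans[OF sum_abs]) (auto intro!: sum_mono mult_right_mono be simp: abs_mult)
  ultimately show ?thesis by linarith
qed

end

subsection \<open>Phases satisfying the boundary conditions\<close>

context half_linear
begin

text \<open>\<open>lres\<close> and \<open>rres\<close> are the residuals of the two boundary conditions for the function
  \<open>x \<mapsto> S (\<tau> x + \<theta>)\<close>.\<close>

definition lres :: "(nat \<Rightarrow> real) \<Rightarrow> (nat \<Rightarrow> real) \<Rightarrow> nat \<Rightarrow> real \<Rightarrow> real \<Rightarrow> real" where
  "lres \<alpha> \<eta> m \<theta> \<tau> = S (\<theta> - \<tau>) - (\<Sum>i=1..m. \<alpha> i * S (\<theta> + \<tau> * \<eta> i))"

definition rres :: "(nat \<Rightarrow> real) \<Rightarrow> (nat \<Rightarrow> real) \<Rightarrow> nat \<Rightarrow> real \<Rightarrow> real \<Rightarrow> real" where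
  "rres \<alpha> \<eta> m \<theta> \<tau> = S (\<theta> + \<tau>) - (\<Sum>i=1..m. \<alpha> i * S (\<theta> + \<tau> * \<eta> i))"

text \<open>The reflection of \<open>S\<close> changes a right residual into a left one with the
  points -\<eta> i, so the right phases inherit the properties of the left ones.\<close>

lemma rres_reflect: "rres \<alpha> \<eta> m \<theta> \<tau> = lres \<alpha> (\<lambda>i. - \<eta> i) m (pi / ra - \<theta>) \<tau>"
proof -
  have "pi / ra - \<theta> - \<tau> = pi / ra - (\<theta> + \<tau>)" "pi / ra - \<theta> + \<tau> * - \<eta> i = pi / ra - (\<theta> + \<tau> * \<eta> i)" for i
    by auto
  then show ?thesis unfolding rres_def lres_def by (simp only: S_reflect)
qed

lemma lres_deriv_phase:
  "((\<lambda>\<theta>. lres \<alpha> \<eta> m \<theta> \<tau>) has_real_derivative C (\<theta> - \<tau>) - (\<Sum>i=1..m. \<alpha> i * C (\<theta> + \<tau> * \<eta> i))) (at \<theta>)"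
  unfolding lres_def
  by (rule derivative_eq_intros DERIV_chain'[OF _ S_deriv] refl | simp add: mult_ac)+

lemma lres_deriv_freq:
  "((\<lambda>\<tau>. lres \<alpha> \<eta> m \<theta> \<tau>) has_real_derivative - C (\<theta> - \<tau>) - (\<Sum>i=1..m. (\<alpha> i * \<eta> i) * C (\<theta> + \<tau> * \<eta> i))) (at \<tau>)"
  unfolding lres_def
  by (rule derivative_eq_intros DERIV_chain'[OF _ S_deriv] refl | simp add: mult_ac)+

lemma lres_cont: "continuous_on A (\<lambda>\<tau>. lres \<alpha> \<eta> m (g \<tau>) (h \<tau>))"
  if "continuous_on A g" "continuous_on A h"
  unfolding lres_def
  by (intro continuous_intros that continuous_on_compose2[OF S_cont[of UNIV]]) auto

text \<open>At these phases the value at -1 is an extremum of \<open>S\<close>, and nonzero; a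
  combination with weights of sum below 1 cannot reach it.\<close>

lemma lres_at_pk:
  assumes \<alpha>: "\<alpha> \<in> A_plus m"
  shows "sg j * lres \<alpha> \<eta> m (pk j + \<tau>) \<tau> < 0" "sg j * lres \<alpha> \<eta> m (pk (j + 1) + \<tau>) \<tau> > 0"
proof -
  have al0: "\<alpha> i \<ge> 0" if "i \<in> {1..m}" for i using \<alpha> that by (auto simp: A_plus_def)
  have al1: "(\<Sum>i=1..m. \<alpha> i) < 1" using \<alpha> by (auto simp: A_plus_def)
  have *: "sg j * lres \<alpha> \<eta> m (pk j + \<tau>) \<tau> < 0" for j
  proof -
    have "sg j * (\<Sum>i=1..m. \<alpha> i * S (pk j + \<tau> + \<tau> * \<eta> i)) = (\<Sum>i=1..m. \<alpha> i * (sg j * S (pk j + \<tau> + \<tau> * \<eta> i)))"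
      by (simp add: sum_distrib_left mult_ac)
    also have "\<dots> \<ge> (\<Sum>i=1..m. \<alpha> i * (sg j * S (pk j)))"
      by (intro sum_mono mult_left_mono S_extreme(2) al0)
    also have "(\<Sum>i=1..m. \<alpha> i * (sg j * S (pk j))) = (\<Sum>i=1..m. \<alpha> i) * (sg j * S (pk j))"
      by (simp add: sum_distrib_right)
    finally have "sg j * lres \<alpha> \<eta> m (pk j + \<tau>) \<tau> \<le> (sg j * S (pk j)) * (1 - (\<Sum>i=1..m. \<alpha> i))"
      by (simp add: lres_def algebra_simps)
    also have "\<dots> < 0" using S_extreme(1)[of j] al1 by (metis diff_gt_0_iff_gt mult_neg_pos)
    finally show ?thesis .
  qed
  show "sg j * lres \<alpha> \<eta> m (pk j + \<tau>) \<tau> < 0" by (rule *)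
  show "sg j * lres \<alpha> \<eta> m (pk (j + 1) + \<tau>) \<tau> > 0" using *[of "j + 1"] by (simp add: sg_Suc)
qed

text \<open>The index records the interval of monotonicity of \<open>S\<close> in which the phase at
  the end -1 lies.\<close>

definition left_phase :: "(nat \<Rightarrow> real) \<Rightarrow> (nat \<Rightarrow> real) \<Rightarrow> nat \<Rightarrow> int \<Rightarrow> real \<Rightarrow> real" where
  "left_phase \<alpha> \<eta> m j \<tau> = (SOME \<theta>. pk j < \<theta> - \<tau> \<and> \<theta> - \<tau> < pk (j + 1) \<and> lres \<alpha> \<eta> m \<theta> \<tau> = 0)"

lemma left_phase_props:
  assumes \<alpha>: "\<alpha> \<in> A_plus m"
  shows "pk j < left_phase \<alpha> \<eta> m j \<tau> - \<tau>" "left_phase \<alpha> \<eta> m j \<tau> - \<tau> < pk (j + 1)" "lres \<alpha> \<eta> m (left_phase \<alpha> \<eta> m j \<tau>) \<tau> = 0"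
proof -
  let ?h = "\<lambda>\<theta>. sg j * lres \<alpha> \<eta> m \<theta> \<tau>"
  have c: "continuous_on {pk j + \<tau>..pk (j + 1) + \<tau>} ?h"
    by (intro continuous_intros lres_cont)
  obtain \<theta> where \<theta>: "pk j + \<tau> \<le> \<theta>" "\<theta> \<le> pk (j + 1) + \<tau>" "?h \<theta> = 0"
    using IVT'[of ?h "pk j + \<tau>" 0 "pk (j + 1) + \<tau>"] c lres_at_pk[OF \<alpha>, of j \<eta> \<tau>] pk_less_Suc[of j]
    by (metis add_le_cancel_right less_eq_real_def)
  have "\<theta> \<noteq> pk j + \<tau>" "\<theta> \<noteq> pk (j + 1) + \<tau>"
    using lres_at_pk[OF \<alpha>, of j \<eta> \<tau>] \<theta>(3) by auto
  then have "pk j < \<theta> - \<tau> \<and> \<theta> - \<tau> < pk (j + 1) \<and> lres \<alpha> \<eta> m \<theta> \<tau> = 0"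
    using \<theta> by (auto simp: sg_def split: if_splits)
  then show "pk j < left_phase \<alpha> \<eta> m j \<tau> - \<tau>" "left_phase \<alpha> \<eta> m j \<tau> - \<tau> < pk (j + 1)" "lres \<alpha> \<eta> m (left_phase \<alpha> \<eta> m j \<tau>) \<tau> = 0"
    unfolding left_phase_def by (metis (mono_tags, lifting) someI_ex)+
qed

text \<open>At a zero of the residual the derivative in the phase is dominated by C(\<theta> -
  \<tau>), by \<open>subconvex_derivative_less\<close> with \<beta> = \<alpha>. All zeros in the
  interval are thus crossed in the same direction, so there is only one.\<close>

lemma left_phase_sign:
  assumes \<alpha>: "\<alpha> \<in> A_plus m" and \<theta>: "pk j \<le> \<theta> - \<tau>" "\<theta> - \<tau> \<le> pk (j + 1)"
  shows "\<theta> < left_phase \<alpha> \<eta> m j \<tau> \<Longrightarrow> sg j * lres \<alpha> \<eta> m \<theta> \<tau> < 0"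
    and "left_phase \<alpha> \<eta> m j \<tau> < \<theta> \<Longrightarrow> sg j * lres \<alpha> \<eta> m \<theta> \<tau> > 0"
proof -
  let ?h = "\<lambda>\<theta>. sg j * lres \<alpha> \<eta> m \<theta> \<tau>"
  let ?h' = "\<lambda>\<theta>. sg j * (C (\<theta> - \<tau>) - (\<Sum>i=1..m. \<alpha> i * C (\<theta> + \<tau> * \<eta> i)))"
  have d: "(?h has_real_derivative ?h' \<theta>) (at \<theta>)" for \<theta>
    by (intro DERIV_cmult lres_deriv_phase)
  have p: "?h' \<theta> > 0" if "pk j + \<tau> < \<theta>" "\<theta> < pk (j + 1) + \<tau>" "?h \<theta> = 0" for \<theta>
  proof -
    have "S (\<theta> - \<tau>) = (\<Sum>i=1..m. \<alpha> i * S (\<theta> + \<tau> * \<eta> i))"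
      using that(3) by (auto simp: sg_def lres_def split: if_splits)
    then have "\<bar>\<Sum>i=1..m. \<alpha> i * C (\<theta> + \<tau> * \<eta> i)\<bar> < \<bar>C (\<theta> - \<tau>)\<bar>"
      using \<alpha> by (intro subconvex_derivative_less) (auto simp: A_plus_def)
    moreover have "sg j * C (\<theta> - \<tau>) > 0" using that by (intro C_sign) auto
    ultimately show ?thesis by (auto simp: sg_def abs_if split: if_splits)
  qed
  note z = left_phase_props[OF \<alpha>, where j = j and \<eta> = \<eta> and \<tau> = \<tau>]
  show "?h \<theta> < 0" if lt: "\<theta> < left_phase \<alpha> \<eta> m j \<tau>"
  proof (cases "pk j + \<tau> = \<theta>")
    case True
    then show ?thesis using lres_at_pk(1)[OF \<alpha>] by blast
  next
    case False
    then show ?thesis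
      using \<theta> z lt by (intro neg_left_of_zero[of "pk j + \<tau>" "pk (j + 1) + \<tau>" ?h ?h' "left_phase \<alpha> \<eta> m j \<tau>"] d p) auto
  qed
  show "?h \<theta> > 0" if lt: "left_phase \<alpha> \<eta> m j \<tau> < \<theta>"
  proof (cases "pk (j + 1) + \<tau> = \<theta>")
    case True
    then show ?thesis using lres_at_pk(2)[OF \<alpha>] by blast
  next
    case False
    then show ?thesis
      using \<theta> z lt by (intro pos_right_of_zero[of "pk j + \<tau>" "pk (j + 1) + \<tau>" ?h ?h' "left_phase \<alpha> \<eta> m j \<tau>"] d p) auto
  qed
qed

lemma left_phase_unique:
  assumes "\<alpha> \<in> A_plus m" "pk j \<le> \<theta> - \<tau>" "\<theta> - \<tau> \<le> pk (j + 1)" "lres \<alpha> \<eta> m \<theta> \<tau> = 0"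
  shows "\<theta> = left_phase \<alpha> \<eta> m j \<tau>"
  using left_phase_sign[OF assms(1-3), of \<eta>] assms(4) by (cases \<theta> "left_phase \<alpha> \<eta> m j \<tau>" rule: linorder_cases) auto

text \<open>The old phase is kept while \<tau> grows. The derivative in \<tau> is dominated by the
  same term, now with \<beta> i = \<alpha> i \<eta> i, but with the opposite sign; so the residual
  at the old phase acquires the sign that it has to the left of the new phase.\<close>

lemma left_phase_strict_mono:
  assumes \<alpha>: "\<alpha> \<in> A_plus m" and \<eta>: "\<And>i. i \<in> {1..m} \<Longrightarrow> \<bar>\<eta> i\<bar> \<le> 1" and lt: "\<tau>1 < \<tau>2"
  shows "left_phase \<alpha> \<eta> m j \<tau>1 < left_phase \<alpha> \<eta> m j \<tau>2"
proof -
  define \<theta> where "\<theta> = left_phase \<alpha> \<eta> m j \<tau>1"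
  note z1 = left_phase_props[OF \<alpha>, where j = j and \<eta> = \<eta> and \<tau> = \<tau>1, folded \<theta>_def] and z2 = left_phase_props[OF \<alpha>, where j = j and \<eta> = \<eta> and \<tau> = \<tau>2]
  show ?thesis
  \<comment> \<open>In the first case the fixed phase has left the interval of monotonicity on its
    lower side and the claim is immediate; otherwise all frequencies up to \<tau>2 stay in the range
    of \<open>C_sign\<close>.\<close>
  proof (cases "\<theta> - \<tau>2 \<le> pk j")
    case True
    then show ?thesis using z2(1) unfolding \<theta>_def by linarith
  next
    case False
    let ?h = "\<lambda>\<tau>. - sg j * lres \<alpha> \<eta> m \<theta> \<tau>"
    let ?h' = "\<lambda>\<tau>. - sg j * (- C (\<theta> - \<tau>) - (\<Sum>i=1..m. (\<alpha> i * \<eta> i) * C (\<theta> + \<tau> * \<eta> i)))"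
    have "?h \<tau>2 > 0"
    proof (rule pos_right_of_zero[of "\<theta> - pk (j + 1)" "\<theta> - pk j" ?h ?h' \<tau>1])
      show "(?h has_real_derivative ?h' \<tau>) (at \<tau>)" for \<tau>
        by (intro DERIV_cmult lres_deriv_freq)
      show "?h' \<tau> > 0" if "\<theta> - pk (j + 1) < \<tau>" "\<tau> < \<theta> - pk j" "?h \<tau> = 0" for \<tau>
      proof -
        have "S (\<theta> - \<tau>) = (\<Sum>i=1..m. \<alpha> i * S (\<theta> + \<tau> * \<eta> i))"
          using that(3) by (auto simp: sg_def lres_def split: if_splits)
        moreover have "\<bar>\<alpha> i * \<eta> i\<bar> \<le> \<alpha> i" if "i \<in> {1..m}" for i
          using mult_left_mono[OF \<eta>[OF that], of "\<alpha> i"] \<alpha> that by (auto simp: A_plus_def abs_mult)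
        ultimately have "\<bar>\<Sum>i=1..m. (\<alpha> i * \<eta> i) * C (\<theta> + \<tau> * \<eta> i)\<bar> < \<bar>C (\<theta> - \<tau>)\<bar>"
          by (intro subconvex_derivative_less[OF \<alpha>])
        moreover have "sg j * C (\<theta> - \<tau>) > 0" using that by (intro C_sign) auto
        ultimately show ?thesis by (auto simp: sg_def abs_if split: if_splits)
      qed
    qed (use z1 lt False in auto)
    then have n: "sg j * lres \<alpha> \<eta> m \<theta> \<tau>2 < 0" by simp
    have "pk j \<le> \<theta> - \<tau>2" "\<theta> - \<tau>2 \<le> pk (j + 1)" using False z1 lt by auto
    note s = left_phase_sign[OF \<alpha> this, of \<eta>]
    have "\<theta> \<noteq> left_phase \<alpha> \<eta> m j \<tau>2" using z2(3) n by auto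
    then show ?thesis using s n unfolding \<theta>_def[symmetric] by (metis linorder_neqE_linordered_idom order_less_asym)
  qed
qed

text \<open>The signs of the residual at two test phases on either side of the zero persist for
  nearby \<tau> and trap the zero between them.\<close>

lemma left_phase_cont:
  assumes \<alpha>: "\<alpha> \<in> A_plus m"
  shows "continuous_on UNIV (left_phase \<alpha> \<eta> m j)"
proof (intro continuous_at_imp_continuous_on ballI)
  fix \<tau>0 :: real
  note z = left_phase_props[OF \<alpha>, where j = j and \<eta> = \<eta> and \<tau> = \<tau>0]
  have ev: "\<forall>\<^sub>F \<tau> in at \<tau>0. (pk j < \<theta> - \<tau> \<and> \<theta> - \<tau> < pk (j + 1)) \<and> s * lres \<alpha> \<eta> m \<theta> \<tau> < 0"
    if "pk j < \<theta> - \<tau>0" "\<theta> - \<tau>0 < pk (j + 1)" "s * lres \<alpha> \<eta> m \<theta> \<tau>0 < 0" for \<theta> s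
  proof (intro eventually_conj)
    show "\<forall>\<^sub>F \<tau> in at \<tau>0. pk j < \<theta> - \<tau>"
      using that by (intro order_tendstoD(1)[of _ "\<theta> - \<tau>0"] tendsto_intros) auto
    show "\<forall>\<^sub>F \<tau> in at \<tau>0. \<theta> - \<tau> < pk (j + 1)"
      using that by (intro order_tendstoD(2)[of _ "\<theta> - \<tau>0"] tendsto_intros) auto
    have "isCont (\<lambda>\<tau>. s * lres \<alpha> \<eta> m \<theta> \<tau>) \<tau>0"
      by (intro continuous_intros DERIV_isCont[OF lres_deriv_freq])
    then show "\<forall>\<^sub>F \<tau> in at \<tau>0. s * lres \<alpha> \<eta> m \<theta> \<tau> < 0"
      using that(3) unfolding isCont_def by (rule order_tendstoD(2))
  qed
  have "((left_phase \<alpha> \<eta> m j) \<longlongrightarrow> left_phase \<alpha> \<eta> m j \<tau>0) (at \<tau>0)"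
  proof (rule order_tendstoI)
    fix l assume l: "l < left_phase \<alpha> \<eta> m j \<tau>0"
    \<comment> \<open>The midpoint keeps the test phase inside the interval of monotonicity even if
      l lies outside.\<close>
    define \<theta> where "\<theta> = max l ((pk j + \<tau>0 + left_phase \<alpha> \<eta> m j \<tau>0) / 2)"
    have \<theta>: "pk j < \<theta> - \<tau>0" "\<theta> - \<tau>0 < pk (j + 1)" "\<theta> < left_phase \<alpha> \<eta> m j \<tau>0" "l \<le> \<theta>"
      using z l by (auto simp: \<theta>_def field_simps less_max_iff_disj)
    have "sg j * lres \<alpha> \<eta> m \<theta> \<tau>0 < 0" using \<theta> by (intro left_phase_sign(1)[OF \<alpha>]) auto
    from ev[OF \<theta>(1,2) this] show "\<forall>\<^sub>F \<tau> in at \<tau>0. l < left_phase \<alpha> \<eta> m j \<tau>"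
    proof eventually_elim
      case (elim \<tau>)
      then have "\<theta> \<noteq> left_phase \<alpha> \<eta> m j \<tau>" "\<not> left_phase \<alpha> \<eta> m j \<tau> < \<theta>"
        using left_phase_props(3)[OF \<alpha>, where j = j and \<eta> = \<eta> and \<tau> = \<tau>] left_phase_sign(2)[OF \<alpha>, of j \<theta> \<tau> \<eta>] by auto
      then show ?case using \<theta>(4) by linarith
    qed
  next
    fix l assume l: "left_phase \<alpha> \<eta> m j \<tau>0 < l"
    define \<theta> where "\<theta> = min l ((pk (j + 1) + \<tau>0 + left_phase \<alpha> \<eta> m j \<tau>0) / 2)"
    have \<theta>: "pk j < \<theta> - \<tau>0" "\<theta> - \<tau>0 < pk (j + 1)" "left_phase \<alpha> \<eta> m j \<tau>0 < \<theta>" "\<theta> \<le> l"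
      using z l by (auto simp: \<theta>_def field_simps min_less_iff_disj)
    have "- sg j * lres \<alpha> \<eta> m \<theta> \<tau>0 < 0" using \<theta> left_phase_sign(2)[OF \<alpha>, of j \<theta> \<tau>0 \<eta>] by auto
    from ev[OF \<theta>(1,2) this] show "\<forall>\<^sub>F \<tau> in at \<tau>0. left_phase \<alpha> \<eta> m j \<tau> < l"
    proof eventually_elim
      case (elim \<tau>)
      then have "\<theta> \<noteq> left_phase \<alpha> \<eta> m j \<tau>" "\<not> \<theta> < left_phase \<alpha> \<eta> m j \<tau>"
        using left_phase_props(3)[OF \<alpha>, where j = j and \<eta> = \<eta> and \<tau> = \<tau>] left_phase_sign(1)[OF \<alpha>, of j \<theta> \<tau> \<eta>] by auto
      then show ?case using \<theta>(4) by linarith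
    qed
  qed
  then show "isCont (left_phase \<alpha> \<eta> m j) \<tau>0" by (simp add: isCont_def)
qed

section \<open>Periodicity of phases and the right boundary condition\<close>

lemma lres_periodic: "lres \<alpha> \<eta> m (\<theta> + per) \<tau> = lres \<alpha> \<eta> m \<theta> \<tau>"
proof -
  have "\<theta> + per - \<tau> = (\<theta> - \<tau>) + per" "\<theta> + per + \<tau> * \<eta> i = (\<theta> + \<tau> * \<eta> i) + per" for i by auto
  then show ?thesis unfolding lres_def by (simp only: S_periodic)
qed

lemma left_phase_period:
  assumes \<alpha>: "\<alpha> \<in> A_plus m"
  shows "left_phase \<alpha> \<eta> m (j + 2) \<tau> = left_phase \<alpha> \<eta> m j \<tau> + per"
proof -
  note z = left_phase_props[OF \<alpha>, where j = j and \<eta> = \<eta> and \<tau> = \<tau>]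
  have "lres \<alpha> \<eta> m (left_phase \<alpha> \<eta> m j \<tau> + per) \<tau> = 0" using z(3) by (simp only: lres_periodic)
  moreover have "pk (j + 2) \<le> left_phase \<alpha> \<eta> m j \<tau> + per - \<tau>" "left_phase \<alpha> \<eta> m j \<tau> + per - \<tau> \<le> pk (j + 2 + 1)"
    using z(1,2) pk_period[of j] pk_period[of "j + 1"] by (auto simp: add_ac)
  ultimately have "left_phase \<alpha> \<eta> m j \<tau> + per = left_phase \<alpha> \<eta> m (j + 2) \<tau>"
    by (intro left_phase_unique[OF \<alpha>])
  then show ?thesis by simp
qed

text \<open>Under \<theta> to pi/ra - \<theta> the point \<open>pk j\<close> goes to
  \<open>pk (2 - j)\<close>, so the interval with index j goes to the one with index 1 - j.\<close>

definition right_phase :: "(nat \<Rightarrow> real) \<Rightarrow> (nat \<Rightarrow> real) \<Rightarrow> nat \<Rightarrow> int \<Rightarrow> real \<Rightarrow> real" where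
  "right_phase \<alpha> \<eta> m j \<tau> = pi / ra - left_phase \<alpha> (\<lambda>i. - \<eta> i) m (1 - j) \<tau>"

lemma right_phase_props:
  assumes \<alpha>: "\<alpha> \<in> A_plus m"
  shows "pk j < right_phase \<alpha> \<eta> m j \<tau> + \<tau>" "right_phase \<alpha> \<eta> m j \<tau> + \<tau> < pk (j + 1)" "rres \<alpha> \<eta> m (right_phase \<alpha> \<eta> m j \<tau>) \<tau> = 0"
  using left_phase_props[OF \<alpha>, where j = "1 - j" and \<eta> = "\<lambda>i. - \<eta> i" and \<tau> = \<tau>] pk_reflect[of j] pk_reflect[of "j + 1"]
  by (auto simp: right_phase_def rres_reflect)

lemma right_phase_sign:
  assumes \<alpha>: "\<alpha> \<in> A_plus m" and \<theta>: "pk j \<le> \<theta> + \<tau>" "\<theta> + \<tau> \<le> pk (j + 1)"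
  shows "\<theta> < right_phase \<alpha> \<eta> m j \<tau> \<Longrightarrow> sg j * rres \<alpha> \<eta> m \<theta> \<tau> < 0"
    and "right_phase \<alpha> \<eta> m j \<tau> < \<theta> \<Longrightarrow> sg j * rres \<alpha> \<eta> m \<theta> \<tau> > 0"
proof -
  have "pk (1 - j) \<le> (pi / ra - \<theta>) - \<tau>" "(pi / ra - \<theta>) - \<tau> \<le> pk (1 - j + 1)"
    using \<theta> pk_reflect[of j] pk_reflect[of "j + 1"] by auto
  note s = left_phase_sign[OF \<alpha> this, of "\<lambda>i. - \<eta> i", folded rres_reflect]
  have "sg (1 - j) = - sg j" by (simp add: sg_def)
  then show "\<theta> < right_phase \<alpha> \<eta> m j \<tau> \<Longrightarrow> sg j * rres \<alpha> \<eta> m \<theta> \<tau> < 0"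
    and "right_phase \<alpha> \<eta> m j \<tau> < \<theta> \<Longrightarrow> sg j * rres \<alpha> \<eta> m \<theta> \<tau> > 0"
    using s by (auto simp: right_phase_def)
qed

lemma right_phase_unique:
  assumes "\<alpha> \<in> A_plus m" "pk j \<le> \<theta> + \<tau>" "\<theta> + \<tau> \<le> pk (j + 1)" "rres \<alpha> \<eta> m \<theta> \<tau> = 0"
  shows "\<theta> = right_phase \<alpha> \<eta> m j \<tau>"
  using right_phase_sign[OF assms(1-3), of \<eta>] assms(4) by (cases \<theta> "right_phase \<alpha> \<eta> m j \<tau>" rule: linorder_cases) auto

lemma right_phase_period:
  assumes \<alpha>: "\<alpha> \<in> A_plus m"
  shows "right_phase \<alpha> \<eta> m (j + 2) \<tau> = right_phase \<alpha> \<eta> m j \<tau> + per"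
  using left_phase_period[OF \<alpha>, of "\<lambda>i. - \<eta> i" "- 1 - j" \<tau>] by (simp add: right_phase_def add.commute)

text \<open>Two successive right phases lie in adjacent intervals of monotonicity. Up to the common
  end the sign comes from the first zero, beyond it from the second.\<close>

lemma rres_sign_between:
  assumes \<alpha>: "\<alpha> \<in> A_plus m" and \<theta>: "right_phase \<alpha> \<eta> m j \<tau> < \<theta>" "\<theta> < right_phase \<alpha> \<eta> m (j + 1) \<tau>"
  shows "sg j * rres \<alpha> \<eta> m \<theta> \<tau> > 0"
proof (cases "\<theta> + \<tau> \<le> pk (j + 1)")
  case True
  then show ?thesis using right_phase_props(1)[OF \<alpha>, where j = j and \<eta> = \<eta> and \<tau> = \<tau>] \<theta> by (intro right_phase_sign(2)[OF \<alpha>]) auto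
next
  case False
  then have "sg (j + 1) * rres \<alpha> \<eta> m \<theta> \<tau> < 0"
    using right_phase_props(2)[OF \<alpha>, where j = "j + 1" and \<eta> = \<eta> and \<tau> = \<tau>] \<theta> by (intro right_phase_sign(1)[OF \<alpha>]) auto
  then show ?thesis by (simp add: sg_Suc)
qed

end

subsection \<open>Half-eigenvalues\<close>

lemma D_eq:
  assumes "(u has_real_derivative d) (at x within {-1..1})" "x \<in> {-1..1}"
  shows "D u x = d"
  using vector_derivative_within_cbox[of "-1" "1::real" x u d] assms
  by (simp add: D_def has_real_derivative_iff_has_vector_derivative)

lemma has_real_derivative_within_transform:
  assumes "x \<in> A" "\<And>y. y \<in> A \<Longrightarrow> g y = f y" "(f has_real_derivative d) (at x within A)"
  shows "(g has_real_derivative d) (at x within A)"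
  using has_vector_derivative_transform[of x A g f d] assms
  by (simp add: has_real_derivative_iff_has_vector_derivative)

lemma C2I:
  assumes u: "\<And>x. x \<in> {-1..1} \<Longrightarrow> (u has_real_derivative v x) (at x within {-1..1})"
    and v: "\<And>x. x \<in> {-1..1} \<Longrightarrow> (v has_real_derivative w x) (at x within {-1..1})"
    and w: "continuous_on {-1..1} w"
  shows "u \<in> C2" "x \<in> {-1..1} \<Longrightarrow> D u x = v x" "x \<in> {-1..1} \<Longrightarrow> D (D u) x = w x"
proof -
  have Du: "D u x = v x" if "x \<in> {-1..1}" for x using D_eq[OF u[OF that] that] .
  have Dv: "(D u has_real_derivative w x) (at x within {-1..1})" if "x \<in> {-1..1}" for x
    by (rule has_real_derivative_within_transform[OF that Du v[OF that]])
  have DDu: "D (D u) x = w x" if "x \<in> {-1..1}" for x using D_eq[OF Dv[OF that] that] .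
  have "continuous_on {-1..1} (D (D u))" using w by (rule continuous_on_eq) (simp add: DDu)
  then show "u \<in> C2"
    unfolding C2_def differentiable_on_def real_differentiable_def using u Dv by blast
  show "x \<in> {-1..1} \<Longrightarrow> D u x = v x" "x \<in> {-1..1} \<Longrightarrow> D (D u) x = w x" using Du DDu by auto
qed

lemma C2D:
  assumes "u \<in> C2" "x \<in> {-1..1}"
  shows "(u has_real_derivative D u x) (at x within {-1..1})"
    "(D u has_real_derivative D (D u) x) (at x within {-1..1})"
proof -
  have *: "(f has_real_derivative D f x) (at x within {-1..1})"
    if "f differentiable (at x within {-1..1})" for f
    using that vector_derivative_works[of f "at x within {-1..1}"]
    by (simp add: D_def has_real_derivative_iff_has_vector_derivative)
  show "(u has_real_derivative D u x) (at x within {-1..1})"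
    "(D u has_real_derivative D (D u) x) (at x within {-1..1})"
    using assms by (auto simp: C2_def differentiable_on_def intro!: *)
qed

lemma taylor_int2:
  assumes u: "\<And>x. x \<in> {-1..1} \<Longrightarrow> (u has_real_derivative v x) (at x within {-1..1})"
    and v: "\<And>x. x \<in> {-1..1} \<Longrightarrow> (v has_real_derivative w x) (at x within {-1..1})"
    and w: "continuous_on {-1..1} w" and x: "x \<in> {-1..1}"
  shows "u x = u (-1) + v (-1) * (x + 1) + int2 w x"
proof -
  have vI: "v x = v (-1) + integral {-1..x} w" if x: "x \<in> {-1..1}" for x
  proof -
    have "(w has_integral (v x - v (-1))) {-1..x}"
    proof (rule fundamental_theorem_of_calculus)
      fix t assume "t \<in> {-1..x}"
      then show "(v has_vector_derivative w t) (at t within {-1..x})"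
        using DERIV_subset[OF v, of t "{-1..x}"] x
        by (auto simp: has_real_derivative_iff_has_vector_derivative)
    qed (use x in auto)
    then show ?thesis by (simp add: integral_unique)
  qed
  define y where "y x = u x - v (-1) * (x + 1) - int2 w x" for x
  have "(y has_real_derivative 0) (at x within {-1..1})" if x: "x \<in> {-1..1}" for x
    unfolding y_def using u[OF x] int2_has_derivative[OF L1_continuous[OF w] x] vI[OF x]
    by (auto intro!: derivative_eq_intros)
  then obtain c where "\<And>x. x \<in> {-1..1} \<Longrightarrow> y x = c"
    using has_field_derivative_zero_constant[of "{-1..1::real}" y] by auto
  then have "y x = y (-1)" using x by simp
  then show ?thesis by (simp add: y_def int2_def)
qed

lemma int_sol_classical:
  assumes u: "\<And>x. x \<in> {-1..1} \<Longrightarrow> (u has_real_derivative v x) (at x within {-1..1})"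
    and v: "\<And>x. x \<in> {-1..1} \<Longrightarrow> (v has_real_derivative - \<phi> (u x)) (at x within {-1..1})"
    and \<phi>: "continuous_on UNIV \<phi>"
  shows "int_sol \<phi> (\<lambda>_. 0) (u (-1)) (v (-1)) u"
proof -
  have uc: "continuous_on {-1..1} u"
    using u by (meson DERIV_continuous continuous_on_eq_continuous_within)
  have wc: "continuous_on {-1..1} (\<lambda>x. - \<phi> (u x))"
    by (intro continuous_on_minus continuous_on_compose2[OF \<phi> uc]) simp
  have neg: "int2 (\<lambda>x. - \<phi> (u x)) x = - int2 (\<lambda>x. \<phi> (u x)) x" for x by (simp add: int2_def)
  have "u x = u (-1) + v (-1) * (x + 1) + 0 - int2 (\<lambda>x. \<phi> (u x)) x" if "x \<in> {-1..1}" for x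
    using taylor_int2[OF u v wc that] by (simp add: neg)
  then show ?thesis using uc unfolding int_sol_def by blast
qed

lemma hl_lipschitz:
  assumes "a > 0" "b > 0"
  shows "\<bar>hl a b s - hl a b t\<bar> \<le> (a + b) * \<bar>s - t\<bar>"
proof -
  have m: "\<bar>max x 0 - max y 0\<bar> \<le> \<bar>x - y\<bar>" for x y :: real by (auto simp: max_def)
  have "\<bar>hl a b s - hl a b t\<bar> = \<bar>a * (max s 0 - max t 0) - b * (max (- s) 0 - max (- t) 0)\<bar>"
    unfolding hl_def right_diff_distrib by (rule arg_cong[where f = abs]) simp
  also have "\<dots> \<le> \<bar>a * (max s 0 - max t 0)\<bar> + \<bar>b * (max (- s) 0 - max (- t) 0)\<bar>" by (rule abs_triangle_ineq4)
  also have "\<dots> \<le> a * \<bar>s - t\<bar> + b * \<bar>s - t\<bar>"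
    using m[of s t] m[of "- s" "- t"] assms by (intro add_mono) (auto simp: abs_mult abs_minus_commute)
  finally show ?thesis by (simp add: algebra_simps)
qed

lemma hl_cont: "continuous_on A (hl a b)"
  unfolding hl_def by (intro continuous_intros)

lemma hl_scale: "r \<ge> 0 \<Longrightarrow> hl a b (r * s) = r * hl a b s"
  using max_mult_distrib_left[of r s 0] max_mult_distrib_left[of r "- s" 0]
  by (simp add: hl_def right_diff_distrib mult.left_commute)

lemma int_sol_unique:
  assumes u: "int_sol \<phi> H c d u" and U: "int_sol \<phi> H c d U"
    and L: "\<And>s t. \<bar>\<phi> s - \<phi> t\<bar> \<le> L * \<bar>s - t\<bar>" and H: "continuous_on {-1..1} H" and x: "x \<in> {-1..1}"
  shows "u x = U x"
proof -
  have \<phi>c: "continuous_on UNIV \<phi>" by (rule continuous_on_lipschitz_bound[OF L])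
  obtain N where "\<And>x. x \<in> {-1..1} \<Longrightarrow> \<bar>U x\<bar> \<le> N"
    using compact_imp_bounded[OF compact_continuous_image[OF int_solD(1)[OF U] compact_Icc]]
    unfolding bounded_iff by (metis imageI real_norm_def)
  then show ?thesis
    using int_sol_estimate[OF u U \<phi>c \<phi>c H H L, of 0 0 N 0 x] x by simp
qed

lemma all_sign: "(\<forall>\<sigma>. P \<sigma>) \<longleftrightarrow> P Minus \<and> P Plus"
  using sign.induct[of P] by blast

context half_linear
begin

lemma gauge_scale: "r \<ge> 0 \<Longrightarrow> gauge_hl (r * s) = r * gauge_hl s"
  by (simp add: gauge_hl_def max_mult_distrib_left mult_ac)

lemma C_sign_closed:
  assumes "pk j \<le> x" "x \<le> pk (j + 1)"
  shows "sg j * C x \<ge> 0"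
  using C_sign[of j x] C_pk[of j] C_pk[of "j + 1"] assms by (cases "x = pk j \<or> x = pk (j + 1)") auto

text \<open>Polar coordinates whose unit circle is the energy curve (S, C): the radius is sqrt(d^2 +
  gauge_hl(c)^2), and the angle comes from the intermediate value theorem on the arc that the sign
  of d selects.\<close>

lemma polar:
  assumes "c \<noteq> 0 \<or> d \<noteq> 0"
  obtains r y where "r > 0" "c = r * S y" "d = r * C y"
    "d \<ge> 0 \<and> pk 0 \<le> y \<and> y \<le> pk 1 \<or> d < 0 \<and> pk 1 \<le> y \<and> y \<le> pk 2"
proof -
  define r where "r = sqrt (d\<^sup>2 + (gauge_hl c)\<^sup>2)"
  have gge: "gauge_hl t \<ge> ra * t" "gauge_hl t \<ge> - rb * t" for t by (auto simp: gauge_hl_def)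
  have "gauge_hl c > 0" if "c \<noteq> 0"
  proof (cases "c > 0")
    case True
    then show ?thesis using gge(1)[of c] mult_pos_pos[OF ra_pos True] by linarith
  next
    case False
    then have "rb * (- c) > 0" using that rb_pos by (intro mult_pos_pos) auto
    then show ?thesis using gge(2)[of c] by simp
  qed
  then have "d\<^sup>2 + (gauge_hl c)\<^sup>2 > 0"
    using assms by (cases "d = 0") (auto intro: add_pos_nonneg)
  then have r: "r > 0" "r\<^sup>2 = d\<^sup>2 + (gauge_hl c)\<^sup>2" by (auto simp: r_def)
  define s where "s = c / r"
  have gs: "gauge_hl c = r * gauge_hl s" using gauge_scale[of r s] r by (simp add: s_def)
  have "d\<^sup>2 = r\<^sup>2 * (1 - (gauge_hl s)\<^sup>2)"
    using r(2) unfolding gs by (simp add: power_mult_distrib right_diff_distrib)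
  then have e: "(d / r)\<^sup>2 = 1 - (gauge_hl s)\<^sup>2" using r(1) by (simp add: power_divide)
  then have "(gauge_hl s)\<^sup>2 \<le> 1" using zero_le_power2[of "d / r"] by linarith
  then have "gauge_hl s \<le> 1" using power2_le_imp_le[of "gauge_hl s" 1] by simp
  then have "ra * s \<le> 1" "- rb * s \<le> 1" using gge[of s] by linarith+
  then have "s * ra \<le> 1" "- 1 \<le> s * rb" by (simp_all add: mult.commute)
  then have s: "- 1 / rb \<le> s" "s \<le> 1 / ra"
    using pos_le_divide_eq[OF ra_pos, of s 1] pos_divide_le_eq[OF rb_pos, of "- 1" s] by blast+
  have sq: "(C y)\<^sup>2 = (d / r)\<^sup>2" if "S y = s" for y 
  proof -
    have "(C y)\<^sup>2 = 1 - (gauge_hl (S y))\<^sup>2" using energy[of y] by linarith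
    then show ?thesis using e that by (simp only:)
  qed
  show ?thesis
  proof (cases "d \<ge> 0")
    case True
    have "\<exists>y. pk 0 \<le> y \<and> y \<le> pk 1 \<and> S y = s"
      by (rule IVT') (use s S_cont pk_less_Suc[of 0] in \<open>simp_all add: S_pk\<close>)
    then obtain y where y: "pk 0 \<le> y" "y \<le> pk 1" "S y = s" by blast
    have "C y \<ge> 0" using C_sign_closed[of 0 y] y by (simp add: sg_def)
    moreover have "d / r \<ge> 0" using True r(1) by simp
    moreover have "C y = d / r \<or> C y = - (d / r)" using sq[OF y(3)] unfolding power2_eq_iff .
    ultimately have "C y = d / r" by linarith
    then have dc: "c = r * S y" "d = r * C y" using r(1) y(3) by (simp_all add: s_def)
    have "d \<ge> 0 \<and> pk 0 \<le> y \<and> y \<le> pk 1 \<or> d < 0 \<and> pk 1 \<le> y \<and> y \<le> pk 2"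
      using y(1,2) True by simp
    then show ?thesis by (rule that[OF r(1) dc])
  next
    case False
    have "\<exists>y. pk 1 \<le> y \<and> y \<le> pk 2 \<and> S y = s"
      by (rule IVT2') (use s S_cont pk_less_Suc[of 1] in \<open>simp_all add: S_pk\<close>)
    then obtain y where y: "pk 1 \<le> y" "y \<le> pk 2" "S y = s" by blast
    have "C y \<le> 0" using C_sign_closed[of 1 y] y by (simp add: sg_def)
    moreover have "d / r \<le> 0" using False r(1) by (simp add: divide_le_0_iff)
    moreover have "C y = d / r \<or> C y = - (d / r)" using sq[OF y(3)] unfolding power2_eq_iff .
    ultimately have "C y = d / r" by linarith
    then have dc: "c = r * S y" "d = r * C y" using r(1) y(3) by (simp_all add: s_def)
    have "d \<ge> 0 \<and> pk 0 \<le> y \<and> y \<le> pk 1 \<or> d < 0 \<and> pk 1 \<le> y \<and> y \<le> pk 2"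
      using y(1,2) False by simp
    then show ?thesis by (rule that[OF r(1) dc])
  qed
qed

lemma wave_deriv:
  "((\<lambda>x. r * S (\<tau> * x + \<theta>)) has_real_derivative r * \<tau> * C (\<tau> * x + \<theta>)) (at x within A)"
  "((\<lambda>x. r * \<tau> * C (\<tau> * x + \<theta>)) has_real_derivative - (r * \<tau>\<^sup>2 * hl a b (S (\<tau> * x + \<theta>)))) (at x within A)"
proof -
  have "((\<lambda>x. S (\<tau> * x + \<theta>)) has_real_derivative C (\<tau> * x + \<theta>) * \<tau>) (at x)"
    by (rule DERIV_chain'[where f = "\<lambda>x. \<tau> * x + \<theta>", OF _ S_deriv]) (auto intro!: derivative_eq_intros)
  then have "((\<lambda>x. r * S (\<tau> * x + \<theta>)) has_real_derivative r * (C (\<tau> * x + \<theta>) * \<tau>)) (at x)"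
    by (rule DERIV_cmult)
  then show "((\<lambda>x. r * S (\<tau> * x + \<theta>)) has_real_derivative r * \<tau> * C (\<tau> * x + \<theta>)) (at x within A)"
    by - (rule has_field_derivative_at_within, simp add: mult_ac)
  have "((\<lambda>x. C (\<tau> * x + \<theta>)) has_real_derivative - hl a b (S (\<tau> * x + \<theta>)) * \<tau>) (at x)"
    by (rule DERIV_chain'[where f = "\<lambda>x. \<tau> * x + \<theta>", OF _ C_deriv]) (auto intro!: derivative_eq_intros)
  then have "((\<lambda>x. (r * \<tau>) * C (\<tau> * x + \<theta>)) has_real_derivative (r * \<tau>) * (- hl a b (S (\<tau> * x + \<theta>)) * \<tau>)) (at x)"
    by (rule DERIV_cmult)
  then show "((\<lambda>x. r * \<tau> * C (\<tau> * x + \<theta>)) has_real_derivative - (r * \<tau>\<^sup>2 * hl a b (S (\<tau> * x + \<theta>)))) (at x within A)"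
    by - (rule has_field_derivative_at_within, simp add: power2_eq_square mult_ac)
qed

lemma wave_BC:
  assumes u: "\<And>x. x \<in> {-1..1} \<Longrightarrow> u x = r * S (\<tau> * x + \<theta>)" and r: "r \<noteq> 0"
    and \<eta>: "\<And>\<sigma> i. i \<in> {1..m \<sigma>} \<Longrightarrow> \<eta> \<sigma> i \<in> {-1<..<1}"
  shows "BC m \<alpha> \<eta> u \<longleftrightarrow> lres (\<alpha> Minus) (\<eta> Minus) (m Minus) \<theta> \<tau> = 0 \<and> rres (\<alpha> Plus) (\<eta> Plus) (m Plus) \<theta> \<tau> = 0"
proof -
  have s: "(\<Sum>i=1..m \<sigma>. \<alpha> \<sigma> i * u (\<eta> \<sigma> i)) = r * (\<Sum>i=1..m \<sigma>. \<alpha> \<sigma> i * S (\<theta> + \<tau> * \<eta> \<sigma> i))" for \<sigma>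
    unfolding sum_distrib_left
  proof (rule sum.cong)
    fix i assume "i \<in> {1..m \<sigma>}"
    then have "\<eta> \<sigma> i \<in> {-1..1}" using \<eta>[of i \<sigma>] by auto
    then show "\<alpha> \<sigma> i * u (\<eta> \<sigma> i) = r * (\<alpha> \<sigma> i * S (\<theta> + \<tau> * \<eta> \<sigma> i))"
      using u[of "\<eta> \<sigma> i"] by (simp add: add.commute mult_ac)
  qed simp
  have "BC m \<alpha> \<eta> u \<longleftrightarrow> (u (sval Minus) = (\<Sum>i=1..m Minus. \<alpha> Minus i * u (\<eta> Minus i)))
     \<and> (u (sval Plus) = (\<Sum>i=1..m Plus. \<alpha> Plus i * u (\<eta> Plus i)))"
    unfolding BC_def by (rule all_sign)
  moreover have "u (sval Minus) = r * S (\<theta> - \<tau>)" "u (sval Plus) = r * S (\<theta> + \<tau>)"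
    using u[of "-1"] u[of 1] by (simp_all add: add.commute)
  ultimately show ?thesis
    unfolding s lres_def rres_def using r by simp
qed

text \<open>The critical points are the peaks of \<open>S\<close> passed between the phases at -1
  and 1, so they are counted by the indices j and J of the intervals in which these two phases
  lie.\<close>

lemma crit_wave:
  assumes Du: "\<And>x. x \<in> {-1..1} \<Longrightarrow> D u x = \<rho> * C (\<tau> * x + \<theta>)" and \<rho>: "\<rho> \<noteq> 0" and \<tau>: "\<tau> > 0"
    and l: "pk j \<le> \<theta> - \<tau>" "\<theta> - \<tau> < pk (j + 1)" and r: "pk J < \<theta> + \<tau>" "\<theta> + \<tau> \<le> pk (J + 1)"
  shows "crit u = (\<lambda>i. (pk i - \<theta>) / \<tau>) ` {j+1..J}" "finite (crit u)" "card (crit u) = nat (J - j)"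
proof -
  show eq: "crit u = (\<lambda>i. (pk i - \<theta>) / \<tau>) ` {j+1..J}"
  proof (intro equalityI subsetI)
    fix x assume "x \<in> crit u"
    then have x: "-1 < x" "x < 1" "C (\<tau> * x + \<theta>) = 0" using Du[of x] \<rho> by (auto simp: crit_def)
    then obtain i where i: "\<tau> * x + \<theta> = pk i" using C_zero_iff by blast
    have "\<tau> * (-1) < \<tau> * x" "\<tau> * x < \<tau> * 1" using x \<tau> by (auto simp only: mult_less_cancel_left_pos)
    then have "pk j < pk i" "pk i < pk (J + 1)" using i l r by linarith+
    then have "i \<in> {j+1..J}" by (auto simp: pk_less_iff)
    moreover have "x = (pk i - \<theta>) / \<tau>" using i \<tau> by (simp add: field_simps)
    ultimately show "x \<in> (\<lambda>i. (pk i - \<theta>) / \<tau>) ` {j+1..J}" by blast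
  next
    fix x assume "x \<in> (\<lambda>i. (pk i - \<theta>) / \<tau>) ` {j+1..J}"
    then obtain i where i: "j + 1 \<le> i" "i \<le> J" "x = (pk i - \<theta>) / \<tau>" by auto
    have "pk (j + 1) \<le> pk i" "pk i \<le> pk J" using i pk_mono by auto
    then have "- \<tau> < pk i - \<theta>" "pk i - \<theta> < \<tau>" using l r by linarith+
    then have "-1 < x" "x < 1" unfolding i(3) using \<tau>
      by (auto simp: pos_less_divide_eq pos_divide_less_eq)
    moreover have "\<tau> * x + \<theta> = pk i" using i \<tau> by simp
    ultimately show "x \<in> crit u" using Du[of x] by (simp add: crit_def C_pk)
  qed
  show "finite (crit u)" unfolding eq by simp
  have "inj_on (\<lambda>i. (pk i - \<theta>) / \<tau>) {j+1..J}" using \<tau> by (auto simp: inj_on_def pk_inj)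
  then show "card (crit u) = nat (J - j)" unfolding eq by (simp add: card_image)
qed

end

text \<open>\<open>S\<close> increases on the interval with index 0 and decreases on that with index
  1: this encodes the sign of u'(-1) as the index of the left phase.\<close>

fun start_index :: "sign \<Rightarrow> int" where
  "start_index Plus = 0" | "start_index Minus = 1"

section \<open>Half-eigenvalues as crossings of phase curves\<close>

locale bvp = half_linear +
  fixes m :: "sign \<Rightarrow> nat" and \<alpha> \<eta> :: "sign \<Rightarrow> nat \<Rightarrow> real"
  assumes \<alpha>: "\<And>\<sigma>. \<alpha> \<sigma> \<in> A_plus (m \<sigma>)"
    and \<eta>: "\<And>\<sigma> i. i \<in> {1..m \<sigma>} \<Longrightarrow> \<eta> \<sigma> i \<in> {-1<..<1}"
begin

definition "zl = left_phase (\<alpha> Minus) (\<eta> Minus) (m Minus)"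
definition "xr = right_phase (\<alpha> Plus) (\<eta> Plus) (m Plus)"
definition "lr = lres (\<alpha> Minus) (\<eta> Minus) (m Minus)"
definition "rr = rres (\<alpha> Plus) (\<eta> Plus) (m Plus)"

lemma sg_start: "sg (start_index \<nu>) = sval \<nu>"
  by (cases \<nu>) (auto simp: sg_def)

text \<open>Uniqueness for the initial value problem identifies the eigenfunction with a wave. Its
  phase is a zero of both residuals; the sign of u'(-1) fixes the index at the left end and the
  number k of critical points the index at the right end.\<close>

lemma eigenfunction_imp_phase:
  assumes l: "l > 0" and u: "u \<in> T_set m \<alpha> \<eta> k \<nu>" and sol: "half_eigen_solution a b l u"
  shows "zl (start_index \<nu>) (sqrt l) = xr (start_index \<nu> + int k) (sqrt l)"
proof -
  define \<tau> where "\<tau> = sqrt l"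
  have \<tau>: "\<tau> > 0" "\<tau>\<^sup>2 = l" using l by (auto simp: \<tau>_def)
  define \<phi> where "\<phi> s = l * hl a b s" for s
  have \<phi>c: "continuous_on A \<phi>" for A unfolding \<phi>_def by (intro continuous_intros hl_cont)
  have \<phi>L: "\<bar>\<phi> s - \<phi> t\<bar> \<le> (l * (a + b)) * \<bar>s - t\<bar>" for s t
    using mult_left_mono[OF hl_lipschitz[OF a_pos b_pos, of s t], of l] l
    by (simp add: \<phi>_def abs_mult mult_ac flip: right_diff_distrib)
  have C2: "u \<in> C2" and BC: "BC m \<alpha> \<eta> u" and bd: "D u (-1) \<noteq> 0" "D u 1 \<noteq> 0" "sval \<nu> * D u (-1) > 0"
    and crit: "card (crit u) = k"
    using u by (auto simp: T_set_def X_space_def)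
  have uc: "continuous_on {-1..1} u"
    using C2D(1)[OF C2] by (meson DERIV_continuous continuous_on_eq_continuous_within)
  \<comment> \<open>The equation is given in the open interval; continuity of u'' extends it to the
    end points.\<close>
  have DD: "D (D u) x = - \<phi> (u x)" if x: "x \<in> {-1..1}" for x
  proof -
    have c: "continuous_on (closure {-1<..<1}) (\<lambda>x. D (D u) x + \<phi> (u x))"
      using C2 continuous_on_compose2[OF \<phi>c[of UNIV] uc] by (auto simp: C2_def intro: continuous_intros)
    have "(\<lambda>x. D (D u) x + \<phi> (u x)) x = 0"
    proof (rule continuous_constant_on_closure[OF c])
      show "D (D u) t + \<phi> (u t) = 0" if "t \<in> {-1<..<1}" for t
        using sol that by (force simp: half_eigen_solution_def \<phi>_def hl_def)
    qed (use x in auto)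
    then show ?thesis by simp
  qed
  have sol1: "int_sol \<phi> (\<lambda>_. 0) (u (-1)) (D u (-1)) u"
    using C2D[OF C2] DD by (intro int_sol_classical \<phi>c) auto
  \<comment> \<open>The slope is divided by \<tau> because the derivative of the wave carries this
    factor.\<close>
  obtain r y where r: "r > 0" "u (-1) = r * S y" "D u (-1) / \<tau> = r * C y"
    "D u (-1) / \<tau> \<ge> 0 \<and> pk 0 \<le> y \<and> y \<le> pk 1 \<or> D u (-1) / \<tau> < 0 \<and> pk 1 \<le> y \<and> y \<le> pk 2"
    using polar[of "u (-1)" "D u (-1) / \<tau>"] bd \<tau> by (metis divide_eq_0_iff less_irrefl)
  define \<theta> where "\<theta> = y + \<tau>"
  define U where "U x = r * S (\<tau> * x + \<theta>)" for x
  have "int_sol \<phi> (\<lambda>_. 0) (U (-1)) (r * \<tau> * C (\<tau> * (-1) + \<theta>)) U"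
  proof (rule int_sol_classical)
    fix x :: real
    show "(U has_real_derivative r * \<tau> * C (\<tau> * x + \<theta>)) (at x within {-1..1})"
      unfolding U_def by (rule wave_deriv)
    show "((\<lambda>x. r * \<tau> * C (\<tau> * x + \<theta>)) has_real_derivative - \<phi> (U x)) (at x within {-1..1})"
      using wave_deriv(2)[of r \<tau> \<theta> x "{-1..1}"] r hl_scale[of r a b "S (\<tau> * x + \<theta>)"]
      unfolding \<phi>_def U_def by (simp add: \<tau> mult_ac)
  qed (rule \<phi>c)
  moreover have "U (-1) = u (-1)" "r * \<tau> * C (\<tau> * (-1) + \<theta>) = D u (-1)"
    using r \<tau> by (auto simp: U_def \<theta>_def field_simps)
  ultimately have "int_sol \<phi> (\<lambda>_. 0) (u (-1)) (D u (-1)) U" by simp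
  then have uU: "u x = U x" if "x \<in> {-1..1}" for x
    by (intro int_sol_unique[OF sol1 _ \<phi>L _ that]) auto
  have Du: "D u x = (r * \<tau>) * C (\<tau> * x + \<theta>)" if x: "x \<in> {-1..1}" for x
  proof (rule D_eq[OF _ x], rule has_real_derivative_within_transform[OF x])
    show "((\<lambda>x. r * S (\<tau> * x + \<theta>)) has_real_derivative r * \<tau> * C (\<tau> * x + \<theta>)) (at x within {-1..1})"
      by (rule wave_deriv)
  qed (use uU in \<open>auto simp: U_def\<close>)
  let ?j = "start_index \<nu>"
  have jy: "pk ?j < \<theta> - \<tau>" "\<theta> - \<tau> < pk (?j + 1)"
  proof -
    have "C y \<noteq> 0" using bd(1) r(3) \<tau> by auto
    then have n: "y \<noteq> pk i" for i using C_pk by auto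
    have "D u (-1) / \<tau> > 0 \<longleftrightarrow> D u (-1) > 0" "D u (-1) / \<tau> < 0 \<longleftrightarrow> D u (-1) < 0"
      using \<tau> by (auto simp: zero_less_divide_iff divide_less_0_iff)
    then have "pk ?j \<le> y \<and> y \<le> pk (?j + 1)"
      using r(4) bd by (cases \<nu>) auto
    then show "pk ?j < \<theta> - \<tau>" "\<theta> - \<tau> < pk (?j + 1)"
      using n[of ?j] n[of "?j + 1"] by (auto simp: \<theta>_def)
  qed
  obtain J where J: "pk J \<le> \<theta> + \<tau>" "\<theta> + \<tau> < pk (J + 1)" by (rule pk_cover)
  have "C (\<theta> + \<tau>) \<noteq> 0" using Du[of 1] bd(2) by (auto simp: add.commute)
  then have J': "pk J < \<theta> + \<tau>" using J(1) C_pk[of J] by (metis less_eq_real_def)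
  have "k = nat (J - ?j)"
    using crit_wave(3)[OF Du _ \<tau>(1), of ?j J] r \<tau> jy J J' crit by simp
  moreover have "?j \<le> J"
  proof -
    have "pk ?j < pk (J + 1)" using jy J \<tau> by linarith
    then show ?thesis by (simp add: pk_less_iff)
  qed
  ultimately have Jk: "J = ?j + int k" by simp
  have "lr \<theta> \<tau> = 0" "rr \<theta> \<tau> = 0"
    using wave_BC[of u r \<tau> \<theta> m \<eta> \<alpha>] uU r BC \<eta> by (auto simp: U_def lr_def rr_def)
  then have "\<theta> = zl ?j \<tau>" "\<theta> = xr J \<tau>"
    using jy J left_phase_unique[OF \<alpha>] right_phase_unique[OF \<alpha>] unfolding zl_def xr_def lr_def rr_def by auto
  then show ?thesis by (simp add: Jk \<tau>_def)
qed

text \<open>The wave with this phase is the eigenfunction: its phase at -1 lies in the interval with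
  index \<open>start_index \<nu>\<close>, its phase at 1 in the one k further, which gives k
  critical points.\<close>

lemma phase_imp_eigenfunction:
  assumes l: "l > 0" and eq: "zl (start_index \<nu>) (sqrt l) = xr (start_index \<nu> + int k) (sqrt l)"
  shows "\<exists>u\<in>T_set m \<alpha> \<eta> k \<nu>. half_eigen_solution a b l u"
proof -
  define \<tau> where "\<tau> = sqrt l"
  have \<tau>: "\<tau> > 0" "\<tau>\<^sup>2 = l" using l by (auto simp: \<tau>_def)
  let ?j = "start_index \<nu>"
  define J where "J = ?j + int k"
  define \<theta> where "\<theta> = zl ?j \<tau>"
  have jy: "pk ?j < \<theta> - \<tau>" "\<theta> - \<tau> < pk (?j + 1)" and lz: "lr \<theta> \<tau> = 0"
    using left_phase_props[OF \<alpha>] by (auto simp: \<theta>_def zl_def lr_def)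
  have "\<theta> = xr J \<tau>" using eq by (simp add: \<theta>_def J_def \<tau>_def)
  then have J: "pk J < \<theta> + \<tau>" "\<theta> + \<tau> < pk (J + 1)" and rz: "rr \<theta> \<tau> = 0"
    using right_phase_props[OF \<alpha>] by (auto simp: xr_def rr_def)
  define U where "U x = 1 * S (\<tau> * x + \<theta>)" for x
  define V where "V x = 1 * \<tau> * C (\<tau> * x + \<theta>)" for x
  define W where "W x = - (1 * \<tau>\<^sup>2 * hl a b (S (\<tau> * x + \<theta>)))" for x
  have Ud: "(U has_real_derivative V x) (at x within {-1..1})"
    and Vd: "(V has_real_derivative W x) (at x within {-1..1})" for x
    unfolding U_def V_def W_def by (rule wave_deriv)+
  have "continuous_on {-1..1} W"
    unfolding W_def
    by (intro continuous_intros continuous_on_compose2[OF hl_cont[of UNIV]] continuous_on_compose2[OF S_cont[of UNIV]]) auto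
  note U = C2I[OF Ud Vd this]
  have DU: "D U x = \<tau> * C (\<tau> * x + \<theta>)" if "x \<in> {-1..1}" for x using U(2)[OF that] by (simp add: V_def)
  note cr = crit_wave[OF DU _ \<tau>(1), of ?j J]
  have crU: "crit U = (\<lambda>i. (pk i - \<theta>) / \<tau>) ` {?j+1..J}" "finite (crit U)" "card (crit U) = k"
    using cr \<tau> jy J by (auto simp: J_def)
  have CJ: "C (\<theta> + \<tau>) \<noteq> 0" using C_sign[OF J] by auto
  have Cj: "sval \<nu> * C (\<theta> - \<tau>) > 0" using C_sign[OF jy] by (simp add: sg_start)
  have "BC m \<alpha> \<eta> U"
    using wave_BC[of U 1 \<tau> \<theta> m \<eta> \<alpha>] \<eta> lz rz by (auto simp: U_def lr_def rr_def)
  then have 1: "U \<in> X_space m \<alpha> \<eta>" using U(1) by (simp add: X_space_def)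
  have 2: "D U (-1) \<noteq> 0" "sval \<nu> * D U (-1) > 0" "D U 1 \<noteq> 0"
    using Cj CJ \<tau> DU[of "-1"] DU[of 1] by (auto simp: add.commute mult.left_commute zero_less_mult_iff)
  have 3: "simple_zero (D U) x" if x: "x \<in> crit U" for x
  proof -
    obtain i where i: "x = (pk i - \<theta>) / \<tau>" using x crU(1) by auto
    have "hl a b (S (pk i)) \<noteq> 0" using a_pos b_pos ra_pos rb_pos by (auto simp: S_pk hl_def)
    moreover have "\<tau> * x + \<theta> = pk i" using i \<tau> by simp
    ultimately have "D (D U) x \<noteq> 0" using U(3)[of x] x \<tau> by (auto simp: W_def crit_def)
    then show ?thesis using x by (simp add: simple_zero_def crit_def)
  qed
  have 4: "\<exists>z\<in>{x<..<y}. U z = 0" if xy: "x \<in> crit U" "y \<in> crit U" "x < y" for x y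
  proof -
    obtain i i' where i: "x = (pk i - \<theta>) / \<tau>" "y = (pk i' - \<theta>) / \<tau>" using xy crU(1) by auto
    then have "pk i < pk i'" using xy(3) \<tau> by (simp add: divide_less_cancel)
    then have le: "pk (i + 1) \<le> pk i'" using pk_less_iff pk_mono by simp
    obtain s where s: "pk i \<le> s" "s \<le> pk (i + 1)" "S s = 0"
    proof (cases "even i")
      case True
      then show ?thesis using that IVT'[of S "pk i" 0 "pk (i + 1)"] S_cont pk_less_Suc[of i] ra_pos rb_pos
        by (auto simp: S_pk)
    next
      case False
      then show ?thesis using that IVT2'[of S "pk (i + 1)" 0 "pk i"] S_cont pk_less_Suc[of i] ra_pos rb_pos
        by (auto simp: S_pk)
    qed
    have "S (pk i) \<noteq> 0" "S (pk (i + 1)) \<noteq> 0" using ra_pos rb_pos by (auto simp: S_pk)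
    then have s': "pk i < s" "s < pk (i + 1)" using s by (auto simp: less_eq_real_def)
    show ?thesis
    proof (rule bexI[of _ "(s - \<theta>) / \<tau>"])
      show "U ((s - \<theta>) / \<tau>) = 0" using \<tau> s by (simp add: U_def)
      show "(s - \<theta>) / \<tau> \<in> {x<..<y}" using s' le \<tau> unfolding i by (auto simp: divide_strict_right_mono)
    qed
  qed
  have "U \<in> T_set m \<alpha> \<eta> k \<nu>"
    unfolding T_set_def using 1 2 3 4 crU by blast
  moreover have "half_eigen_solution a b l U"
    unfolding half_eigen_solution_def using U(3) by (auto simp: W_def U_def \<tau> hl_def)
  ultimately show ?thesis by blast
qed

lemma zl_xr_strict_mono:
  assumes "\<tau>1 < \<tau>2"
  shows "zl j \<tau>1 - xr J \<tau>1 < zl j \<tau>2 - xr J \<tau>2"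
proof -
  have "zl j \<tau>1 < zl j \<tau>2" unfolding zl_def
    using \<eta>[of _ Minus] by (intro left_phase_strict_mono[OF \<alpha> _ assms]) (force simp: abs_le_iff)
  moreover have "xr J \<tau>2 < xr J \<tau>1" unfolding xr_def right_phase_def
    using \<eta>[of _ Plus] by (intro diff_strict_left_mono left_phase_strict_mono[OF \<alpha> _ assms]) (force simp: abs_le_iff)
  ultimately show ?thesis by simp
qed

text \<open>The difference \<open>d\<close> of the left and right phases is continuous and strictly
  increasing, and the squares of its positive zeros are the half-eigenvalues with these indices. So
  there is exactly one, the definite description denotes it, and its position relative to 1 is read
  off from the sign of d 1. For k \<ge> 1 the intervals of the two phases at \<tau> = 0 give d 0 <
  0.\<close>

lemma half_eigenvalue_compare:
  assumes k: "k \<ge> 1"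
  shows "half_eigenvalue m \<alpha> \<eta> k \<nu> a b < 1 \<Longrightarrow> xr (start_index \<nu> + int k) 1 < zl (start_index \<nu>) 1"
    and "half_eigenvalue m \<alpha> \<eta> k \<nu> a b > 1 \<Longrightarrow> zl (start_index \<nu>) 1 < xr (start_index \<nu> + int k) 1"
proof -
  let ?j = "start_index \<nu>"
  let ?J = "?j + int k"
  define d where "d \<tau> = zl ?j \<tau> - xr ?J \<tau>" for \<tau>
  have mono: "d \<tau>1 < d \<tau>2" if "\<tau>1 < \<tau>2" for \<tau>1 \<tau>2
    unfolding d_def by (rule zl_xr_strict_mono[OF that])
  have c: "continuous_on A d" for A
    unfolding d_def zl_def xr_def right_phase_def
    by (intro continuous_intros continuous_on_subset[OF left_phase_cont[OF \<alpha>]]) auto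
  have z: "pk ?j < zl ?j \<tau> - \<tau>" "zl ?j \<tau> - \<tau> < pk (?j + 1)" for \<tau>
    unfolding zl_def by (rule left_phase_props[OF \<alpha>])+
  have x: "pk ?J < xr ?J \<tau> + \<tau>" "xr ?J \<tau> + \<tau> < pk (?J + 1)" for \<tau>
    unfolding xr_def by (rule right_phase_props[OF \<alpha>])+
  have "d 0 < 0" using z(2)[of 0] x(1)[of 0] pk_mono[of "?j + 1" ?J] k by (simp add: d_def)
  \<comment> \<open>The phase bounds give d t > pk ?j - pk (?J + 1) + 2t, which equals t for this
    choice.\<close>
  define t where "t = pk (?J + 1) - pk ?j"
  have t0: "t \<ge> 0" unfolding t_def using pk_mono[of ?j "?J + 1"] by simp
  have "d t > 0" using z(1)[of t] x(2)[of t] t0 unfolding t_def d_def by linarith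
  then obtain \<tau>0 where \<tau>0: "0 \<le> \<tau>0" "d \<tau>0 = 0"
    using IVT'[of d 0 0 t] \<open>d 0 < 0\<close> t0 c by auto
  then have \<tau>0p: "\<tau>0 > 0" using \<open>d 0 < 0\<close> by (metis less_eq_real_def less_irrefl)
  have "half_eigenvalue m \<alpha> \<eta> k \<nu> a b = \<tau>0\<^sup>2"
    unfolding half_eigenvalue_def
  proof (rule the_equality)
    have "sqrt (\<tau>0\<^sup>2) = \<tau>0" using \<tau>0 by simp
    then show "\<tau>0\<^sup>2 > 0 \<and> (\<exists>u\<in>T_set m \<alpha> \<eta> k \<nu>. half_eigen_solution a b (\<tau>0\<^sup>2) u)"
      using phase_imp_eigenfunction[of "\<tau>0\<^sup>2" \<nu> k] \<tau>0 \<tau>0p by (auto simp: d_def)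
    fix l assume l: "l > 0 \<and> (\<exists>u\<in>T_set m \<alpha> \<eta> k \<nu>. half_eigen_solution a b l u)"
    then have "d (sqrt l) = 0" using eigenfunction_imp_phase[of l _ k \<nu>] by (auto simp: d_def)
    then have "sqrt l = \<tau>0" using mono \<tau>0(2) by (metis less_irrefl linorder_neqE_linordered_idom)
    then show "l = \<tau>0\<^sup>2" using l by auto
  qed
  moreover have "\<tau>0\<^sup>2 < 1 \<longleftrightarrow> \<tau>0 < 1" "\<tau>0\<^sup>2 > 1 \<longleftrightarrow> \<tau>0 > 1"
    using \<tau>0(1) by (auto simp: power_less_one_iff one_less_power abs_square_less_1)
       (metis abs_of_nonneg abs_square_le_1 linorder_not_le)
  moreover have "d 1 > 0" if "\<tau>0 < 1" using mono[OF that] \<tau>0 by simp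
  moreover have "d 1 < 0" if "\<tau>0 > 1" using mono[OF that] \<tau>0 by simp
  ultimately show "half_eigenvalue m \<alpha> \<eta> k \<nu> a b < 1 \<Longrightarrow> xr ?J 1 < zl ?j 1"
    "half_eigenvalue m \<alpha> \<eta> k \<nu> a b > 1 \<Longrightarrow> zl ?j 1 < xr ?J 1"
    by (auto simp: d_def)
qed

text \<open>At \<tau> = 0 both residuals are nonzero multiples of S(\<theta>), so the phases agree;
  afterwards they separate. This replaces the lower half-eigenvalue when k = 0.\<close>

lemma zl_above_xr: "xr j 1 < zl j 1"
proof -
  have "zl j 0 = xr j 0"
  proof -
    have z: "pk j < zl j 0" "zl j 0 < pk (j + 1)" "lr (zl j 0) 0 = 0"
      using left_phase_props[OF \<alpha>[of Minus], where j = j and \<eta> = "\<eta> Minus" and \<tau> = 0] by (auto simp: zl_def lr_def)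
    have "S (zl j 0) * (1 - (\<Sum>i=1..m Minus. \<alpha> Minus i)) = 0"
      using z(3) by (simp add: lr_def lres_def algebra_simps sum_distrib_right)
    then have "S (zl j 0) = 0" using \<alpha>[of Minus] by (auto simp: A_plus_def)
    then have "rr (zl j 0) 0 = 0" by (simp add: rr_def rres_def)
    then show ?thesis using z right_phase_unique[OF \<alpha>, of j "zl j 0" 0] by (auto simp: rr_def xr_def)
  qed
  then show ?thesis using zl_xr_strict_mono[of 0 1 j j] by simp
qed

section \<open>The side of the right condition determined by the position of 1\<close>

definition end_residual :: "sign \<Rightarrow> real" where "end_residual \<nu> = rr (zl (start_index \<nu>) 1) 1"

lemma zl_order: "zl 0 1 < zl 1 1" "zl 1 1 < zl 0 1 + per"
  using left_phase_props(1,2)[OF \<alpha>[of Minus], where j = 0 and \<eta> = "\<eta> Minus" and \<tau> = 1]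
    left_phase_props(1,2)[OF \<alpha>[of Minus], where j = 1 and \<eta> = "\<eta> Minus" and \<tau> = 1]
    left_phase_props(1)[OF \<alpha>[of Minus], where j = 2 and \<eta> = "\<eta> Minus" and \<tau> = 1]
    left_phase_period[OF \<alpha>[of Minus], where j = 0 and \<eta> = "\<eta> Minus" and \<tau> = 1]
  by (auto simp: zl_def)

text \<open>For both \<nu> the left phase lies between the right phases with indices start_index
  \<nu> + k and start_index \<nu> + k + 1. The start indices differ by one, hence the residuals have
  opposite signs.\<close>

lemma Lambda1_sign:
  assumes "1 \<in> Lambda1 m \<alpha> \<eta> k a b"
  shows "end_residual Plus * end_residual Minus < 0"
proof -
  have up: "zl (start_index \<nu>) 1 < xr (start_index \<nu> + int k + 1) 1" for \<nu>
  proof -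
    have "half_eigenvalue m \<alpha> \<eta> (k + 1) \<nu> a b > 1"
      using assms by (cases \<nu>) (auto simp: Lambda1_def lam_min_def split: if_splits)
    then show ?thesis using half_eigenvalue_compare(2)[of "k + 1" \<nu>] by (simp add: add_ac)
  qed
  have lo: "xr (start_index \<nu> + int k) 1 < zl (start_index \<nu>) 1" for \<nu>
  proof (cases "k = 0")
    case True
    then show ?thesis using zl_above_xr by simp
  next
    case False
    then have "half_eigenvalue m \<alpha> \<eta> k \<nu> a b < 1"
      using assms by (cases \<nu>) (auto simp: Lambda1_def lam_max_def)
    then show ?thesis using half_eigenvalue_compare(1)[of k \<nu>] False by simp
  qed
  have "sg (start_index \<nu> + int k) * end_residual \<nu> > 0" for \<nu>
    unfolding end_residual_def rr_def using lo[of \<nu>] up[of \<nu>] unfolding xr_def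
    by (intro rres_sign_between[OF \<alpha>])
  from this[of Plus] this[of Minus] show ?thesis
    by (auto simp: sg_def mult_less_0_iff split: if_splits)
qed

text \<open>In the first case both left phases lie in the gap between the right phases k and k + 1.
  In the second they lie in the gaps beginning at k - 1 and at k + 1, the missing bounds coming from
  periodicity; these indices have the same parity.\<close>

lemma Lambda0_sign:
  assumes k: "k \<ge> 1" and L: "1 \<in> Lambda0 m \<alpha> \<eta> k a b"
  shows "end_residual Plus * end_residual Minus > 0"
proof -
  note cP = half_eigenvalue_compare[OF k, of Plus] and cM = half_eigenvalue_compare[OF k, of Minus]
  have per: "xr (j + 2) 1 = xr j 1 + per" for j unfolding xr_def by (rule right_phase_period[OF \<alpha>])
  have sgn: "sg j * rr \<theta> 1 > 0" if "xr j 1 < \<theta>" "\<theta> < xr (j + 1) 1" for j \<theta>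
    using that unfolding xr_def rr_def by (rule rres_sign_between[OF \<alpha>])
  have g: "end_residual Plus = rr (zl 0 1) 1" "end_residual Minus = rr (zl 1 1) 1" by (auto simp: end_residual_def)
  consider "half_eigenvalue m \<alpha> \<eta> k Plus a b < 1" "half_eigenvalue m \<alpha> \<eta> k Minus a b > 1"
    | "half_eigenvalue m \<alpha> \<eta> k Plus a b > 1" "half_eigenvalue m \<alpha> \<eta> k Minus a b < 1"
    using L by (auto simp: Lambda0_def lam_min_def lam_max_def min_def max_def split: if_splits)
  then show ?thesis
  proof cases
    case 1
    then have "xr (int k) 1 < zl 0 1" "zl 1 1 < xr (int k + 1) 1"
      using cP(1) cM(2) by (auto simp: add.commute)
    then have "sg (int k) * end_residual Plus > 0" "sg (int k) * end_residual Minus > 0"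
      unfolding g using zl_order by (auto intro!: sgn)
    then show ?thesis by (auto simp: sg_def mult_less_0_iff zero_less_mult_iff split: if_splits)
  next
    case 2
    then have "zl 0 1 < xr (int k) 1" "xr (int k + 1) 1 < zl 1 1"
      using cP(2) cM(1) by (auto simp: add.commute)
    then have "sg (int k - 1) * end_residual Plus > 0" "sg (int k + 1) * end_residual Minus > 0"
      unfolding g using zl_order per[of "int k"] per[of "int k - 1"]
      by (auto intro!: sgn simp: add.commute)
    then show ?thesis by (auto simp: sg_def mult_less_0_iff zero_less_mult_iff split: if_splits)
  qed
qed

end

subsection \<open>The half-linear problem in the plane of initial data\<close>

lemma int_sol_lipschitz:
  assumes u: "int_sol \<phi> H c d u" and U: "int_sol \<phi> H c' d' U"
    and L: "\<And>s t. \<bar>\<phi> s - \<phi> t\<bar> \<le> L * \<bar>s - t\<bar>" and H: "continuous_on {-1..1} H" and x: "x \<in> {-1..1}"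
  shows "\<bar>u x - U x\<bar> \<le> (\<bar>c - c'\<bar> + 2 * \<bar>d - d'\<bar>) * exp (4 * (L + 1))"
proof -
  have \<phi>c: "continuous_on UNIV \<phi>" by (rule continuous_on_lipschitz_bound[OF L])
  obtain N where "\<And>x. x \<in> {-1..1} \<Longrightarrow> \<bar>U x\<bar> \<le> N"
    using compact_imp_bounded[OF compact_continuous_image[OF int_solD(1)[OF U] compact_Icc]]
    unfolding bounded_iff by (metis imageI real_norm_def)
  then show ?thesis
    using int_sol_estimate[OF u U \<phi>c \<phi>c H H L, of 0 0 N 0 x] x by simp
qed

lemma continuous_on_by_modulus:
  fixes f g h :: "'a::topological_space \<Rightarrow> real"
  assumes bd: "\<And>x y. x \<in> A \<Longrightarrow> y \<in> A \<Longrightarrow> \<bar>f x - f y\<bar> \<le> K * (\<bar>g x - g y\<bar> + \<bar>h x - h y\<bar>)"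
    and g: "continuous_on A g" and h: "continuous_on A h"
  shows "continuous_on A f"
  unfolding continuous_on_def
proof
  fix x assume x: "x \<in> A"
  have "((\<lambda>y. K * (\<bar>g y - g x\<bar> + \<bar>h y - h x\<bar>)) \<longlongrightarrow> K * (\<bar>g x - g x\<bar> + \<bar>h x - h x\<bar>)) (at x within A)"
    using g h x unfolding continuous_on_def by (intro tendsto_intros) auto
  then have lim: "((\<lambda>y. K * (\<bar>g y - g x\<bar> + \<bar>h y - h x\<bar>)) \<longlongrightarrow> 0) (at x within A)" by simp
  have "((\<lambda>y. f y - f x) \<longlongrightarrow> 0) (at x within A)"
  proof (rule Lim_null_comparison[OF _ lim])
    show "\<forall>\<^sub>F y in at x within A. norm (f y - f x) \<le> K * (\<bar>g y - g x\<bar> + \<bar>h y - h x\<bar>)"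
      unfolding eventually_at_filter
      by (rule always_eventually) (use bd x in auto)
  qed
  then show "(f \<longlongrightarrow> f x) (at x within A)" by (rule LIM_zero_cancel)
qed

context half_linear
begin

text \<open>The derivative is 1 + S hl(S) / C^2, and S hl(S) is nonnegative. The quotient is value
  over slope of the initial data, the analogue of the tangent.\<close>

lemma quotient_mono:
  assumes "pk j < y1" "y1 \<le> y2" "y2 < pk (j + 1)"
  shows "S y1 / C y1 \<le> S y2 / C y2"
proof (rule DERIV_nonneg_imp_nondecreasing[OF assms(2)])
  fix x assume x: "y1 \<le> x" "x \<le> y2"
  have "sg j * C x > 0" using assms x by (intro C_sign) linarith+
  then have c: "C x \<noteq> 0" by auto
  have n: "S x * hl a b (S x) \<ge> 0"
  proof (cases "S x \<ge> 0")
    case True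
    then show ?thesis using a_pos by (simp add: hl_def)
  next
    case False
    then have "b * S x \<le> 0" using b_pos by (simp add: mult_nonneg_nonpos)
    then show ?thesis using False by (simp add: hl_def mult_nonpos_nonpos)
  qed
  have "((\<lambda>x. S x / C x) has_real_derivative (C x * C x - S x * (- hl a b (S x))) / (C x * C x)) (at x)"
    by (rule DERIV_divide[OF S_deriv C_deriv c])
  moreover have "(C x * C x - S x * (- hl a b (S x))) / (C x * C x) \<ge> 0"
    using n by (intro divide_nonneg_nonneg) auto
  ultimately show "\<exists>y. ((\<lambda>x. S x / C x) has_real_derivative y) (at x) \<and> y \<ge> 0" by blast
qed

end

context bvp
begin

section \<open>Residuals as functions of the initial data\<close>

definition res :: "sign \<Rightarrow> (real \<Rightarrow> real) \<Rightarrow> real" where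
  "res \<sigma> u = u (sval \<sigma>) - (\<Sum>i=1..m \<sigma>. \<alpha> \<sigma> i * u (\<eta> \<sigma> i))"

lemma BC_iff_res: "BC m \<alpha> \<eta> u \<longleftrightarrow> res Plus u = 0 \<and> res Minus u = 0"
  unfolding BC_def res_def right_minus_eq by (subst all_sign) (rule conj_commute)

lemma sval_in: "sval \<sigma> \<in> {-1..1}" by (cases \<sigma>) auto

lemma eta_in: "i \<in> {1..m \<sigma>} \<Longrightarrow> \<eta> \<sigma> i \<in> {-1..1}" using \<eta>[of i \<sigma>] by auto

lemma al_nonneg: "i \<in> {1..m \<sigma>} \<Longrightarrow> 0 \<le> \<alpha> \<sigma> i" using \<alpha>[of \<sigma>] by (auto simp: A_plus_def)

text \<open>One B comes from the boundary value and at most one more from the weighted sum, since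
  the weights add up to less than 1.\<close>

lemma res_close:
  assumes bd: "\<And>x. x \<in> {-1..1} \<Longrightarrow> \<bar>u x - v x\<bar> \<le> B"
  shows "\<bar>res \<sigma> u - res \<sigma> v\<bar> \<le> 2 * B"
proof -
  have B0: "B \<ge> 0" using bd[of 0] by simp
  let ?s = "\<Sum>i=1..m \<sigma>. \<alpha> \<sigma> i * (u (\<eta> \<sigma> i) - v (\<eta> \<sigma> i))"
  have e: "res \<sigma> u - res \<sigma> v = (u (sval \<sigma>) - v (sval \<sigma>)) - ?s"
    by (simp add: res_def right_diff_distrib sum_subtractf)
  have "\<bar>?s\<bar> \<le> (\<Sum>i=1..m \<sigma>. \<bar>\<alpha> \<sigma> i * (u (\<eta> \<sigma> i) - v (\<eta> \<sigma> i))\<bar>)" by (rule sum_abs)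
  also have "\<dots> \<le> (\<Sum>i=1..m \<sigma>. \<alpha> \<sigma> i * B)"
  proof (rule sum_mono)
    fix i assume i: "i \<in> {1..m \<sigma>}"
    then show "\<bar>\<alpha> \<sigma> i * (u (\<eta> \<sigma> i) - v (\<eta> \<sigma> i))\<bar> \<le> \<alpha> \<sigma> i * B"
      using mult_left_mono[OF bd[OF eta_in[OF i]] al_nonneg[OF i]] al_nonneg[OF i] by (simp add: abs_mult)
  qed
  also have "\<dots> = (\<Sum>i=1..m \<sigma>. \<alpha> \<sigma> i) * B" by (simp add: sum_distrib_right)
  also have "\<dots> \<le> 1 * B" using \<alpha>[of \<sigma>] B0 by (intro mult_right_mono) (auto simp: A_plus_def)
  finally have "\<bar>?s\<bar> \<le> B" by simp
  then show ?thesis using e bd[OF sval_in[of \<sigma>]] by linarith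
qed

lemma res_cong:
  assumes "\<And>x. x \<in> {-1..1} \<Longrightarrow> u x = v x"
  shows "res \<sigma> u = res \<sigma> v"
  using res_close[of u v 0 \<sigma>] assms by simp

lemma res_diff: "res \<sigma> (\<lambda>x. u x - v x) = res \<sigma> u - res \<sigma> v"
  by (simp add: res_def right_diff_distrib sum_subtractf)

lemma res_scale: "res \<sigma> (\<lambda>x. r * u x) = r * res \<sigma> u"
  by (simp add: res_def right_diff_distrib sum_distrib_left mult.left_commute)

definition hsol :: "real \<Rightarrow> real \<Rightarrow> real \<Rightarrow> real" where
  "hsol c d = (SOME u. int_sol (hl a b) (\<lambda>_. 0) c d u)"

lemma hsol: "int_sol (hl a b) (\<lambda>_. 0) c d (hsol c d)"
proof -
  have "\<exists>u. int_sol (hl a b) (\<lambda>_. 0) c d u"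
    by (rule int_sol_exists[OF hl_lipschitz[OF a_pos b_pos]]) simp
  then show ?thesis unfolding hsol_def by (rule someI_ex)
qed

definition F :: "sign \<Rightarrow> real \<Rightarrow> real \<Rightarrow> real" where
  "F \<sigma> c d = res \<sigma> (hsol c d)"

text \<open>The exponential factor of \<open>int_sol_estimate\<close> for the Lipschitz constant a +
  b of \<open>hl a b\<close>.\<close>

definition "EE = exp (4 * (a + b + 1))"

lemma EE: "EE \<ge> 1" using a_pos b_pos by (simp add: EE_def)

lemma F_eq:
  assumes "int_sol (hl a b) (\<lambda>_. 0) c d u"
  shows "F \<sigma> c d = res \<sigma> u"
  unfolding F_def
  by (rule res_cong, rule int_sol_unique[OF hsol assms hl_lipschitz[OF a_pos b_pos]]) auto

lemma hsol_lip:
  assumes "x \<in> {-1..1}"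
  shows "\<bar>hsol c d x - hsol c' d' x\<bar> \<le> 2 * EE * (\<bar>c - c'\<bar> + \<bar>d - d'\<bar>)"
proof -
  have "\<bar>hsol c d x - hsol c' d' x\<bar> \<le> (\<bar>c - c'\<bar> + 2 * \<bar>d - d'\<bar>) * EE"
    unfolding EE_def
    by (rule int_sol_lipschitz[OF hsol hsol hl_lipschitz[OF a_pos b_pos] _ assms]) simp
  also have "\<dots> \<le> (2 * (\<bar>c - c'\<bar> + \<bar>d - d'\<bar>)) * EE"
    using EE by (intro mult_right_mono) auto
  finally show ?thesis by (simp add: algebra_simps)
qed

lemma F_lip: "\<bar>F \<sigma> c d - F \<sigma> c' d'\<bar> \<le> 4 * EE * (\<bar>c - c'\<bar> + \<bar>d - d'\<bar>)"
  using res_close[where u = "hsol c d" and v = "hsol c' d'" and \<sigma> = \<sigma>, OF hsol_lip] by (simp add: F_def)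

lemma int_sol_zero: "int_sol (hl a b) (\<lambda>_. 0) 0 0 (\<lambda>_. 0)"
  by (simp add: int_sol_def int2_def hl_def)

lemma F_zero: "F \<sigma> 0 0 = 0"
  using F_eq[OF int_sol_zero] by (simp add: res_def)

lemma hsol_bound:
  assumes x: "x \<in> {-1..1}"
  shows "\<bar>hsol c d x\<bar> \<le> 2 * EE * (\<bar>c\<bar> + \<bar>d\<bar>)"
proof -
  have "hsol 0 0 x = 0"
    using int_sol_unique[OF hsol int_sol_zero hl_lipschitz[OF a_pos b_pos] _ x] by simp
  then show ?thesis using hsol_lip[OF x, of c d 0 0] by simp
qed

lemma F_cont:
  fixes g h :: "'a::topological_space \<Rightarrow> real"
  assumes "continuous_on A g" "continuous_on A h"
  shows "continuous_on A (\<lambda>x. F \<sigma> (g x) (h x))"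
  by (rule continuous_on_by_modulus[OF F_lip assms])

lemma int2_scale: "int2 (\<lambda>s. r * w s) x = r * int2 w x"
  by (simp add: int2_def mult.left_commute)

lemma F_scale:
  assumes r: "r \<ge> 0"
  shows "F \<sigma> (r * c) (r * d) = r * F \<sigma> c d"
proof -
  have "int_sol (hl a b) (\<lambda>_. 0) (r * c) (r * d) (\<lambda>x. r * hsol c d x)"
    unfolding int_sol_def
  proof (intro conjI ballI)
    show "continuous_on {-1..1} (\<lambda>x. r * hsol c d x)"
      by (intro continuous_on_mult_left int_solD(1)[OF hsol])
    fix x :: real assume x: "x \<in> {-1..1}"
    have "int2 (\<lambda>s. hl a b (r * hsol c d s)) x = r * int2 (\<lambda>s. hl a b (hsol c d s)) x"
      unfolding hl_scale[OF r] by (rule int2_scale)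
    moreover have "hsol c d x = c + d * (x + 1) + 0 - int2 (\<lambda>s. hl a b (hsol c d s)) x"
      by (rule int_solD(2)[OF hsol x])
    ultimately show "r * hsol c d x = r * c + r * d * (x + 1) + 0 - int2 (\<lambda>s. hl a b (r * hsol c d s)) x"
      by algebra
  qed
  then show ?thesis using F_eq[of "r * c" "r * d" _ \<sigma>] by (simp add: res_scale F_def)
qed

lemma F_wave:
  assumes r: "r \<ge> 0"
  shows "F Minus (r * S (\<theta> - 1)) (r * C (\<theta> - 1)) = r * lr \<theta> 1"
    and "F Plus (r * S (\<theta> - 1)) (r * C (\<theta> - 1)) = r * rr \<theta> 1"
proof -
  define U where "U x = r * S (1 * x + \<theta>)" for x
  have "int_sol (hl a b) (\<lambda>_. 0) (U (-1)) (r * 1 * C (1 * (-1) + \<theta>)) U"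
  proof (rule int_sol_classical)
    fix x :: real
    show "(U has_real_derivative r * 1 * C (1 * x + \<theta>)) (at x within {-1..1})"
      unfolding U_def by (rule wave_deriv)
    show "((\<lambda>x. r * 1 * C (1 * x + \<theta>)) has_real_derivative - hl a b (U x)) (at x within {-1..1})"
      using wave_deriv(2)[of r 1 \<theta> x "{-1..1}"] hl_scale[OF r, of a b "S (1 * x + \<theta>)"]
      unfolding U_def by simp
  qed (rule hl_cont)
  then have s: "int_sol (hl a b) (\<lambda>_. 0) (r * S (\<theta> - 1)) (r * C (\<theta> - 1)) U"
    by (simp add: U_def)
  have U: "U = (\<lambda>x. r * S (\<theta> + 1 * x))" by (rule ext) (simp add: U_def add.commute)
  show "F Minus (r * S (\<theta> - 1)) (r * C (\<theta> - 1)) = r * lr \<theta> 1"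
    unfolding F_eq[OF s] U res_scale by (simp add: res_def lr_def lres_def)
  show "F Plus (r * S (\<theta> - 1)) (r * C (\<theta> - 1)) = r * rr \<theta> 1"
    unfolding F_eq[OF s] U res_scale by (simp add: res_def rr_def rres_def)
qed

text \<open>The residual at \<open>-1\<close> vanishes exactly on two rays of initial data, which form the graph of
  \<open>ray\<close> over the slope \<open>u'(-1)\<close>.\<close>

definition "ph \<nu> = zl (start_index \<nu>) 1 - 1"
definition "slope \<nu> = S (ph \<nu>) / C (ph \<nu>)"
definition "ray = hl (slope Plus) (slope Minus)"

lemma ph: "pk (start_index \<nu>) < ph \<nu>" "ph \<nu> < pk (start_index \<nu> + 1)" "sval \<nu> * C (ph \<nu>) > 0"
proof -
  show 1: "pk (start_index \<nu>) < ph \<nu>" "ph \<nu> < pk (start_index \<nu> + 1)"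
    using left_phase_props[OF \<alpha>[of Minus], where j = "start_index \<nu>" and \<eta> = "\<eta> Minus" and \<tau> = 1]
    by (auto simp: ph_def zl_def)
  show "sval \<nu> * C (ph \<nu>) > 0" using C_sign[OF 1] by (simp add: sg_start)
qed

lemma C_ph: "C (ph Plus) > 0" "C (ph Minus) < 0"
  using ph(3)[of Plus] ph(3)[of Minus] by auto

lemma ray_zero: "ray 0 = 0" by (simp add: ray_def hl_def)

lemma ray_eq: "p \<ge> 0 \<Longrightarrow> ray p = p * slope Plus" "p \<le> 0 \<Longrightarrow> ray p = p * slope Minus"
  by (simp_all add: ray_def hl_def max_def)

lemma ray_cont: "continuous_on A ray" unfolding ray_def by (rule hl_cont)

lemma ray_scale: "r \<ge> 0 \<Longrightarrow> ray (r * p) = r * ray p" unfolding ray_def by (rule hl_scale)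

lemma ray_bound: "\<bar>ray p\<bar> \<le> (\<bar>slope Plus\<bar> + \<bar>slope Minus\<bar>) * \<bar>p\<bar>"
proof -
  have "\<bar>ray p\<bar> = \<bar>p\<bar> * \<bar>slope Plus\<bar> \<or> \<bar>ray p\<bar> = \<bar>p\<bar> * \<bar>slope Minus\<bar>"
    by (cases "p \<ge> 0") (simp_all add: ray_eq abs_mult)
  then show ?thesis by (auto simp: mult.commute intro!: mult_left_mono)
qed

text \<open>Right residuals on the two rays per unit of the slope datum p. The divisor C(ph Minus)
  is negative, so end residuals of opposite sign give coefficients of equal sign, and
  conversely.\<close>

definition "kP = end_residual Plus / C (ph Plus)"
definition "kM = end_residual Minus / C (ph Minus)"

lemma F_ray: "F Plus (ray p) p = hl kP kM p"
proof (cases "p \<ge> 0")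
  case True
  have "p / C (ph Plus) \<ge> 0" using True C_ph by simp
  from F_wave(2)[OF this, of "zl 0 1"]
  have "F Plus (p / C (ph Plus) * S (ph Plus)) (p / C (ph Plus) * C (ph Plus)) = p / C (ph Plus) * end_residual Plus"
    by (simp add: ph_def end_residual_def)
  then show ?thesis using True C_ph by (simp add: ray_eq slope_def hl_def kP_def)
next
  case False
  have "p / C (ph Minus) \<ge> 0" using False C_ph by (simp add: divide_nonpos_neg)
  from F_wave(2)[OF this, of "zl 1 1"]
  have "F Plus (p / C (ph Minus) * S (ph Minus)) (p / C (ph Minus) * C (ph Minus)) = p / C (ph Minus) * end_residual Minus"
    by (simp add: ph_def end_residual_def)
  then show ?thesis using False C_ph by (simp add: ray_eq slope_def hl_def kM_def)
qed

text \<open>In polar coordinates both signs are decided by the position of the phase y relative to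
  \<open>ph \<nu>\<close>: that of the residual by \<open>left_phase_sign\<close>, that of q because
  q is p times the change of the monotone quotient S/C. The sign of C y enters both and cancels. For
  p = 0 the phase is an extremum of \<open>S\<close> and \<open>lres_at_pk\<close> decides.\<close>

lemma F_minus_sign:
  shows "q > 0 \<Longrightarrow> F Minus (ray p + q) p > 0" and "q < 0 \<Longrightarrow> F Minus (ray p + q) p < 0"
proof -
  have *: "(q > 0 \<longrightarrow> F Minus (ray p + q) p > 0) \<and> (q < 0 \<longrightarrow> F Minus (ray p + q) p < 0)" if q: "q \<noteq> 0"
  proof -
    have ne: "ray p + q \<noteq> 0 \<or> p \<noteq> 0" using q ray_zero by auto
    obtain r y where ry: "r > 0" "ray p + q = r * S y" "p = r * C y"
      and dis: "p \<ge> 0 \<and> pk 0 \<le> y \<and> y \<le> pk 1 \<or> p < 0 \<and> pk 1 \<le> y \<and> y \<le> pk 2"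
      using polar[OF ne] by blast
    define \<theta> where "\<theta> = y + 1"
    have y\<theta>: "\<theta> - 1 = y" by (simp add: \<theta>_def)
    have Fm: "F Minus (ray p + q) p = r * lr \<theta> 1"
      using F_wave(1)[of r \<theta>] ry y\<theta> by simp
    have "(q > 0 \<longrightarrow> lr \<theta> 1 > 0) \<and> (q < 0 \<longrightarrow> lr \<theta> 1 < 0)"
    proof (cases "p = 0")
      case True
      then have Cy: "C y = 0" using ry by simp
      have y: "pk 0 \<le> y" "y \<le> pk 1" using dis True by auto
      have "y = pk 0 \<or> y = pk 1"
      proof (rule ccontr)
        assume "\<not> (y = pk 0 \<or> y = pk 1)"
        then have "pk 0 < y" "y < pk (0 + 1)" using y by auto
        from C_sign[OF this] show False using Cy by simp
      qed
      moreover have "q = r * S y" using ry True ray_zero by simp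
      moreover have "S (pk 0) < 0" "S (pk 1) > 0" using ra_pos rb_pos by (simp_all add: S_pk)
      moreover have "lr (pk 0 + 1) 1 < 0" "lr (pk 1 + 1) 1 > 0"
        using lres_at_pk[OF \<alpha>[of Minus], of 0 "\<eta> Minus" 1] by (simp_all add: lr_def sg_def)
      ultimately show ?thesis
        using ry(1) y\<theta> unfolding \<theta>_def by (auto simp: zero_less_mult_iff mult_less_0_iff)
    next
      case False
      define \<nu> where "\<nu> = (if p > 0 then Plus else Minus)"
      let ?j = "start_index \<nu>"
      have cn: "C y \<noteq> 0" using ry False by auto
      then have npk: "y \<noteq> pk i" for i using C_pk by auto
      have yj: "pk ?j < y" "y < pk (?j + 1)"
        using dis npk[of 0] npk[of 1] npk[of 2] False by (auto simp: \<nu>_def)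
      have sC: "sval \<nu> * C y > 0" using C_sign[OF yj] by (simp add: sg_start)
      have "ray p = p * slope \<nu>" using False by (auto simp: \<nu>_def ray_eq)
      then have "q = r * S y - r * C y * slope \<nu>" using ry by simp
      also have "\<dots> = r * C y * (S y / C y - slope \<nu>)" using cn by (simp add: right_diff_distrib)
      finally have qW: "q = r * C y * (S y / C y - slope \<nu>)" .
      have W: "S y / C y \<le> slope \<nu>" if "y \<le> ph \<nu>"
        unfolding slope_def by (rule quotient_mono[OF yj(1) that ph(2)])
      have W': "slope \<nu> \<le> S y / C y" if "ph \<nu> \<le> y"
        unfolding slope_def by (rule quotient_mono[OF ph(1) that yj(2)])
      have pj: "pk ?j \<le> \<theta> - 1" "\<theta> - 1 \<le> pk (?j + 1)" using yj y\<theta> by auto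
      have lt: "sval \<nu> * lr \<theta> 1 < 0" if "y < ph \<nu>"
        using left_phase_sign(1)[OF \<alpha>[of Minus] pj, of "\<eta> Minus"] that unfolding lr_def ph_def zl_def \<theta>_def sg_start by simp
      have gt: "sval \<nu> * lr \<theta> 1 > 0" if "ph \<nu> < y"
        using left_phase_sign(2)[OF \<alpha>[of Minus] pj, of "\<eta> Minus"] that unfolding lr_def ph_def zl_def \<theta>_def sg_start by simp
      have ne: "y \<noteq> ph \<nu>"
      proof
        assume "y = ph \<nu>"
        then have "S y / C y - slope \<nu> = 0" by (simp add: slope_def)
        then show False using qW q by simp
      qed
      show ?thesis
      proof (cases \<nu>)
        case Plus
        then have C: "r * C y > 0" using sC ry by simp
        show ?thesis
        proof (cases "y < ph \<nu>")
          case True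
          then have "q \<le> 0" unfolding qW using W C by - (rule mult_nonneg_nonpos, auto)
          then show ?thesis using lt[OF True] Plus q by simp
        next
          case False
          then have "q \<ge> 0" unfolding qW using W' C by - (rule mult_nonneg_nonneg, auto)
          then show ?thesis using gt False ne Plus q by simp
        qed
      next
        case Minus
        then have C: "r * C y < 0" using sC ry by (simp add: mult_pos_neg)
        show ?thesis
        proof (cases "y < ph \<nu>")
          case True
          then have "q \<ge> 0" unfolding qW using W C by - (rule mult_nonpos_nonpos, auto)
          then show ?thesis using lt[OF True] Minus q by simp
        next
          case False
          then have "q \<le> 0" unfolding qW using W' C by - (rule mult_nonpos_nonneg, auto)
          then show ?thesis using gt False ne Minus q by simp
        qed
      qed
    qed
    then show ?thesis unfolding Fm using ry(1) by (simp add: mult_pos_neg)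
  qed
  show "q > 0 \<Longrightarrow> F Minus (ray p + q) p > 0" "q < 0 \<Longrightarrow> F Minus (ray p + q) p < 0"
    using * by auto
qed

text \<open>Homogeneity reduces the cone to the segments q = 1 and q = -1 with |p| \<le> M, where
  compactness turns the strict signs into bounds.\<close>

lemma F_minus_lower:
  assumes M: "M \<ge> 0"
  obtains \<kappa> where "\<kappa> > 0" "\<And>p q. \<bar>p\<bar> \<le> M * \<bar>q\<bar> \<Longrightarrow> q \<ge> 0 \<Longrightarrow> F Minus (ray p + q) p \<ge> \<kappa> * q"
    "\<And>p q. \<bar>p\<bar> \<le> M * \<bar>q\<bar> \<Longrightarrow> q \<le> 0 \<Longrightarrow> F Minus (ray p + q) p \<le> \<kappa> * q"
proof -
  have c: "continuous_on {-M..M} (\<lambda>p. F Minus (ray p + e) p)" for e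
    by (intro F_cont continuous_on_add ray_cont continuous_on_const continuous_on_id)
  have ne: "{-M..M} \<noteq> {}" using M by simp
  obtain p1 where p1: "\<forall>p\<in>{-M..M}. F Minus (ray p1 + 1) p1 \<le> F Minus (ray p + 1) p"
    using continuous_attains_inf[OF compact_Icc ne c[of 1]] by blast
  obtain p2 where p2: "\<forall>p\<in>{-M..M}. F Minus (ray p + - 1) p \<le> F Minus (ray p2 + - 1) p2"
    using continuous_attains_sup[OF compact_Icc ne c[of "- 1"]] by blast
  define \<kappa> where "\<kappa> = min (F Minus (ray p1 + 1) p1) (- F Minus (ray p2 + - 1) p2)"
  have \<kappa>: "\<kappa> > 0" using F_minus_sign(1)[of 1 p1] F_minus_sign(2)[of "- 1" p2] by (simp add: \<kappa>_def)
  have sc: "F Minus (ray p + t * e) p = t * F Minus (ray (p / t) + e) (p / t)" if "t > 0" for p t e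
    using F_scale[of t Minus "ray (p / t) + e" "p / t"] ray_scale[of t "p / t"] that
    by (simp add: distrib_left)
  have rg: "p / t \<in> {-M..M}" if "t > 0" "\<bar>p\<bar> \<le> M * t" for p t
    using that by (auto simp: abs_le_iff pos_le_divide_eq pos_divide_le_eq minus_le_iff)
  show ?thesis
  proof (rule that[OF \<kappa>])
    fix p q :: real assume pq: "\<bar>p\<bar> \<le> M * \<bar>q\<bar>" "q \<ge> 0"
    show "F Minus (ray p + q) p \<ge> \<kappa> * q"
    proof (cases "q = 0")
      case True
      then show ?thesis using pq ray_zero F_zero by simp
    next
      case False
      then have q: "q > 0" using pq by simp
      then have "\<kappa> \<le> F Minus (ray (p / q) + 1) (p / q)"
        using p1 rg[OF q] pq unfolding \<kappa>_def by (metis abs_of_pos min.coboundedI1)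
      then show ?thesis using sc[OF q, of p 1] mult_left_mono[of \<kappa> "F Minus (ray (p / q) + 1) (p / q)" q] q
        by (simp add: mult.commute)
    qed
  next
    fix p q :: real assume pq: "\<bar>p\<bar> \<le> M * \<bar>q\<bar>" "q \<le> 0"
    show "F Minus (ray p + q) p \<le> \<kappa> * q"
    proof (cases "q = 0")
      case True
      then show ?thesis using pq ray_zero F_zero by simp
    next
      case False
      define t where "t = - q"
      have t: "t > 0" "\<bar>p\<bar> \<le> M * t" using pq False by (auto simp: t_def)
      have "F Minus (ray (p / t) + - 1) (p / t) \<le> F Minus (ray p2 + - 1) p2" using p2 rg[OF t] by blast
      also have "\<dots> \<le> - \<kappa>" unfolding \<kappa>_def by simp
      finally have "t * F Minus (ray (p / t) + - 1) (p / t) \<le> t * - \<kappa>" using t by (intro mult_left_mono) auto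
      then show ?thesis using sc[OF t(1), of p "- 1"] by (simp add: t_def mult.commute)
    qed
  qed
qed

text \<open>\<open>int_sol_estimate\<close> against \<open>hsol c d\<close>, which is bounded by 2
  EE (|c| + |d|); this 2 and the 4 of the estimate give the 8.\<close>

lemma sol_compare:
  assumes u: "int_sol \<phi> H c d u" and \<phi>: "continuous_on UNIV \<phi>" and H: "continuous_on {-1..1} H"
    and dev: "\<And>s. \<bar>\<phi> s - hl a b s\<bar> \<le> e * \<bar>s\<bar> + K0" and e: "0 \<le> e" "e \<le> 1" and K0: "0 \<le> K0"
    and Hb: "integral {-1..1} (\<lambda>s. \<bar>H s\<bar>) \<le> h"
  shows "x \<in> {-1..1} \<Longrightarrow> \<bar>(u x - H x) - hsol c d x\<bar> \<le>
      (2 * (a + b + 1) * h + 8 * e * EE * (\<bar>c\<bar> + \<bar>d\<bar>) + 4 * K0) * EE"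
    and "\<bar>res \<sigma> u - res \<sigma> H - F \<sigma> c d\<bar> \<le>
      2 * ((2 * (a + b + 1) * h + 8 * e * EE * (\<bar>c\<bar> + \<bar>d\<bar>) + 4 * K0) * EE)"
proof -
  show 1: "\<bar>(u x - H x) - hsol c d x\<bar> \<le> (2 * (a + b + 1) * h + 8 * e * EE * (\<bar>c\<bar> + \<bar>d\<bar>) + 4 * K0) * EE"
    if "x \<in> {-1..1}" for x
    using int_sol_estimate[OF u hsol \<phi> hl_cont H continuous_on_const hl_lipschitz[OF a_pos b_pos] dev e K0
        hsol_bound _ that, of h c d] Hb
    by (simp add: EE_def mult_ac)
  show "\<bar>res \<sigma> u - res \<sigma> H - F \<sigma> c d\<bar> \<le>
      2 * ((2 * (a + b + 1) * h + 8 * e * EE * (\<bar>c\<bar> + \<bar>d\<bar>) + 4 * K0) * EE)"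
    using res_close[of "\<lambda>x. u x - H x" "hsol c d", OF 1] by (simp add: res_diff F_def)
qed

end

subsection \<open>The nonlinear boundary value problem\<close>

text \<open>Any positive e is allowed at the price of K0: far out the limits of f(s)/s bound the
  deviation by e|s|, and on the remaining compact interval it is bounded.\<close>

lemma asymptotically_half_linear:
  fixes f :: "real \<Rightarrow> real"
  assumes f: "continuous_on UNIV f" and top: "((\<lambda>s. f s / s) \<longlongrightarrow> a) at_top"
    and bot: "((\<lambda>s. f s / s) \<longlongrightarrow> b) at_bot" and e: "e > 0"
  obtains K0 where "K0 \<ge> 0" "\<And>s. \<bar>f s - hl a b s\<bar> \<le> e * \<bar>s\<bar> + K0"
proof -
  obtain N1 where N1: "\<And>s. s \<ge> N1 \<Longrightarrow> \<bar>f s / s - a\<bar> < e"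
    using tendstoD[OF top e] unfolding eventually_at_top_linorder dist_real_def by blast
  obtain N2 where N2: "\<And>s. s \<le> N2 \<Longrightarrow> \<bar>f s / s - b\<bar> < e"
    using tendstoD[OF bot e] unfolding eventually_at_bot_linorder dist_real_def by blast
  define I where "I = {min N2 (-1)..max N1 1}"
  have "continuous_on I (\<lambda>s. f s - hl a b s)"
    by (intro continuous_on_diff continuous_on_subset[OF f] hl_cont) auto
  then have "bounded ((\<lambda>s. f s - hl a b s) ` I)"
    unfolding I_def by (intro compact_imp_bounded compact_continuous_image) auto
  then obtain B where B: "\<And>s. s \<in> I \<Longrightarrow> \<bar>f s - hl a b s\<bar> \<le> B"
    unfolding bounded_iff by (metis imageI real_norm_def)
  show ?thesis
  proof (rule that[of "\<bar>B\<bar>"])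
    fix s
    consider "s \<in> I" | "s \<ge> N1" "s \<ge> 1" | "s \<le> N2" "s \<le> -1" unfolding I_def by fastforce
    then show "\<bar>f s - hl a b s\<bar> \<le> e * \<bar>s\<bar> + \<bar>B\<bar>"
    proof cases
      case 1
      then have "\<bar>f s - hl a b s\<bar> \<le> \<bar>B\<bar>" using B[OF 1] by linarith
      moreover have "0 \<le> e * \<bar>s\<bar>" using e by simp
      ultimately show ?thesis by linarith
    next
      case 2
      have "f s - hl a b s = (f s / s - a) * s" using 2 by (simp add: hl_def left_diff_distrib)
      then have "\<bar>f s - hl a b s\<bar> = \<bar>f s / s - a\<bar> * \<bar>s\<bar>" by (simp only: abs_mult)
      also have "\<dots> \<le> e * \<bar>s\<bar>" using N1[OF 2(1)] by (intro mult_right_mono) auto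
      finally show ?thesis by linarith
    next
      case 3
      have "f s - hl a b s = (f s / s - b) * s" using 3 by (simp add: hl_def left_diff_distrib)
      then have "\<bar>f s - hl a b s\<bar> = \<bar>f s / s - b\<bar> * \<bar>s\<bar>" by (simp only: abs_mult)
      also have "\<dots> \<le> e * \<bar>s\<bar>" using N2[OF 3(1)] by (intro mult_right_mono) auto
      finally show ?thesis by linarith
    qed
  qed simp
qed

text \<open>The weak second derivative is -h - f(u) almost everywhere, and \<open>int2\<close> does
  not see null sets; the representation of functions with a weak second derivative then gives the
  integral equation with H = -\<open>int2 h\<close>.\<close>

lemma is_solution_iff:
  assumes f: "continuous_on UNIV f" and h: "h \<in> L1"
  shows "is_solution m \<alpha> \<eta> f h u \<longleftrightarrow> BC m \<alpha> \<eta> u \<and> (\<exists>c d. int_sol f (\<lambda>x. - int2 h x) c d u)"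
proof -
  have h': "h absolutely_integrable_on {-1..1}" using h by (simp add: L1_iff)
  have fu: "continuous_on {-1..1} (\<lambda>s. f (u s))" if "continuous_on {-1..1} u"
    using continuous_on_compose2[OF f that] by simp
  show ?thesis
  proof
    assume "is_solution m \<alpha> \<eta> f h u"
    then obtain w where uc: "continuous_on {-1..1} u" and BC: "BC m \<alpha> \<eta> u" and w: "weak_second_deriv u w"
      and ae: "AE x\<in>{-1<..<1} in lebesgue. - w x = f (u x) + h x"
      by (auto simp: is_solution_def X_tilde_def W21_def)
    obtain c d where cd: "\<And>x. x \<in> {-1..1} \<Longrightarrow> u x = c + d * (x + 1) + int2 w x"
      using weak_second_deriv_representation[OF uc w] by blast
    have fL: "(\<lambda>s. f (u s)) absolutely_integrable_on {-1..1}" using L1_continuous[OF fu[OF uc]] .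
    have "int2 w x = - int2 h x - int2 (\<lambda>s. f (u s)) x" if x: "x \<in> {-1..1}" for x
    proof -
      obtain N where eq: "\<And>x. x \<in> space lebesgue - N \<Longrightarrow> x \<in> {-1<..<1} \<longrightarrow> - w x = f (u x) + h x"
        and N: "N \<in> null_sets lebesgue"
        by (rule AE_E3[OF ae]) (rule that)
      have N': "negligible (N \<union> {-1, 1})"
        using N by (intro negligible_Un) (auto simp: negligible_iff_null_sets)
      have "int2 w x = integral {-1..x} (\<lambda>s. (x - s) * (- h s - f (u s)))"
        unfolding int2_def 
      proof (rule integral_spike[OF N'])
        fix s assume s: "s \<in> {-1..x} - (N \<union> {-1, 1})"
        then have "- w s = f (u s) + h s" using eq[of s] x by auto
        then have "w s = - h s - f (u s)" by linarith
        then show "(x - s) * (- h s - f (u s)) = (x - s) * w s" by simp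
      qed
      also have "\<dots> = int2 (\<lambda>s. - h s - f (u s)) x" by (simp add: int2_def)
      also have "\<dots> = int2 (\<lambda>s. - h s) x - int2 (\<lambda>s. f (u s)) x"
        by (rule int2_diff[OF _ fL x]) (use absolutely_integrable_mult_continuous[OF h', of "\<lambda>_. - 1"] in simp)
      also have "int2 (\<lambda>s. - h s) x = - int2 h x" by (simp add: int2_def)
      finally show ?thesis .
    qed
    then have "int_sol f (\<lambda>x. - int2 h x) c d u"
      unfolding int_sol_def using uc cd by simp
    then show "BC m \<alpha> \<eta> u \<and> (\<exists>c d. int_sol f (\<lambda>x. - int2 h x) c d u)" using BC by blast
  next
    assume "BC m \<alpha> \<eta> u \<and> (\<exists>c d. int_sol f (\<lambda>x. - int2 h x) c d u)"
    then obtain c d where BC: "BC m \<alpha> \<eta> u" and u: "int_sol f (\<lambda>x. - int2 h x) c d u" by blast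
    have uc: "continuous_on {-1..1} u" by (rule int_solD(1)[OF u])
    have fL: "(\<lambda>s. f (u s)) absolutely_integrable_on {-1..1}" using L1_continuous[OF fu[OF uc]] .
    define w where "w s = - h s - f (u s)" for s
    have nh: "(\<lambda>s. - h s) absolutely_integrable_on {-1..1}" using absolutely_integrable_mult_continuous[OF h', of "\<lambda>_. - 1"] by simp
    have w: "w \<in> L1" unfolding L1_iff w_def
      using nh fL by (rule set_integral_diff(1))
    have "u x = c + d * (x + 1) + int2 w x" if x: "x \<in> {-1..1}" for x
    proof -
      have "int2 w x = int2 (\<lambda>s. - h s) x - int2 (\<lambda>s. f (u s)) x"
        unfolding w_def by (rule int2_diff[OF nh fL x])
      also have "int2 (\<lambda>s. - h s) x = - int2 h x" by (simp add: int2_def)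
      finally show ?thesis using int_solD(2)[OF u x] by linarith
    qed
    then have wd: "weak_second_deriv u w" by (rule weak_second_deriv_int2[OF w])
    then show "is_solution m \<alpha> \<eta> f h u"
      unfolding is_solution_def X_tilde_def W21_def using uc BC
      by (auto intro!: exI[of _ w] simp: w_def)
  qed
qed

section \<open>Uniform comparison with the half-linear residuals\<close>

context bvp
begin

text \<open>One constant for all comparisons, in the coordinates p and q. It is uniform in \<phi>,
  H, e \<le> 1 and K0, so that e, and with it K0, can be chosen after K.\<close>

definition comparison_const :: "real \<Rightarrow> bool" where
  "comparison_const K \<longleftrightarrow> K \<ge> 1 \<and>
    (\<forall>e K0 \<phi> H p q u h \<sigma>. int_sol \<phi> H (ray p + q) p u \<longrightarrow> continuous_on UNIV \<phi> \<longrightarrow>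
      continuous_on {-1..1} H \<longrightarrow> (\<forall>s. \<bar>\<phi> s - hl a b s\<bar> \<le> e * \<bar>s\<bar> + K0) \<longrightarrow> 0 \<le> e \<longrightarrow> e \<le> 1 \<longrightarrow>
      0 \<le> K0 \<longrightarrow> integral {-1..1} (\<lambda>s. \<bar>H s\<bar>) \<le> h \<longrightarrow>
      \<bar>res \<sigma> u - res \<sigma> H - F \<sigma> (ray p + q) p\<bar> \<le> K * (e * (\<bar>p\<bar> + \<bar>q\<bar>) + h + K0)) \<and>
    (\<forall>\<sigma> p q. \<bar>F \<sigma> (ray p + q) p - F \<sigma> (ray p) p\<bar> \<le> K * \<bar>q\<bar>) \<and>
    (\<forall>\<sigma> p q. \<bar>F \<sigma> (ray p + q) p\<bar> \<le> K * (\<bar>p\<bar> + \<bar>q\<bar>))"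

lemma comparison_constD:
  assumes "comparison_const K"
  shows "K \<ge> 1"
    and "int_sol \<phi> H (ray p + q) p u \<Longrightarrow> continuous_on UNIV \<phi> \<Longrightarrow> continuous_on {-1..1} H \<Longrightarrow>
      (\<And>s. \<bar>\<phi> s - hl a b s\<bar> \<le> e * \<bar>s\<bar> + K0) \<Longrightarrow> 0 \<le> e \<Longrightarrow> e \<le> 1 \<Longrightarrow> 0 \<le> K0 \<Longrightarrow>
      integral {-1..1} (\<lambda>s. \<bar>H s\<bar>) \<le> h \<Longrightarrow>
      \<bar>res \<sigma> u - res \<sigma> H - F \<sigma> (ray p + q) p\<bar> \<le> K * (e * (\<bar>p\<bar> + \<bar>q\<bar>) + h + K0)"
    and "\<bar>F \<sigma> (ray p + q) p - F \<sigma> (ray p) p\<bar> \<le> K * \<bar>q\<bar>"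
    and "\<bar>F \<sigma> (ray p + q) p\<bar> \<le> K * (\<bar>p\<bar> + \<bar>q\<bar>)"
  using assms unfolding comparison_const_def by blast+

lemma comparison_const_exists: "\<exists>K. comparison_const K"
proof -
  define T where "T = \<bar>slope Plus\<bar> + \<bar>slope Minus\<bar> + 1"
  have T: "T \<ge> 1" by (simp add: T_def)
  have N: "\<bar>ray p + q\<bar> + \<bar>p\<bar> \<le> T * (\<bar>p\<bar> + \<bar>q\<bar>)" for p q
  proof -
    have "\<bar>ray p\<bar> + \<bar>p\<bar> \<le> T * \<bar>p\<bar>" using ray_bound[of p] by (simp add: T_def distrib_right)
    moreover have "\<bar>q\<bar> \<le> T * \<bar>q\<bar>" using mult_right_mono[OF T, of "\<bar>q\<bar>"] by simp
    ultimately show ?thesis unfolding distrib_left by linarith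
  qed
  \<comment> \<open>The coefficients of the forcing, of the relative error and of the constant
    error; the factor T in the second passes from the initial data to p and q.\<close>
  define A1 where "A1 = 4 * (a + b + 1) * EE"
  define A2 where "A2 = 16 * EE * EE * T"
  define A3 where "A3 = 8 * EE"
  define K where "K = A1 + A2 + A3"
  have pos: "A1 \<ge> 0" "A2 \<ge> 0" "A3 \<ge> 8" using a_pos b_pos EE T by (auto simp: A1_def A2_def A3_def)
  then have K: "A1 \<le> K" "A2 \<le> K" "A3 \<le> K" "K \<ge> 1" by (auto simp: K_def)
  have "4 * EE * T \<le> A2"
  proof -
    have "4 * EE * T * 1 \<le> 4 * EE * T * (4 * EE)" using EE T by (intro mult_left_mono) auto
    then show ?thesis by (simp add: A2_def mult_ac)
  qed
  then have K4: "4 * EE * T \<le> K" using K(2) by linarith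
  show ?thesis
    unfolding comparison_const_def
  proof (intro exI[of _ K] conjI allI impI)
    show "1 \<le> K" by (rule K(4))
  next
    fix e K0 \<phi> H p q u h \<sigma>
    assume as: "int_sol \<phi> H (ray p + q) p u" "continuous_on UNIV \<phi>" "continuous_on {-1..1} H"
      "\<forall>s. \<bar>\<phi> s - hl a b s\<bar> \<le> e * \<bar>s\<bar> + K0" "0 \<le> e" "e \<le> 1" "0 \<le> K0"
      "integral {-1..1} (\<lambda>s. \<bar>H s\<bar>) \<le> h"
    have "0 \<le> integral {-1..1} (\<lambda>s. \<bar>H s\<bar>)"
      by (intro integral_nonneg integrable_continuous_real continuous_on_rabs as(3)) auto
    then have h: "0 \<le> h" using as(8) by linarith
    let ?N = "\<bar>p\<bar> + \<bar>q\<bar>"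
    have "\<bar>res \<sigma> u - res \<sigma> H - F \<sigma> (ray p + q) p\<bar> \<le>
      2 * ((2 * (a + b + 1) * h + 8 * e * EE * (\<bar>ray p + q\<bar> + \<bar>p\<bar>) + 4 * K0) * EE)"
      by (rule sol_compare(2)[OF as(1-3) as(4)[rule_format] as(5-8)])
    also have "\<dots> = A1 * h + (16 * EE * EE * e) * (\<bar>ray p + q\<bar> + \<bar>p\<bar>) + A3 * K0"
      by (simp add: A1_def A3_def algebra_simps)
    also have "(16 * EE * EE * e) * (\<bar>ray p + q\<bar> + \<bar>p\<bar>) \<le> (16 * EE * EE * e) * (T * ?N)"
      using N EE as(5) by (intro mult_left_mono) auto
    also have "\<dots> = A2 * (e * ?N)" by (simp add: A2_def mult_ac)
    also have "A2 * (e * ?N) \<le> K * (e * ?N)" using K(2) as(5) by (intro mult_right_mono) auto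
    also have "A1 * h \<le> K * h" using K(1) h by (rule mult_right_mono)
    also have "A3 * K0 \<le> K * K0" using K(3) as(7) by (rule mult_right_mono)
    finally show "\<bar>res \<sigma> u - res \<sigma> H - F \<sigma> (ray p + q) p\<bar> \<le> K * (e * ?N + h + K0)"
      by (simp add: algebra_simps)
  next
    fix \<sigma> p q
    have "\<bar>F \<sigma> (ray p + q) p - F \<sigma> (ray p) p\<bar> \<le> (4 * EE) * \<bar>q\<bar>"
      using F_lip[of \<sigma> "ray p + q" p "ray p" p] by simp
    also have "\<dots> \<le> (4 * EE * T) * \<bar>q\<bar>" using EE T by (intro mult_right_mono) auto
    also have "\<dots> \<le> K * \<bar>q\<bar>" using K4 by (intro mult_right_mono) auto
    finally show "\<bar>F \<sigma> (ray p + q) p - F \<sigma> (ray p) p\<bar> \<le> K * \<bar>q\<bar>" .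
    have "\<bar>F \<sigma> (ray p + q) p\<bar> \<le> (4 * EE) * (\<bar>ray p + q\<bar> + \<bar>p\<bar>)"
      using F_lip[of \<sigma> "ray p + q" p 0 0] by (simp add: F_zero)
    also have "\<dots> \<le> (4 * EE) * (T * (\<bar>p\<bar> + \<bar>q\<bar>))" using N EE by (intro mult_left_mono) auto
    also have "\<dots> = (4 * EE * T) * (\<bar>p\<bar> + \<bar>q\<bar>)" by simp
    also have "\<dots> \<le> K * (\<bar>p\<bar> + \<bar>q\<bar>)" using K4 by (intro mult_right_mono) auto
    finally show "\<bar>F \<sigma> (ray p + q) p\<bar> \<le> K * (\<bar>p\<bar> + \<bar>q\<bar>)" .
  qed
qed

text \<open>The sign conditions of the Poincare-Miranda theorem, required of every nonlinearity in a
  neighbourhood that contains the Lipschitz approximations of \<open>f\<close>.\<close>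

definition box_signs :: "real \<Rightarrow> real \<Rightarrow> (real \<Rightarrow> real) \<Rightarrow> real \<Rightarrow> real \<Rightarrow> real \<Rightarrow> real \<Rightarrow> real \<Rightarrow> bool" where
  "box_signs e K0 H s p1 p2 q1 q2 \<longleftrightarrow> (\<forall>\<phi> p q u. continuous_on UNIV \<phi> \<longrightarrow>
     (\<forall>t. \<bar>\<phi> t - hl a b t\<bar> \<le> e * \<bar>t\<bar> + K0) \<longrightarrow> int_sol \<phi> H (ray p + q) p u \<longrightarrow>
     p \<in> {p1..p2} \<longrightarrow> q \<in> {q1..q2} \<longrightarrow>
     (p = p1 \<longrightarrow> s * res Plus u \<le> 0) \<and> (p = p2 \<longrightarrow> s * res Plus u \<ge> 0) \<and>
     (q = q1 \<longrightarrow> res Minus u \<le> 0) \<and> (q = q2 \<longrightarrow> res Minus u \<ge> 0))"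

text \<open>For a Lipschitz nonlinearity the solution is unique and depends continuously on p and q,
  so the residuals are continuous on the box and the Poincare-Miranda theorem applies.\<close>

lemma lipschitz_box_solution:
  assumes L: "\<And>s t. \<bar>\<phi> s - \<phi> t\<bar> \<le> L * \<bar>s - t\<bar>" and dev: "\<And>t. \<bar>\<phi> t - hl a b t\<bar> \<le> e * \<bar>t\<bar> + K0"
    and H: "continuous_on {-1..1} H" and le: "p1 \<le> p2" "q1 \<le> q2" and s: "s \<noteq> 0"
    and sides: "box_signs e K0 H s p1 p2 q1 q2"
  obtains p q u where "p \<in> {p1..p2}" "q \<in> {q1..q2}" "int_sol \<phi> H (ray p + q) p u"
    "res Plus u = 0" "res Minus u = 0"
proof -
  have \<phi>c: "continuous_on UNIV \<phi>" by (rule continuous_on_lipschitz_bound[OF L])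
  define sol where "sol z = (SOME u. int_sol \<phi> H (ray (fst z) + snd z) (fst z) u)" for z
  have sol: "int_sol \<phi> H (ray (fst z) + snd z) (fst z) (sol z)" for z
  proof -
    have "\<exists>u. int_sol \<phi> H (ray (fst z) + snd z) (fst z) u" by (rule int_sol_exists[OF L H])
    then show ?thesis unfolding sol_def by (rule someI_ex)
  qed
  have sg: "(p = p1 \<longrightarrow> s * res Plus (sol (p, q)) \<le> 0) \<and> (p = p2 \<longrightarrow> s * res Plus (sol (p, q)) \<ge> 0) \<and>
     (q = q1 \<longrightarrow> res Minus (sol (p, q)) \<le> 0) \<and> (q = q2 \<longrightarrow> res Minus (sol (p, q)) \<ge> 0)"
    if "p \<in> {p1..p2}" "q \<in> {q1..q2}" for p q
    using sides \<phi>c dev sol[of "(p, q)"] that unfolding box_signs_def fst_conv snd_conv by blast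
  let ?c = "\<lambda>z::real \<times> real. ray (fst z) + snd z"
  have cont: "continuous_on A (\<lambda>z. res \<sigma> (sol z))" for \<sigma> A
  proof (rule continuous_on_by_modulus[where K = "4 * exp (4 * (L + 1))" and g = ?c and h = fst])
    fix z z' :: "real \<times> real"
    let ?c1 = "\<bar>?c z - ?c z'\<bar>" and ?d1 = "\<bar>fst z - fst z'\<bar>"
    have "\<bar>res \<sigma> (sol z) - res \<sigma> (sol z')\<bar> \<le> 2 * ((?c1 + 2 * ?d1) * exp (4 * (L + 1)))"
      by (rule res_close, rule int_sol_lipschitz[OF sol sol L H])
    also have "\<dots> \<le> 2 * ((2 * (?c1 + ?d1)) * exp (4 * (L + 1)))"
      by (intro mult_left_mono mult_right_mono) auto
    finally show "\<bar>res \<sigma> (sol z) - res \<sigma> (sol z')\<bar> \<le> 4 * exp (4 * (L + 1)) * (?c1 + ?d1)"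
      by (simp add: algebra_simps)
  next
    show "continuous_on A ?c"
      by (intro continuous_on_add continuous_on_compose2[OF ray_cont[of UNIV]] continuous_on_fst
          continuous_on_snd continuous_on_id) auto
    show "continuous_on A fst" by (intro continuous_on_fst continuous_on_id)
  qed
  obtain p q where pq: "p \<in> {p1..p2}" "q \<in> {q1..q2}" "s * res Plus (sol (p, q)) = 0" "res Minus (sol (p, q)) = 0"
  proof (rule poincare_miranda[of p1 p2 q1 q2 "\<lambda>z. s * res Plus (sol z)" "\<lambda>z. res Minus (sol z)"])
    show "continuous_on ({p1..p2} \<times> {q1..q2}) (\<lambda>z. s * res Plus (sol z))"
      by (intro continuous_on_mult_left cont)
    show "s * res Plus (sol (p1, q)) \<le> 0 \<and> s * res Plus (sol (p2, q)) \<ge> 0" if "q \<in> {q1..q2}" for q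
      using sg[of p1 q] sg[of p2 q] le that by simp
    show "res Minus (sol (p, q1)) \<le> 0 \<and> res Minus (sol (p, q2)) \<ge> 0" if "p \<in> {p1..p2}" for p
      using sg[of p q1] sg[of p q2] le that by simp
  qed (use le cont in auto)
  show ?thesis
    using that[OF pq(1,2), of "sol (p, q)"] sol[of "(p, q)"] pq(3,4) s by simp
qed

text \<open>Every approximation satisfies the deviation bound with K0 + 1, hence the same sign
  conditions, and has a solution with data in the box. These solutions are uniformly bounded; a
  limit keeps its data in the closed box and its residuals at zero.\<close>

lemma box_solution:
  assumes f: "continuous_on UNIV f" and dev: "\<And>t. \<bar>f t - hl a b t\<bar> \<le> e * \<bar>t\<bar> + K0"
    and e: "0 \<le> e" "e \<le> 1" and K0: "0 \<le> K0"
    and H: "continuous_on {-1..1} H" and le: "p1 \<le> p2" "q1 \<le> q2" and s: "s \<noteq> 0"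
    and sides: "box_signs e (K0 + 1) H s p1 p2 q1 q2"
  obtains p q u where "p \<in> {p1..p2}" "q \<in> {q1..q2}" "int_sol f H (ray p + q) p u" "BC m \<alpha> \<eta> u"
proof -
  define good where "good n \<phi> p q u \<longleftrightarrow> continuous_on UNIV \<phi> \<and>
      (\<forall>t. \<bar>t\<bar> \<le> real n \<longrightarrow> \<bar>\<phi> t - f t\<bar> \<le> 1 / (real n + 1)) \<and>
      (\<forall>t. \<bar>\<phi> t - hl a b t\<bar> \<le> e * \<bar>t\<bar> + (K0 + 1)) \<and> p \<in> {p1..p2} \<and> q \<in> {q1..q2} \<and>
      int_sol \<phi> H (ray p + q) p u \<and> res Plus u = 0 \<and> res Minus u = 0" for n \<phi> p q u
  have "\<exists>\<phi> p q u. good n \<phi> p q u" for n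
  proof -
    obtain \<phi> L where \<phi>: "\<And>s t. \<bar>\<phi> s - \<phi> t\<bar> \<le> L * \<bar>s - t\<bar>"
      "\<And>t. \<bar>t\<bar> \<le> real n \<Longrightarrow> \<bar>\<phi> t - f t\<bar> \<le> 1 / (real n + 1)"
      "\<And>t. \<bar>\<phi> t - hl a b t\<bar> \<le> e * \<bar>t\<bar> + (K0 + 1)"
      by (rule lipschitz_approximation[OF f hl_lipschitz[OF a_pos b_pos] dev e(1), where n = n]) (rule that)
    have \<phi>c: "continuous_on UNIV \<phi>" by (rule continuous_on_lipschitz_bound[OF \<phi>(1)])
    have "\<forall>t. \<bar>t\<bar> \<le> real n \<longrightarrow> \<bar>\<phi> t - f t\<bar> \<le> 1 / (real n + 1)"
      "\<forall>t. \<bar>\<phi> t - hl a b t\<bar> \<le> e * \<bar>t\<bar> + (K0 + 1)" 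
      using \<phi>(2,3) by auto
    moreover obtain p q u where "p \<in> {p1..p2}" "q \<in> {q1..q2}" "int_sol \<phi> H (ray p + q) p u"
      "res Plus u = 0" "res Minus u = 0"
      by (rule lipschitz_box_solution[OF \<phi>(1,3) H le s sides])
    ultimately have "good n \<phi> p q u" unfolding good_def using \<phi>c by (intro conjI)
    then show ?thesis by (intro exI)
  qed
  then obtain \<phi> p q u where g: "\<And>n. good n (\<phi> n) (p n) (q n) (u n)" by metis
  have G: "continuous_on UNIV (\<phi> n)" "\<forall>t. \<bar>t\<bar> \<le> real n \<longrightarrow> \<bar>\<phi> n t - f t\<bar> \<le> 1 / (real n + 1)"
    "\<forall>t. \<bar>\<phi> n t - hl a b t\<bar> \<le> e * \<bar>t\<bar> + (K0 + 1)" "p n \<in> {p1..p2}" "q n \<in> {q1..q2}"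
    "int_sol (\<phi> n) H (ray (p n) + q n) (p n) (u n)" "res Plus (u n) = 0" "res Minus (u n) = 0" for n
    using g[of n] unfolding good_def by blast+
  have S: "\<forall>n. (p n, q n) \<in> {p1..p2} \<times> {q1..q2}" using G(4,5) by simp
  have "seq_compact ({p1..p2} \<times> {q1..q2})" by (intro compact_imp_seq_compact compact_Times compact_Icc)
  then obtain l r where l: "l \<in> {p1..p2} \<times> {q1..q2}" and r: "strict_mono (r :: nat \<Rightarrow> nat)"
    and lim: "((\<lambda>n. (p n, q n)) \<circ> r) \<longlonglongrightarrow> l"
    using S by (rule seq_compactE)
  have rn: "n \<le> r n" for n using r by (rule seq_suble)
  have lp: "(\<lambda>n. p (r n)) \<longlonglongrightarrow> fst l" and lq: "(\<lambda>n. q (r n)) \<longlonglongrightarrow> snd l"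
    using tendsto_fst[OF lim] tendsto_snd[OF lim] by (simp_all add: o_def)
  have "isCont ray (fst l)" using ray_cont[of UNIV] by (simp add: continuous_on_eq_continuous_at)
  then have lc: "(\<lambda>n. ray (p (r n)) + q (r n)) \<longlonglongrightarrow> ray (fst l) + snd l"
    using lp lq by (intro tendsto_add isCont_tendsto_compose[of _ ray])
  define h where "h = integral {-1..1} (\<lambda>s. \<bar>H s\<bar>)"
  obtain HB where HB: "\<And>x. x \<in> {-1..1} \<Longrightarrow> \<bar>H x\<bar> \<le> HB"
    using compact_imp_bounded[OF compact_continuous_image[OF H compact_Icc]]
    unfolding bounded_iff by (metis imageI real_norm_def)
  \<comment> \<open>N bounds the initial data over the whole box and M the solutions, both
    independently of n.\<close>
  define N where "N = (\<bar>slope Plus\<bar> + \<bar>slope Minus\<bar>) * (\<bar>p1\<bar> + \<bar>p2\<bar>) + (\<bar>q1\<bar> + \<bar>q2\<bar>) + (\<bar>p1\<bar> + \<bar>p2\<bar>)"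
  define M where "M = HB + 2 * EE * N + (2 * (a + b + 1) * h + 8 * e * EE * N + 4 * (K0 + 1)) * EE"
  have bd: "\<bar>u n x\<bar> \<le> M" if x: "x \<in> {-1..1}" for n x
  proof -
    have dv: "\<And>t. \<bar>\<phi> n t - hl a b t\<bar> \<le> e * \<bar>t\<bar> + (K0 + 1)" using G(3) by blast
    have P: "\<bar>p n\<bar> \<le> \<bar>p1\<bar> + \<bar>p2\<bar>" "\<bar>q n\<bar> \<le> \<bar>q1\<bar> + \<bar>q2\<bar>" using G(4,5)[of n] by auto
    have "\<bar>ray (p n)\<bar> \<le> (\<bar>slope Plus\<bar> + \<bar>slope Minus\<bar>) * (\<bar>p1\<bar> + \<bar>p2\<bar>)"
      using ray_bound[of "p n"] mult_left_mono[OF P(1), of "\<bar>slope Plus\<bar> + \<bar>slope Minus\<bar>"] by linarith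
    then have Nn: "\<bar>ray (p n) + q n\<bar> + \<bar>p n\<bar> \<le> N" unfolding N_def using P by linarith
    have "\<bar>(u n x - H x) - hsol (ray (p n) + q n) (p n) x\<bar> \<le>
        (2 * (a + b + 1) * h + 8 * e * EE * (\<bar>ray (p n) + q n\<bar> + \<bar>p n\<bar>) + 4 * (K0 + 1)) * EE"
      by (rule sol_compare(1)[OF G(6,1) H dv e _ _ x]) (use K0 in \<open>auto simp: h_def\<close>)
    also have "\<dots> \<le> (2 * (a + b + 1) * h + 8 * e * EE * N + 4 * (K0 + 1)) * EE"
    proof (rule mult_right_mono)
      have "8 * e * EE * (\<bar>ray (p n) + q n\<bar> + \<bar>p n\<bar>) \<le> 8 * e * EE * N"
        using Nn e EE by (intro mult_left_mono) auto
      then show "2 * (a + b + 1) * h + 8 * e * EE * (\<bar>ray (p n) + q n\<bar> + \<bar>p n\<bar>) + 4 * (K0 + 1)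
          \<le> 2 * (a + b + 1) * h + 8 * e * EE * N + 4 * (K0 + 1)" by linarith
    qed (use EE in simp)
    finally have "\<bar>(u n x - H x) - hsol (ray (p n) + q n) (p n) x\<bar> \<le> \<dots>" .
    moreover have "\<bar>hsol (ray (p n) + q n) (p n) x\<bar> \<le> 2 * EE * N"
      using hsol_bound[OF x, of "ray (p n) + q n" "p n"] mult_left_mono[OF Nn, of "2 * EE"] EE by linarith
    ultimately show ?thesis using HB[OF x] unfolding M_def by linarith
  qed
  have gr: "int_sol (\<phi> (r n)) H (ray (p (r n)) + q (r n)) (p (r n)) (u (r n))" "continuous_on UNIV (\<phi> (r n))" for n
    by (rule G(6), rule G(1))
  have ap: "\<bar>\<phi> (r n) t - f t\<bar> \<le> 1 / (real n + 1)" if "\<bar>t\<bar> \<le> real n" for n t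
  proof -
    have "real n \<le> real (r n)" using rn[of n] by simp
    then have "\<bar>\<phi> (r n) t - f t\<bar> \<le> 1 / (real (r n) + 1)" using G(2)[of "r n"] that by (meson order_trans)
    also have "\<dots> \<le> 1 / (real n + 1)" using \<open>real n \<le> real (r n)\<close> by (intro divide_left_mono) auto
    finally show ?thesis .
  qed
  have gw: "\<bar>\<phi> (r n) t\<bar> \<le> (e + (a + b)) * \<bar>t\<bar> + (K0 + 1)" for n t
  proof -
    have "\<bar>\<phi> (r n) t - hl a b t\<bar> \<le> e * \<bar>t\<bar> + (K0 + 1)" using G(3) by blast
    moreover have "\<bar>hl a b t\<bar> \<le> (a + b) * \<bar>t\<bar>"
      using hl_lipschitz[OF a_pos b_pos, of t 0] by (simp add: hl_def)
    ultimately show ?thesis unfolding distrib_right by linarith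
  qed
  have A: "e + (a + b) \<ge> 0" using e a_pos b_pos by simp
  obtain U k where U: "int_sol f H (ray (fst l) + snd l) (fst l) U" and k: "strict_mono (k :: nat \<Rightarrow> nat)"
    and pw: "\<And>x. x \<in> {-1..1} \<Longrightarrow> (\<lambda>n. u (r (k n)) x) \<longlonglongrightarrow> U x"
    by (rule int_sol_limit[where u = "\<lambda>n. u (r n)" and \<phi> = "\<lambda>n. \<phi> (r n)", OF gr f H ap gw A lc lp bd];
        (assumption | (rule that; assumption)))
  have "res \<sigma> U = 0" for \<sigma>
  proof -
    have "(\<lambda>n. res \<sigma> (u (r (k n)))) \<longlonglongrightarrow> res \<sigma> U"
      unfolding res_def by (intro tendsto_diff tendsto_sum tendsto_mult_left pw sval_in eta_in)
    moreover have "res \<sigma> (u (r (k n))) = 0" for n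
      using G(7,8) by (cases \<sigma>) simp_all
    ultimately have "(\<lambda>n. 0) \<longlonglongrightarrow> res \<sigma> U" by simp
    then show ?thesis by (simp add: LIMSEQ_const_iff)
  qed
  then have "BC m \<alpha> \<eta> U" by (simp add: BC_iff_res)
  moreover have "fst l \<in> {p1..p2}" "snd l \<in> {q1..q2}" using l by (simp_all add: mem_Times_iff)
  ultimately show ?thesis using U by (intro that)
qed

text \<open>A cubic ramp from 0 to 1 on the last stretch of length d before 1. It misses -1 and all
  points \<eta> \<sigma> i, the third power makes its second derivative continuous, and its integral
  is at most d.\<close>

lemma localized_bump:
  assumes \<delta>: "\<delta> > 0"
  obtains \<zeta> w where "continuous_on {-1..1} \<zeta>" "continuous_on {-1..1} w"
    "\<And>x. x \<in> {-1..1} \<Longrightarrow> int2 w x = \<zeta> x" "res Plus \<zeta> = 1" "res Minus \<zeta> = 0"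
    "integral {-1..1} (\<lambda>s. \<bar>\<zeta> s\<bar>) \<le> \<delta>"
proof -
  \<comment> \<open>Adding 0 makes the set nonempty and its maximum nonnegative, so the ramp stays
    away from -1 as well.\<close>
  define E where "E = insert 0 ((\<Union>\<sigma>\<in>{Plus, Minus}. \<eta> \<sigma> ` {1..m \<sigma>}))"
  have fE: "finite E" "E \<noteq> {}" by (auto simp: E_def)
  have E1: "t < 1" if "t \<in> E" for t using that \<eta> by (force simp: E_def)
  define e where "e = Max E"
  have e: "e < 1" "0 \<le> e" using Max_in[OF fE] E1 Max_ge[OF fE(1), of 0] by (auto simp: e_def E_def)
  have eE: "\<eta> \<sigma> i \<le> e" if "i \<in> {1..m \<sigma>}" for \<sigma> i
    unfolding e_def using that by (intro Max_ge[OF fE(1)]) (cases \<sigma>; auto simp: E_def)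
  define d where "d = min \<delta> (1 - e)"
  have d: "d > 0" "d \<le> \<delta>" "e \<le> 1 - d" using \<delta> e by (auto simp: d_def)
  define \<zeta> where "\<zeta> x = (if x \<le> 1 - d then 0 else ((x - (1 - d)) / d) ^ 3)" for x
  define v where "v x = (if x \<le> 1 - d then 0 else 3 * ((x - (1 - d)) / d) ^ 2 / d)" for x
  define w where "w x = (if x \<le> 1 - d then 0 else 6 * ((x - (1 - d)) / d) / d / d)" for x
  define w' where "w' x = (if x \<le> 1 - d then 0 else 6 / d / d / d)" for x
  have \<zeta>d: "(\<zeta> has_real_derivative v x) (at x)" for x
    unfolding \<zeta>_def v_def using d(1) by (intro DERIV_glue) (auto intro!: derivative_eq_intros)
  have vd: "(v has_real_derivative w x) (at x)" for x
    unfolding v_def w_def using d(1) by (intro DERIV_glue) (auto intro!: derivative_eq_intros)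
  have wc: "continuous_on A w" for A
  proof -
    have "w = (\<lambda>x. 6 * (max 0 (x - (1 - d)) / d) / d / d)" by (auto simp: w_def fun_eq_iff max_def)
    then show ?thesis using d(1) by (auto intro!: continuous_intros)
  qed
  have \<zeta>c: "continuous_on A \<zeta>" for A
    using \<zeta>d by (meson DERIV_isCont continuous_at_imp_continuous_on)
  have zero: "\<zeta> x = 0" if "x \<le> e" for x using that d by (simp add: \<zeta>_def)
  have one: "\<zeta> 1 = 1" using d by (simp add: \<zeta>_def)
  have sum0: "(\<Sum>i=1..m \<sigma>. \<alpha> \<sigma> i * \<zeta> (\<eta> \<sigma> i)) = 0" for \<sigma>
    by (rule sum.neutral) (use eE zero in auto)
  have i2: "int2 w x = \<zeta> x" if x: "x \<in> {-1..1}" for x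
  proof -
    have "\<zeta> x = \<zeta> (-1) + v (-1) * (x + 1) + int2 w x"
      by (rule taylor_int2[OF _ _ wc x]) (rule has_field_derivative_at_within, rule \<zeta>d vd)+
    moreover have "v (-1) = 0" "\<zeta> (-1) = 0" using d e by (auto simp: v_def \<zeta>_def)
    ultimately show ?thesis by simp
  qed
  have r1: "res Plus \<zeta> = 1" using sum0[of Plus] one by (simp add: res_def)
  have r2: "res Minus \<zeta> = 0" using sum0[of Minus] zero[of "-1"] e by (simp add: res_def)
  have bd: "\<bar>\<zeta> s\<bar> \<le> 1" if "s \<le> 1" for s
  proof (cases "s \<le> 1 - d")
    case False
    then have "0 \<le> (s - (1 - d)) / d" "(s - (1 - d)) / d \<le> 1" using d that by (auto simp: divide_le_eq)
    then show ?thesis using False by (simp add: \<zeta>_def power_le_one)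
  qed (simp add: \<zeta>_def)
  have ac: "(\<lambda>s. \<bar>\<zeta> s\<bar>) integrable_on {x..y}" for x y
    by (intro integrable_continuous_real continuous_on_rabs \<zeta>c)
  have "integral {-1..1} (\<lambda>s. \<bar>\<zeta> s\<bar>) = integral {-1..1-d} (\<lambda>s. \<bar>\<zeta> s\<bar>) + integral {1-d..1} (\<lambda>s. \<bar>\<zeta> s\<bar>)"
    by (rule Henstock_Kurzweil_Integration.integral_combine[symmetric]) (use d e ac in auto)
  also have "integral {-1..1-d} (\<lambda>s. \<bar>\<zeta> s\<bar>) = integral {-1..1-d} (\<lambda>s. 0)"
    by (rule Henstock_Kurzweil_Integration.integral_cong) (simp add: \<zeta>_def)
  also have "integral {1-d..1} (\<lambda>s. \<bar>\<zeta> s\<bar>) \<le> integral {1-d..1} (\<lambda>s. 1)"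
    by (rule integral_le[OF ac]) (use bd in auto)
  finally have "integral {-1..1} (\<lambda>s. \<bar>\<zeta> s\<bar>) \<le> \<delta>" using d by simp
  then show ?thesis using that[OF \<zeta>c wc i2 r1 r2] by blast
qed

end

text \<open>The error budget is \<mu> R/2: one quarter of \<mu> R for the part proportional to the
  data, one quarter for the rest.\<close>

lemma small_error:
  fixes K :: real
  assumes "0 < \<mu>" "1 \<le> K" "0 \<le> e" "e \<le> \<mu> / (8 * K)" "\<bar>p\<bar> \<le> R" "\<bar>q\<bar> \<le> R" "X \<le> \<mu> * R / 4"
  shows "K * (e * (\<bar>p\<bar> + \<bar>q\<bar>)) + X \<le> \<mu> * R / 2"
proof -
  have "e * (\<bar>p\<bar> + \<bar>q\<bar>) \<le> \<mu> / (8 * K) * (2 * R)" using assms by (intro mult_mono) auto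
  then have "K * (e * (\<bar>p\<bar> + \<bar>q\<bar>)) \<le> K * (\<mu> / (8 * K) * (2 * R))"
    using assms(2) by (intro mult_left_mono) auto
  also have "\<dots> = \<mu> * R / 4" using assms(2) by simp
  finally show ?thesis using assms(7) by linarith
qed

lemma signed_bounds:
  fixes s :: real
  assumes "s = 1 \<or> s = -1" "\<bar>x - y\<bar> \<le> B"
  shows "s * x \<le> s * y + B" "s * y - B \<le> s * x"
  using assms by auto

section \<open>Choice of boxes and forcing terms\<close>

context bvp
begin

lemma kP_kM_pos: "end_residual Plus * end_residual Minus < 0 \<Longrightarrow> kP * kM > 0"
  and kP_kM_neg: "end_residual Plus * end_residual Minus > 0 \<Longrightarrow> kP * kM < 0"
proof -
  have "kP * kM = (end_residual Plus * end_residual Minus) / (C (ph Plus) * C (ph Minus))" by (simp add: kP_def kM_def)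
  moreover have "C (ph Plus) * C (ph Minus) < 0" using C_ph by (simp add: mult_pos_neg)
  ultimately show "end_residual Plus * end_residual Minus < 0 \<Longrightarrow> kP * kM > 0" "end_residual Plus * end_residual Minus > 0 \<Longrightarrow> kP * kM < 0"
    by (simp_all add: divide_neg_neg divide_pos_neg)
qed

text \<open>The forcing J times the ramp shifts the right residual by J and leaves the left one
  alone, at a cost of only |J| \<delta> in the integral that enters the comparison.\<close>

lemma impulse:
  assumes \<delta>: "\<delta> > 0"
  obtains h where "h \<in> L1" "continuous_on {-1..1} (\<lambda>x. - int2 h x)"
    "res Plus (\<lambda>x. - int2 h x) = J" "res Minus (\<lambda>x. - int2 h x) = 0"
    "integral {-1..1} (\<lambda>s. \<bar>- int2 h s\<bar>) \<le> \<bar>J\<bar> * \<delta>"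
proof -
  obtain \<zeta> w where z: "continuous_on {-1..1} \<zeta>" "continuous_on {-1..1} w"
    "\<And>x. x \<in> {-1..1} \<Longrightarrow> int2 w x = \<zeta> x" "res Plus \<zeta> = 1" "res Minus \<zeta> = 0"
    "integral {-1..1} (\<lambda>s. \<bar>\<zeta> s\<bar>) \<le> \<delta>"
    by (rule localized_bump[OF \<delta>]) (rule that)
  define h where "h s = - J * w s" for s
  have hw: "h = (\<lambda>s. - J * w s)" by (rule ext) (simp add: h_def)
  have hL: "h absolutely_integrable_on {-1..1}"
    unfolding h_def by (intro L1_continuous continuous_on_mult_left z)
  have i: "- int2 h x = J * \<zeta> x" if "x \<in> {-1..1}" for x
    unfolding hw int2_scale z(3)[OF that] by simp
  have r: "res \<sigma> (\<lambda>x. - int2 h x) = J * res \<sigma> \<zeta>" for \<sigma>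
    unfolding res_scale[symmetric] by (rule res_cong) (rule i)
  have "integral {-1..1} (\<lambda>s. \<bar>- int2 h s\<bar>) = integral {-1..1} (\<lambda>s. \<bar>J\<bar> * \<bar>\<zeta> s\<bar>)"
    by (rule Henstock_Kurzweil_Integration.integral_cong) (simp only: i abs_mult)
  also have "\<dots> = \<bar>J\<bar> * integral {-1..1} (\<lambda>s. \<bar>\<zeta> s\<bar>)" by simp
  also have "\<dots> \<le> \<bar>J\<bar> * \<delta>" using z(6) by (intro mult_left_mono) auto
  finally have 5: "integral {-1..1} (\<lambda>s. \<bar>- int2 h s\<bar>) \<le> \<bar>J\<bar> * \<delta>" .
  show ?thesis
    by (rule that[OF _ _ _ _ 5])
       (simp_all only: L1_iff hL r z continuous_on_minus[OF continuous_on_int2[OF hL]] mult_1_right mult_zero_right)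
qed

text \<open>The box is |p| \<le> R, |q| \<le> \<eta>1 R. On its ends p = -R and p = R the right
  residual is of order \<gamma> R with opposite signs, since kP and kM have equal sign; on the other
  two sides the left residual is of order \<kappa> \<eta>1 R. The factor s orients the first
  pair.\<close>

lemma solvable:
  assumes f: "continuous_on UNIV f"
    and dev: "\<forall>e>0. \<exists>K0\<ge>0. \<forall>s. \<bar>f s - hl a b s\<bar> \<le> e * \<bar>s\<bar> + K0"
    and H: "continuous_on {-1..1} H" and sgn: "end_residual Plus * end_residual Minus < 0"
  shows "\<exists>c d u. int_sol f H c d u \<and> BC m \<alpha> \<eta> u"
proof -
  obtain K where "comparison_const K" using comparison_const_exists by blast
  note K = comparison_constD[OF this]
  have kk: "kP * kM > 0" using kP_kM_pos[OF sgn] .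
  obtain s where s: "s = 1 \<or> s = -1" "s * kP = \<bar>kP\<bar>" "s * kM = \<bar>kM\<bar>"
  proof (cases "kP > 0")
    case True
    then show ?thesis using that[of 1] kk by (simp add: zero_less_mult_iff)
  next
    case False
    then show ?thesis using that[of "-1"] kk by (simp add: zero_less_mult_iff)
  qed
  define \<gamma> where "\<gamma> = min \<bar>kP\<bar> \<bar>kM\<bar>"
  have \<gamma>: "\<gamma> > 0" "\<gamma> \<le> \<bar>kP\<bar>" "\<gamma> \<le> \<bar>kM\<bar>" using kk by (auto simp: \<gamma>_def)
  \<comment> \<open>The box is flat enough that q changes the right residual by at most \<gamma>
    R/4.\<close>
  define \<eta>1 where "\<eta>1 = min 1 (\<gamma> / (4 * K))"
  have \<eta>1: "0 < \<eta>1" "\<eta>1 \<le> 1" "K * \<eta>1 \<le> \<gamma> / 4"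
  proof -
    show "0 < \<eta>1" "\<eta>1 \<le> 1" using \<gamma> K(1) by (auto simp: \<eta>1_def)
    have "K * \<eta>1 \<le> K * (\<gamma> / (4 * K))" using K(1) by (intro mult_left_mono) (auto simp: \<eta>1_def)
    then show "K * \<eta>1 \<le> \<gamma> / 4" using K(1) by simp
  qed
  \<comment> \<open>On the sides |q| = \<eta>1 R the data lie in the cone |p| \<le> |q| / \<eta>1,
    where the left residual has a linear lower bound.\<close>
  have "1 / \<eta>1 \<ge> 0" using \<eta>1 by simp
  then obtain \<kappa> where \<kappa>: "\<kappa> > 0"
    "\<And>p q. \<bar>p\<bar> \<le> 1 / \<eta>1 * \<bar>q\<bar> \<Longrightarrow> q \<ge> 0 \<Longrightarrow> F Minus (ray p + q) p \<ge> \<kappa> * q"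
    "\<And>p q. \<bar>p\<bar> \<le> 1 / \<eta>1 * \<bar>q\<bar> \<Longrightarrow> q \<le> 0 \<Longrightarrow> F Minus (ray p + q) p \<le> \<kappa> * q"
    by (rule F_minus_lower) (rule that)
  \<comment> \<open>The smaller of the two margins per unit of R; e is then fixed relative to
    it.\<close>
  define \<mu> where "\<mu> = min \<gamma> (\<kappa> * \<eta>1)"
  have \<mu>: "\<mu> > 0" "\<mu> \<le> \<gamma>" "\<mu> \<le> \<kappa> * \<eta>1" using \<gamma> \<kappa> \<eta>1 by (auto simp: \<mu>_def)
  define e where "e = min 1 (\<mu> / (8 * K))"
  have e: "e > 0" "e \<le> 1" "e \<le> \<mu> / (8 * K)" using \<mu> K(1) by (auto simp: e_def)
  obtain K0 where K0: "K0 \<ge> 0" "\<And>s. \<bar>f s - hl a b s\<bar> \<le> e * \<bar>s\<bar> + K0" using dev e(1) by blast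
  define h where "h = integral {-1..1} (\<lambda>s. \<bar>H s\<bar>)"
  have h0: "h \<ge> 0" unfolding h_def
    by (intro integral_nonneg integrable_continuous_real continuous_on_rabs H) auto
  define Bd where "Bd = \<bar>res Plus H\<bar> + \<bar>res Minus H\<bar>"
  have Bd: "\<bar>res \<sigma> H\<bar> \<le> Bd" for \<sigma> by (cases \<sigma>) (auto simp: Bd_def)
  define X where "X = K * (h + (K0 + 1)) + Bd"
  have "X \<ge> 0" unfolding X_def Bd_def using K(1) h0 K0 by simp
  \<comment> \<open>X collects the errors that do not grow with the data; a large box makes them at
    most \<mu> R/4.\<close>
  define R where "R = 4 * X / \<mu> + 1"
  have R: "R > 0" "X \<le> \<mu> * R / 4"
  proof -
    show "R > 0" unfolding R_def using \<open>X \<ge> 0\<close> \<mu> by (intro add_nonneg_pos) auto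
    have "\<mu> * R / 4 = X + \<mu> / 4" unfolding R_def using \<mu> by (simp add: field_simps)
    then show "X \<le> \<mu> * R / 4" using \<mu> by linarith
  qed
  have \<mu>R: "\<mu> * R \<le> \<gamma> * R" "\<mu> * R \<le> \<kappa> * (\<eta>1 * R)"
    using mult_right_mono[OF \<mu>(2), of R] mult_right_mono[OF \<mu>(3), of R] R by (auto simp: mult.assoc)
  have \<eta>R: "0 \<le> \<eta>1 * R" "\<eta>1 * R \<le> R" using \<eta>1 R by (auto simp: mult_left_le_one_le)
  have sides: "box_signs e (K0 + 1) H s (- R) R (- (\<eta>1 * R)) (\<eta>1 * R)"
    unfolding box_signs_def
  proof (intro allI impI)
    fix \<phi> p q u
    assume as: "continuous_on UNIV \<phi>" "\<forall>t. \<bar>\<phi> t - hl a b t\<bar> \<le> e * \<bar>t\<bar> + (K0 + 1)"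
      "int_sol \<phi> H (ray p + q) p u" "p \<in> {-R..R}" "q \<in> {- (\<eta>1 * R)..\<eta>1 * R}"
    have pq: "\<bar>p\<bar> \<le> R" "\<bar>q\<bar> \<le> \<eta>1 * R" using as(4,5) by auto
    have qR: "\<bar>q\<bar> \<le> R" using pq \<eta>R by linarith
    have err: "\<bar>res \<sigma> u - F \<sigma> (ray p + q) p\<bar> \<le> \<mu> * R / 2" for \<sigma>
    proof -
      have "\<bar>res \<sigma> u - res \<sigma> H - F \<sigma> (ray p + q) p\<bar> \<le> K * (e * (\<bar>p\<bar> + \<bar>q\<bar>) + h + (K0 + 1))"
        by (rule K(2)[OF as(3,1) H]) (use as(2) e K0 in \<open>auto simp: h_def\<close>)
      also have "\<dots> = K * (e * (\<bar>p\<bar> + \<bar>q\<bar>)) + K * (h + (K0 + 1))" by (simp add: distrib_left)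
      finally have "\<bar>res \<sigma> u - F \<sigma> (ray p + q) p\<bar> \<le> K * (e * (\<bar>p\<bar> + \<bar>q\<bar>)) + X"
        using Bd[of \<sigma>] unfolding X_def by linarith
      also have "\<dots> \<le> \<mu> * R / 2"
        by (rule small_error) (use \<mu> K(1) e pq qR R in auto)
      finally show ?thesis .
    qed
    have Kq: "K * \<bar>q\<bar> \<le> \<gamma> / 4 * R"
    proof -
      have "K * \<bar>q\<bar> \<le> K * (\<eta>1 * R)" using pq K(1) by (intro mult_left_mono) auto
      also have "\<dots> \<le> \<gamma> / 4 * R" using mult_right_mono[OF \<eta>1(3), of R] R by (simp add: mult.assoc)
      finally show ?thesis .
    qed
    have FP: "\<bar>F Plus (ray p + q) p - hl kP kM p\<bar> \<le> \<gamma> / 4 * R"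
      using K(3)[of Plus p q] Kq unfolding F_ray by linarith
    note sb = signed_bounds[OF s(1) err[of Plus]] signed_bounds[OF s(1) FP]
    have 1: "s * res Plus u \<le> 0" if "p = - R"
    proof -
      have "s * hl kP kM p = - (\<bar>kM\<bar> * R)" using that R s(3) by (simp add: hl_def flip: mult.assoc)
      moreover have "\<gamma> * R \<le> \<bar>kM\<bar> * R" using \<gamma> R by (intro mult_right_mono) auto
      ultimately show ?thesis using sb \<mu>R R \<gamma> mult_pos_pos[OF \<gamma>(1) R(1)] by linarith
    qed
    have 2: "s * res Plus u \<ge> 0" if "p = R"
    proof -
      have "s * hl kP kM p = \<bar>kP\<bar> * R" using that R s(2) by (simp add: hl_def flip: mult.assoc)
      moreover have "\<gamma> * R \<le> \<bar>kP\<bar> * R" using \<gamma> R by (intro mult_right_mono) auto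
      ultimately show ?thesis using sb \<mu>R R \<gamma> mult_pos_pos[OF \<gamma>(1) R(1)] by linarith
    qed
    have pM: "\<bar>p\<bar> \<le> 1 / \<eta>1 * \<bar>q\<bar>" if "\<bar>q\<bar> = \<eta>1 * R" using pq that \<eta>1 by simp
    have \<mu>Rp: "\<mu> * R > 0" using \<mu> R by simp
    have 3: "res Minus u \<le> 0" if "q = - (\<eta>1 * R)"
    proof -
      have "F Minus (ray p + q) p \<le> \<kappa> * q" using that \<eta>R by (intro \<kappa>(3) pM) auto
      moreover have "\<kappa> * q = - (\<kappa> * (\<eta>1 * R))" unfolding that by simp
      ultimately show ?thesis using err[of Minus] \<mu>R(2) \<mu>Rp by linarith
    qed
    have 4: "res Minus u \<ge> 0" if "q = \<eta>1 * R"
    proof -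
      have "F Minus (ray p + q) p \<ge> \<kappa> * q" using that \<eta>R by (intro \<kappa>(2) pM) auto
      moreover have "\<kappa> * q = (\<kappa> * (\<eta>1 * R))" unfolding that by simp
      ultimately show ?thesis using err[of Minus] \<mu>R(2) \<mu>Rp by linarith
    qed
    show "(p = - R \<longrightarrow> s * res Plus u \<le> 0) \<and> (p = R \<longrightarrow> s * res Plus u \<ge> 0) \<and>
      (q = - (\<eta>1 * R) \<longrightarrow> res Minus u \<le> 0) \<and> (q = \<eta>1 * R \<longrightarrow> res Minus u \<ge> 0)"
      using 1 2 3 4 by blast
  qed
  have "- R \<le> R" "- (\<eta>1 * R) \<le> \<eta>1 * R" "s \<noteq> 0" using R \<eta>R s by auto
  then obtain p q u where "int_sol f H (ray p + q) p u" "BC m \<alpha> \<eta> u"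
    using box_solution[OF f K0(2) _ e(2) K0(1) H _ _ _ sides] e by (metis less_imp_le)
  then show ?thesis by blast
qed

text \<open>When kP and kM have opposite signs, the values kP p for p > 0 and kM p for p < 0 have
  the same sign; \<gamma> is the smaller modulus.\<close>

lemma opposite_ray_values:
  assumes sgn: "end_residual Plus * end_residual Minus > 0"
  obtains s \<gamma> where "s = 1 \<or> s = -1" "\<gamma> > 0" "\<And>p. s * hl kP kM p \<ge> \<gamma> * \<bar>p\<bar>"
proof -
  have kk: "kP * kM < 0" using kP_kM_neg[OF sgn] .
  obtain s where s: "s = 1 \<or> s = -1" "s * kP = \<bar>kP\<bar>" "s * kM = - \<bar>kM\<bar>"
  proof (cases "kP > 0")
    case True
    then show ?thesis using that[of 1] kk by (simp add: mult_less_0_iff)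
  next
    case False
    then show ?thesis using that[of "-1"] kk by (simp add: mult_less_0_iff)
  qed
  define \<gamma> where "\<gamma> = min \<bar>kP\<bar> \<bar>kM\<bar>"
  have \<gamma>: "\<gamma> > 0" "\<gamma> \<le> \<bar>kP\<bar>" "\<gamma> \<le> \<bar>kM\<bar>" using kk by (auto simp: \<gamma>_def)
  have hlp: "s * hl kP kM p \<ge> \<gamma> * \<bar>p\<bar>" for p
  proof (cases "p \<ge> 0")
    case True
    then have "s * hl kP kM p = \<bar>kP\<bar> * \<bar>p\<bar>" using s(2) by (simp add: hl_def flip: mult.assoc)
    then show ?thesis using mult_right_mono[OF \<gamma>(2), of "\<bar>p\<bar>"] by simp
  next
    case False
    then have "s * hl kP kM p = \<bar>kM\<bar> * \<bar>p\<bar>" using s(3) by (simp add: hl_def flip: mult.assoc)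
    then show ?thesis using mult_right_mono[OF \<gamma>(3), of "\<bar>p\<bar>"] by simp
  qed
  show ?thesis by (rule that[OF s(1) \<gamma>(1) hlp])
qed

text \<open>The shift s R has the sign of the right residual on the rays and reinforces it. All data
  have to be excluded, so there is no box; instead the errors are compared with |d| near the rays
  and with |q| away from them.\<close>

lemma no_solution:
  assumes f: "continuous_on UNIV f"
    and dev: "\<forall>e>0. \<exists>K0\<ge>0. \<forall>s. \<bar>f s - hl a b s\<bar> \<le> e * \<bar>s\<bar> + K0"
    and sgn: "end_residual Plus * end_residual Minus > 0"
  obtains h where "h \<in> L1" "\<And>c d u. int_sol f (\<lambda>x. - int2 h x) c d u \<Longrightarrow> \<not> BC m \<alpha> \<eta> u"
proof -
  obtain K where "comparison_const K" using comparison_const_exists by blast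
  note K = comparison_constD[OF this]
  obtain s \<gamma> where s: "s = 1 \<or> s = -1" and \<gamma>: "\<gamma> > 0" and hlp: "\<And>p. s * hl kP kM p \<ge> \<gamma> * \<bar>p\<bar>"
    by (rule opposite_ray_values[OF sgn]) (rule that)
  define \<eta>1 where "\<eta>1 = min 1 (\<gamma> / (4 * K))"
  have \<eta>1: "0 < \<eta>1" "\<eta>1 \<le> 1" "K * \<eta>1 \<le> \<gamma> / 4"
  proof -
    show "0 < \<eta>1" "\<eta>1 \<le> 1" using \<gamma> K(1) by (auto simp: \<eta>1_def)
    have "K * \<eta>1 \<le> K * (\<gamma> / (4 * K))" using K(1) by (intro mult_left_mono) (auto simp: \<eta>1_def)
    then show "K * \<eta>1 \<le> \<gamma> / 4" using K(1) by simp
  qed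
  define M where "M = 1 / \<eta>1"
  have M: "M \<ge> 0" using \<eta>1 by (simp add: M_def)
  then obtain \<kappa> where \<kappa>: "\<kappa> > 0"
    "\<And>p q. \<bar>p\<bar> \<le> M * \<bar>q\<bar> \<Longrightarrow> q \<ge> 0 \<Longrightarrow> F Minus (ray p + q) p \<ge> \<kappa> * q"
    "\<And>p q. \<bar>p\<bar> \<le> M * \<bar>q\<bar> \<Longrightarrow> q \<le> 0 \<Longrightarrow> F Minus (ray p + q) p \<le> \<kappa> * q"
    by (rule F_minus_lower) (rule that)
  \<comment> \<open>The second entry serves near the rays, against the margin \<gamma> |d|; the
    third serves in the cone |d| \<le> M |q|, against \<kappa> |q|.\<close>
  define e where "e = min 1 (min (\<gamma> / (8 * K)) (\<kappa> / (2 * K * (1 + M))))"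
  have e: "e > 0" "e \<le> 1" "e \<le> \<gamma> / (8 * K)" "e \<le> \<kappa> / (2 * K * (1 + M))"
    using \<gamma> \<kappa> K(1) M by (auto simp: e_def)
  obtain K0 where K0: "K0 \<ge> 0" "\<And>s. \<bar>f s - hl a b s\<bar> \<le> e * \<bar>s\<bar> + K0" using dev e(1) by blast
  \<comment> \<open>In the cone the left condition gives |q| \<le> (2K/\<kappa>) Y; inserted into
    the bound for the right residual, this yields Q Y.\<close>
  define Q where "Q = (K * (1 + M) + \<kappa>) * (2 * K / \<kappa>) + K"
  have Q: "Q \<ge> K" "Q > 0"
  proof -
    have "(K * (1 + M) + \<kappa>) * (2 * K / \<kappa>) \<ge> 0" using K(1) M \<kappa>(1) by (intro mult_nonneg_nonneg add_nonneg_nonneg) auto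
    then show "Q \<ge> K" "Q > 0" unfolding Q_def using K(1) by linarith+
  qed
  \<comment> \<open>With the R chosen next, Q R \<delta> = R/4 and Q K0 = (R - 1)/4; so Q Y < R/2
    although the forcing grows with R.\<close>
  define \<delta> where "\<delta> = 1 / (4 * Q)"
  have \<delta>: "\<delta> > 0" using Q by (simp add: \<delta>_def)
  define R where "R = 4 * Q * K0 + 1"
  have R: "R \<ge> 1" unfolding R_def using Q K0 by simp
  define Y where "Y = R * \<delta> + K0"
  have QY: "Q * Y < R / 2"
  proof -
    have "Q * (R * \<delta>) = R / 4" using Q by (simp add: \<delta>_def)
    moreover have "Q * K0 = (R - 1) / 4" by (simp add: R_def)
    ultimately have "Q * Y = R / 4 + (R - 1) / 4" 
      unfolding Y_def distrib_left by linarith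
    then show ?thesis by (simp add: field_simps)
  qed
  have Y0: "Y \<ge> 0" unfolding Y_def using R \<delta> K0 by simp
  have KY: "K * Y \<le> Q * Y" using Q(1) Y0 by (rule mult_right_mono)
  obtain h where h: "h \<in> L1" "continuous_on {-1..1} (\<lambda>x. - int2 h x)"
    "res Plus (\<lambda>x. - int2 h x) = s * R" "res Minus (\<lambda>x. - int2 h x) = 0"
    "integral {-1..1} (\<lambda>s. \<bar>- int2 h s\<bar>) \<le> \<bar>s * R\<bar> * \<delta>"
    by (rule impulse[OF \<delta>, where J = "s * R"]) (rule that)
  have sR: "\<bar>s * R\<bar> = R" "s * (s * R) = R" using s R by auto
  show ?thesis
  proof (rule that[OF h(1)])
    fix c d u assume u: "int_sol f (\<lambda>x. - int2 h x) c d u"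
    define q where "q = c - ray d"
    have u': "int_sol f (\<lambda>x. - int2 h x) (ray d + q) d u" using u by (simp add: q_def)
    have err: "\<bar>res \<sigma> u - res \<sigma> (\<lambda>x. - int2 h x) - F \<sigma> (ray d + q) d\<bar> \<le> K * (e * (\<bar>d\<bar> + \<bar>q\<bar>)) + K * Y" for \<sigma>
    proof -
      have "\<bar>res \<sigma> u - res \<sigma> (\<lambda>x. - int2 h x) - F \<sigma> (ray d + q) d\<bar> \<le> K * (e * (\<bar>d\<bar> + \<bar>q\<bar>) + R * \<delta> + K0)"
        by (rule K(2)[OF u' f h(2) K0(2)]) (use e K0 h(5) sR in auto)
      then show ?thesis by (simp add: Y_def distrib_left add.assoc)
    qed
    show "\<not> BC m \<alpha> \<eta> u"
    proof
      assume "BC m \<alpha> \<eta> u"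
      then have r0: "res Plus u = 0" "res Minus u = 0" by (auto simp: BC_iff_res)
      have eP: "\<bar>F Plus (ray d + q) d - (- (s * R))\<bar> \<le> K * (e * (\<bar>d\<bar> + \<bar>q\<bar>)) + K * Y"
        using err[of Plus] unfolding r0 h(3) by linarith
      have eM: "\<bar>F Minus (ray d + q) d\<bar> \<le> K * (e * (\<bar>d\<bar> + \<bar>q\<bar>)) + K * Y"
        using err[of Minus] unfolding r0 h(4) by linarith
      \<comment> \<open>Near the rays the shifted right residual keeps the sign s. Away from them a
        vanishing left residual makes |q| so small that the right residual of the half-linear
        problem cannot cancel the shift.\<close>
      show False
      proof (cases "\<bar>q\<bar> \<le> \<eta>1 * \<bar>d\<bar>")
        case True
        have "\<eta>1 * \<bar>d\<bar> \<le> \<bar>d\<bar>" using \<eta>1 by (simp add: mult_left_le_one_le)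
        then have qd: "\<bar>q\<bar> \<le> \<bar>d\<bar>" using True by linarith
        have "K * \<bar>q\<bar> \<le> K * (\<eta>1 * \<bar>d\<bar>)" using True K(1) by (intro mult_left_mono) auto
        also have "\<dots> \<le> \<gamma> / 4 * \<bar>d\<bar>" using mult_right_mono[OF \<eta>1(3), of "\<bar>d\<bar>"] by (simp add: mult.assoc)
        finally have "\<bar>F Plus (ray d + q) d - hl kP kM d\<bar> \<le> \<gamma> / 4 * \<bar>d\<bar>"
          using K(3)[of Plus d q] unfolding F_ray by linarith
        note s1 = signed_bounds(2)[OF s this]
        note s2 = signed_bounds[OF s eP]
        have "K * (e * (\<bar>d\<bar> + \<bar>q\<bar>)) + 0 \<le> \<gamma> * \<bar>d\<bar> / 2"
          by (rule small_error) (use \<gamma> K(1) e qd in auto)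
        moreover have "s * - (s * R) = - R" using sR(2) by simp
        moreover have "0 \<le> \<gamma> * \<bar>d\<bar>" using \<gamma> by simp
        ultimately show False using s1 s2 hlp[of d] KY QY R by linarith
      next
        case False
        have dq: "\<bar>d\<bar> \<le> M * \<bar>q\<bar>" using False \<eta>1 by (simp add: M_def field_simps)
        have lo: "\<kappa> * \<bar>q\<bar> \<le> \<bar>F Minus (ray d + q) d\<bar>"
        proof (cases "q \<ge> 0")
          case True
          then show ?thesis using \<kappa>(2)[OF dq True] by simp
        next
          case False
          then show ?thesis using \<kappa>(3)[OF dq] by simp
        qed
        have s3: "\<bar>d\<bar> + \<bar>q\<bar> \<le> (1 + M) * \<bar>q\<bar>" using dq by (simp add: distrib_right)
        have s4: "K * (e * (\<bar>d\<bar> + \<bar>q\<bar>)) \<le> \<kappa> / 2 * \<bar>q\<bar>"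
        proof -
          have "e * (\<bar>d\<bar> + \<bar>q\<bar>) \<le> \<kappa> / (2 * K * (1 + M)) * ((1 + M) * \<bar>q\<bar>)"
            using e s3 \<kappa>(1) K(1) M by (intro mult_mono) auto
          then have "K * (e * (\<bar>d\<bar> + \<bar>q\<bar>)) \<le> K * (\<kappa> / (2 * K * (1 + M)) * ((1 + M) * \<bar>q\<bar>))"
            using K(1) by (intro mult_left_mono) auto
          also have "\<dots> = \<kappa> / 2 * \<bar>q\<bar>"
          proof -
            have "K * (\<kappa> / (2 * K * n) * (n * x)) = \<kappa> / 2 * x" if "n \<noteq> 0" for n x :: real
              using that K(1) by (simp add: field_simps)
            moreover have "1 + M \<noteq> 0" using M by simp
            ultimately show ?thesis .
          qed
          finally show ?thesis .
        qed
        have q1: "\<kappa> / 2 * \<bar>q\<bar> \<le> K * Y" using lo eM s4 by linarith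
        have q2: "\<bar>q\<bar> \<le> 2 * K / \<kappa> * Y"
        proof -
          have "\<bar>q\<bar> = 2 / \<kappa> * (\<kappa> / 2 * \<bar>q\<bar>)" using \<kappa>(1) by simp
          also have "\<dots> \<le> 2 / \<kappa> * (K * Y)" using q1 \<kappa>(1) by (intro mult_left_mono) auto
          finally show ?thesis by simp
        qed
        have "\<bar>F Plus (ray d + q) d\<bar> \<le> K * ((1 + M) * \<bar>q\<bar>)"
          using K(4)[of Plus d q] mult_left_mono[OF s3, of K] K(1) by linarith
        then have "R \<le> K * ((1 + M) * \<bar>q\<bar>) + \<kappa> / 2 * \<bar>q\<bar> + K * Y"
          using eP s4 sR(1) by linarith
        also have "\<dots> \<le> (K * (1 + M) + \<kappa>) * \<bar>q\<bar> + K * Y"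
          using \<kappa>(1) by (simp add: algebra_simps)
        also have "\<dots> \<le> (K * (1 + M) + \<kappa>) * (2 * K / \<kappa> * Y) + K * Y"
          using q2 K(1) M \<kappa>(1) by (intro add_right_mono mult_left_mono) auto
        also have "\<dots> = Q * Y" by (simp add: Q_def algebra_simps)
        finally show False using QY R by linarith
      qed
    qed
  qed
qed

text \<open>A shift against the sign of the residual on the rays dominates for small |p| and is
  dominated for large |p|. So the right residual changes sign along each ray, and there is one box
  with p > 0 and one with p < 0.\<close>

lemma two_solutions:
  assumes f: "continuous_on UNIV f"
    and dev: "\<forall>e>0. \<exists>K0\<ge>0. \<forall>s. \<bar>f s - hl a b s\<bar> \<le> e * \<bar>s\<bar> + K0"
    and sgn: "end_residual Plus * end_residual Minus > 0"
  obtains h c1 d1 u1 c2 d2 u2 where "h \<in> L1"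
    "int_sol f (\<lambda>x. - int2 h x) c1 d1 u1" "BC m \<alpha> \<eta> u1"
    "int_sol f (\<lambda>x. - int2 h x) c2 d2 u2" "BC m \<alpha> \<eta> u2" "d2 < 0" "0 < d1"
proof -
  obtain K where "comparison_const K" using comparison_const_exists by blast
  note K = comparison_constD[OF this]
  obtain s \<gamma> where s: "s = 1 \<or> s = -1" and \<gamma>: "\<gamma> > 0" and hlp: "\<And>p. s * hl kP kM p \<ge> \<gamma> * \<bar>p\<bar>"
    by (rule opposite_ray_values[OF sgn]) (rule that)
  \<comment> \<open>K t \<le> \<gamma>/8 serves twice: it bounds the effect of |q| \<le> t R on the
    right residual, and that of p on the inner side |p| = t R.\<close>
  define t where "t = min 1 (\<gamma> / (8 * K))"
  have t: "0 < t" "t \<le> 1" "K * t \<le> \<gamma> / 8"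
  proof -
    show "0 < t" "t \<le> 1" using \<gamma> K(1) by (auto simp: t_def)
    have "K * t \<le> K * (\<gamma> / (8 * K))" using K(1) by (intro mult_left_mono) (auto simp: t_def)
    then show "K * t \<le> \<gamma> / 8" using K(1) by simp
  qed
  have "1 / t \<ge> 0" using t by simp
  then obtain \<kappa> where \<kappa>: "\<kappa> > 0"
    "\<And>p q. \<bar>p\<bar> \<le> 1 / t * \<bar>q\<bar> \<Longrightarrow> q \<ge> 0 \<Longrightarrow> F Minus (ray p + q) p \<ge> \<kappa> * q"
    "\<And>p q. \<bar>p\<bar> \<le> 1 / t * \<bar>q\<bar> \<Longrightarrow> q \<le> 0 \<Longrightarrow> F Minus (ray p + q) p \<le> \<kappa> * q"
    by (rule F_minus_lower) (rule that)
  define \<mu> where "\<mu> = min (\<gamma> / 4) (\<kappa> * t)"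
  have \<mu>: "\<mu> > 0" "\<mu> \<le> \<gamma> / 4" "\<mu> \<le> \<kappa> * t" using \<gamma> \<kappa> t by (auto simp: \<mu>_def)
  define e where "e = min 1 (\<mu> / (8 * K))"
  have e: "e > 0" "e \<le> 1" "e \<le> \<mu> / (8 * K)" using \<mu> K(1) by (auto simp: e_def)
  obtain K0 where K0: "K0 \<ge> 0" "\<And>s. \<bar>f s - hl a b s\<bar> \<le> e * \<bar>s\<bar> + K0" using dev e(1) by blast
  \<comment> \<open>The cost K |J| \<delta> of a shift with |J| = \<gamma> R/2 becomes \<mu> R/8;
    the choice of R keeps K (K0 + 1) below the same amount.\<close>
  define \<delta> where "\<delta> = \<mu> / (4 * K * \<gamma>)"
  have \<delta>: "\<delta> > 0" using \<mu> K(1) \<gamma> by (simp add: \<delta>_def)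
  define R where "R = 8 * K * (K0 + 1) / \<mu> + 1"
  have R: "R > 0" unfolding R_def using K(1) K0 \<mu> by (intro add_nonneg_pos) auto
  define X where "X = K * (\<gamma> / 2 * R * \<delta> + (K0 + 1))"
  have X: "X \<le> \<mu> * R / 4"
  proof -
    have "K * (\<gamma> / 2 * R * \<delta>) = \<mu> * R / 8" using K(1) \<gamma> by (simp add: \<delta>_def)
    moreover have "K * (K0 + 1) = \<mu> * R / 8 - \<mu> / 8" using \<mu> unfolding R_def by (simp add: field_simps)
    ultimately show ?thesis using \<mu> unfolding X_def distrib_left[of K "\<gamma> / 2 * R * \<delta>"] by linarith
  qed
  have \<mu>R: "\<mu> * R \<le> \<gamma> / 4 * R" "\<mu> * R \<le> \<kappa> * (t * R)"
    using mult_right_mono[OF \<mu>(2), of R] mult_right_mono[OF \<mu>(3), of R] R by (auto simp: mult.assoc)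
  have tR: "0 < t * R" "t * R \<le> R" using t R by (auto simp: mult_left_le_one_le)
  have \<mu>Rp: "\<mu> * R > 0" and \<gamma>Rp: "\<gamma> * R > 0" using \<mu> \<gamma> R by auto
  \<comment> \<open>Half of \<gamma> R lies between the half-linear residual on the inner side, at
    most \<gamma> R/4, and that on the outer side, at least 7 \<gamma> R/8, with room for the
    errors.\<close>
  define J where "J = - s * (\<gamma> / 2 * R)"
  have sJ: "s * J = - (\<gamma> / 2 * R)" "\<bar>J\<bar> = \<gamma> / 2 * R" using s \<gamma>Rp by (auto simp: J_def)
  obtain h where h: "h \<in> L1" "continuous_on {-1..1} (\<lambda>x. - int2 h x)"
    "res Plus (\<lambda>x. - int2 h x) = J" "res Minus (\<lambda>x. - int2 h x) = 0"
    "integral {-1..1} (\<lambda>s. \<bar>- int2 h s\<bar>) \<le> \<bar>J\<bar> * \<delta>"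
    by (rule impulse[OF \<delta>, where J = J]) (rule that)
  let ?H = "\<lambda>x. - int2 h x"
  have key: "(\<bar>p\<bar> = t * R \<longrightarrow> s * res Plus u \<le> 0) \<and> (\<bar>p\<bar> = R \<longrightarrow> s * res Plus u \<ge> 0) \<and>
      (q = - (t * R) \<longrightarrow> res Minus u \<le> 0) \<and> (q = t * R \<longrightarrow> res Minus u \<ge> 0)"
    if as: "continuous_on UNIV \<phi>" "\<forall>t. \<bar>\<phi> t - hl a b t\<bar> \<le> e * \<bar>t\<bar> + (K0 + 1)"
      "int_sol \<phi> ?H (ray p + q) p u" and pq: "\<bar>p\<bar> \<le> R" "\<bar>q\<bar> \<le> t * R" for \<phi> p q u
  proof -
    have qR: "\<bar>q\<bar> \<le> R" using pq tR by linarith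
    have err: "\<bar>res \<sigma> u - res \<sigma> ?H - F \<sigma> (ray p + q) p\<bar> \<le> \<mu> * R / 2" for \<sigma>
    proof -
      have "\<bar>res \<sigma> u - res \<sigma> ?H - F \<sigma> (ray p + q) p\<bar> \<le> K * (e * (\<bar>p\<bar> + \<bar>q\<bar>) + \<gamma> / 2 * R * \<delta> + (K0 + 1))"
        by (rule K(2)[OF as(3,1) h(2)]) (use as(2) e K0 h(5) sJ in auto)
      also have "\<dots> = K * (e * (\<bar>p\<bar> + \<bar>q\<bar>)) + X" by (simp add: X_def distrib_left)
      also have "\<dots> \<le> \<mu> * R / 2"
        by (rule small_error) (use \<mu> K(1) e pq qR X in auto)
      finally show ?thesis .
    qed
    have Kq: "K * \<bar>q\<bar> \<le> \<gamma> / 8 * R"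
    proof -
      have "K * \<bar>q\<bar> \<le> K * (t * R)" using pq K(1) by (intro mult_left_mono) auto
      also have "\<dots> \<le> \<gamma> / 8 * R" using mult_right_mono[OF t(3), of R] R by (simp add: mult.assoc)
      finally show ?thesis .
    qed
    have eP: "\<bar>res Plus u - (J + F Plus (ray p + q) p)\<bar> \<le> \<mu> * R / 2"
      using err[of Plus] unfolding h(3) by linarith
    have eM: "\<bar>res Minus u - F Minus (ray p + q) p\<bar> \<le> \<mu> * R / 2"
      using err[of Minus] unfolding h(4) by linarith
    have FP: "\<bar>F Plus (ray p + q) p - hl kP kM p\<bar> \<le> \<gamma> / 8 * R"
      using K(3)[of Plus p q] Kq unfolding F_ray by linarith
    note sb = signed_bounds[OF s eP, unfolded distrib_left sJ(1)]
    have 1: "s * res Plus u \<le> 0" if "\<bar>p\<bar> = t * R"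
    proof -
      have "K * \<bar>p\<bar> \<le> \<gamma> / 8 * R"
        using mult_right_mono[OF t(3), of R] R unfolding that by (simp add: mult.assoc)
      then have "\<bar>F Plus (ray p + q) p - 0\<bar> \<le> \<gamma> / 4 * R"
        using K(4)[of Plus p q] Kq unfolding distrib_left by linarith
      note signed_bounds[OF s this]
      then show ?thesis using sb \<mu>R(1) \<gamma>Rp by linarith
    qed
    have 2: "s * res Plus u \<ge> 0" if "\<bar>p\<bar> = R"
      using signed_bounds(2)[OF s FP] hlp[of p] sb \<mu>R(1) \<gamma>Rp unfolding that by linarith
    have pM: "\<bar>p\<bar> \<le> 1 / t * \<bar>q\<bar>" if "\<bar>q\<bar> = t * R" using pq that t by simp
    have 3: "res Minus u \<le> 0" if "q = - (t * R)"
    proof -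
      have "F Minus (ray p + q) p \<le> \<kappa> * q" using that tR by (intro \<kappa>(3) pM) auto
      moreover have "\<kappa> * q = - (\<kappa> * (t * R))" unfolding that by simp
      ultimately show ?thesis using eM \<mu>R(2) \<mu>Rp by linarith
    qed
    have 4: "res Minus u \<ge> 0" if "q = t * R"
    proof -
      have "F Minus (ray p + q) p \<ge> \<kappa> * q" using that tR by (intro \<kappa>(2) pM) auto
      moreover have "\<kappa> * q = (\<kappa> * (t * R))" unfolding that by simp
      ultimately show ?thesis using eM \<mu>R(2) \<mu>Rp by linarith
    qed
    show ?thesis using 1 2 3 4 by blast
  qed
  have e0: "0 \<le> e" using e by simp
  have q12: "- (t * R) \<le> t * R" using tR by simp
  have b1: "box_signs e (K0 + 1) ?H s (t * R) R (- (t * R)) (t * R)"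
    unfolding box_signs_def
  proof (intro allI impI)
    fix \<phi> p q u
    assume as: "continuous_on UNIV \<phi>" "\<forall>t. \<bar>\<phi> t - hl a b t\<bar> \<le> e * \<bar>t\<bar> + (K0 + 1)"
      "int_sol \<phi> ?H (ray p + q) p u" "p \<in> {t * R..R}" "q \<in> {- (t * R)..t * R}"
    have pq: "\<bar>p\<bar> = p" "\<bar>p\<bar> \<le> R" "\<bar>q\<bar> \<le> t * R" using as(4,5) tR by auto
    show "(p = t * R \<longrightarrow> s * res Plus u \<le> 0) \<and> (p = R \<longrightarrow> s * res Plus u \<ge> 0) \<and>
      (q = - (t * R) \<longrightarrow> res Minus u \<le> 0) \<and> (q = t * R \<longrightarrow> res Minus u \<ge> 0)"
      using key[OF as(1-3) pq(2,3)] unfolding pq(1) .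
  qed
  \<comment> \<open>For negative p the lower end of the interval is the outer side, hence the
    orientation -s.\<close>
  have b2: "box_signs e (K0 + 1) ?H (- s) (- R) (- (t * R)) (- (t * R)) (t * R)"
    unfolding box_signs_def
  proof (intro allI impI)
    fix \<phi> p q u
    assume as: "continuous_on UNIV \<phi>" "\<forall>t. \<bar>\<phi> t - hl a b t\<bar> \<le> e * \<bar>t\<bar> + (K0 + 1)"
      "int_sol \<phi> ?H (ray p + q) p u" "p \<in> {- R..- (t * R)}" "q \<in> {- (t * R)..t * R}"
    have pq: "\<bar>p\<bar> = - p" "\<bar>p\<bar> \<le> R" "\<bar>q\<bar> \<le> t * R" using as(4,5) tR by auto
    show "(p = - R \<longrightarrow> - s * res Plus u \<le> 0) \<and> (p = - (t * R) \<longrightarrow> - s * res Plus u \<ge> 0) \<and>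
      (q = - (t * R) \<longrightarrow> res Minus u \<le> 0) \<and> (q = t * R \<longrightarrow> res Minus u \<ge> 0)"
      using key[OF as(1-3) pq(2,3)] unfolding pq(1) by auto
  qed
  have s0: "s \<noteq> 0" "- s \<noteq> 0" using s by auto
  have le2: "- R \<le> - (t * R)" using tR by simp
  obtain p1 q1 u1 where 1: "p1 \<in> {t * R..R}" "int_sol f ?H (ray p1 + q1) p1 u1" "BC m \<alpha> \<eta> u1"
    by (rule box_solution[OF f K0(2) e0 e(2) K0(1) h(2) tR(2) q12 s0(1) b1]) (rule that)
  obtain p2 q2 u2 where 2: "p2 \<in> {- R..- (t * R)}" "int_sol f ?H (ray p2 + q2) p2 u2" "BC m \<alpha> \<eta> u2"
    by (rule box_solution[OF f K0(2) e0 e(2) K0(1) h(2) le2 q12 s0(2) b2]) (rule that)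
  have "p2 < 0" "0 < p1" using 1(1) 2(1) tR by auto
  then show ?thesis by (rule that[OF h(1) 1(2,3) 2(2,3)])
qed

end

theorem theorem7p1:
  fixes m :: "sign \<Rightarrow> nat"
    and \<alpha> \<eta> :: "sign \<Rightarrow> nat \<Rightarrow> real"
    and f :: "real \<Rightarrow> real"
    and f_pinf f_minf :: real
  assumes "\<And>\<sigma>. m \<sigma> \<ge> 1"
    and "\<And>\<sigma>. \<alpha> \<sigma> \<in> A_plus (m \<sigma>)"
    and "\<And>\<sigma> i. i \<in> {1..m \<sigma>} \<Longrightarrow> \<eta> \<sigma> i \<in> {-1<..<1}"
    and "continuous_on UNIV f"
    and "((\<lambda>s. f s / s) \<longlongrightarrow> f_pinf) at_top"
    and "((\<lambda>s. f s / s) \<longlongrightarrow> f_minf) at_bot"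
    and "f_pinf > 0"
    and "f_minf > 0"
  shows "((\<exists>k::nat. 1 \<in> Lambda1 m \<alpha> \<eta> k f_pinf f_minf) \<longrightarrow>
            (\<forall>h\<in>L1. \<exists>u. is_solution m \<alpha> \<eta> f h u)) \<and>
         ((\<exists>k::nat. k \<ge> 1 \<and> 1 \<in> Lambda0 m \<alpha> \<eta> k f_pinf f_minf) \<longrightarrow>
            (\<exists>h0\<in>L1. \<exists>h2\<in>L1.
               \<not> (\<exists>u. is_solution m \<alpha> \<eta> f h0 u) \<and>
               (\<exists>u1 u2. is_solution m \<alpha> \<eta> f h2 u1 \<and> is_solution m \<alpha> \<eta> f h2 u2 \<and>
                  (\<exists>x\<in>{-1..1}. u1 x \<noteq> u2 x))))"
proof -
  interpret bvp f_pinf f_minf m \<alpha> \<eta>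
    using assms by unfold_locales auto
  note f = assms(4)
  have dev: "\<forall>e>0. \<exists>K0\<ge>0. \<forall>s. \<bar>f s - hl f_pinf f_minf s\<bar> \<le> e * \<bar>s\<bar> + K0"
    using asymptotically_half_linear[OF f assms(5,6)] by metis
  note sol = is_solution_iff[OF f]
  show ?thesis
  proof (intro conjI impI ballI)
    fix h :: "real \<Rightarrow> real"
    assume "\<exists>k. 1 \<in> Lambda1 m \<alpha> \<eta> k f_pinf f_minf" and h: "h \<in> L1"
    then have sg: "end_residual Plus * end_residual Minus < 0" using Lambda1_sign by blast
    have "h absolutely_integrable_on {-1..1}" using h by (simp add: L1_iff)
    then have "continuous_on {-1..1} (\<lambda>x. - int2 h x)"
      by (intro continuous_on_minus continuous_on_int2)
    from solvable[OF f dev this sg] show "\<exists>u. is_solution m \<alpha> \<eta> f h u"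
      unfolding sol[OF h] by blast
  next
    assume "\<exists>k\<ge>1. 1 \<in> Lambda0 m \<alpha> \<eta> k f_pinf f_minf"
    then have sg: "end_residual Plus * end_residual Minus > 0" using Lambda0_sign by blast
    obtain h0 where h0: "h0 \<in> L1" "\<And>c d u. int_sol f (\<lambda>x. - int2 h0 x) c d u \<Longrightarrow> \<not> BC m \<alpha> \<eta> u"
      by (rule no_solution[OF f dev sg]) (rule that)
    obtain h2 c1 d1 u1 c2 d2 u2 where h2: "h2 \<in> L1"
      and u1: "int_sol f (\<lambda>x. - int2 h2 x) c1 d1 u1" "BC m \<alpha> \<eta> u1"
      and u2: "int_sol f (\<lambda>x. - int2 h2 x) c2 d2 u2" "BC m \<alpha> \<eta> u2" and d: "d2 < 0" "0 < d1"
      by (rule two_solutions[OF f dev sg]) (rule that)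
    \<comment> \<open>Solutions that agree on [-1,1] have the same integral terms and the same
      forcing, hence equal affine parts, against d2 < 0 < d1.\<close>
    have ne: "\<exists>x\<in>{-1..1}. u1 x \<noteq> u2 x"
    proof (rule ccontr)
      assume "\<not> (\<exists>x\<in>{-1..1}. u1 x \<noteq> u2 x)"
      then have eq: "\<And>x. x \<in> {-1..1} \<Longrightarrow> u1 x = u2 x" by blast
      have i: "int2 (\<lambda>s. f (u1 s)) x = int2 (\<lambda>s. f (u2 s)) x" if "x \<in> {-1..1}" for x
        unfolding int2_def by (rule Henstock_Kurzweil_Integration.integral_cong) (use eq that in auto)
      have "c1 + d1 * (x + 1) = c2 + d2 * (x + 1)" if x: "x \<in> {-1..1}" for x
        using int_solD(2)[OF u1(1) x] int_solD(2)[OF u2(1) x] eq[OF x] i[OF x] by linarith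
      from this[of "-1"] this[of 1] show False using d by simp
    qed
    have "\<not> (\<exists>u. is_solution m \<alpha> \<eta> f h0 u)" unfolding sol[OF h0(1)] using h0(2) by blast
    moreover have "is_solution m \<alpha> \<eta> f h2 u1" "is_solution m \<alpha> \<eta> f h2 u2"
      unfolding sol[OF h2] using u1 u2 by blast+
    ultimately show "\<exists>h0\<in>L1. \<exists>h2\<in>L1. \<not> (\<exists>u. is_solution m \<alpha> \<eta> f h0 u) \<and>
       (\<exists>u1 u2. is_solution m \<alpha> \<eta> f h2 u1 \<and> is_solution m \<alpha> \<eta> f h2 u2 \<and> (\<exists>x\<in>{-1..1}. u1 x \<noteq> u2 x))"
      using h0(1) h2 ne by blast
  qed
qed

end
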